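(* Let $\beta\in(0,1]$ and consider the scale $a(n,t)=n^t$. Then for every $\alpha\in\mathcal D$, every $\gamma\in(0,1)$ and every corresponding Kochergin flow $(T^{f,\gamma}_t)_{t\in\mathbb R}$ (the special flow over the rotation by $\alpha$ under a roof function $f$ with a power singularity of exponent $\gamma$), the $\beta$-slow entropy with respect to this scale satisfies $h_s^\beta(T^{f,\gamma}_t)=1+\gamma$.
   Context: **Slow entropy.** Let $(T_t)_{t\in\mathbb R}$ be a measure-preserving flow on a probability Borel space $(X,\mathcal B,\mu)$ and $\mathcal P=\{P_1,\dots,P_k\}$ a finite measurable partition of $X$. For $r>0$ let $\Omega_{k,r}$ be the set of (measurable) $w=(w_t)_{t\in[0,r]}$ with $w_t\in\{1,\dots,k\}$, with the Hamming distance $d_r(w,w')=\frac1r\left(r-\lambda\{s\in[0,r]: w_s=w'_s\}\right)$, $\lambda$ being Lebesgue measure. The $\mathcal P,r$-name of $x\in X$ is $\phi_{\mathcal P,r}(x)=(N_t(x))_{t\in[0,r]}$ where $N_t(x)=i$ iff $T_tx\in P_i$. Put $\nu=(\phi_{\mathcal P,r})_*\mu$. For $\epsilon>0$, $\beta\in(0,1]$, let $S^r_{\mathcal P}(\epsilon,\beta)$ be the minimal number of $d_r$-balls of radius $\epsilon$ whose union has $\nu$-measure greater than $\beta-\epsilon$. Given a scale $a(n,t)$ ($n\in\mathbb N$, $t>0$), with $a(n,t)\to\infty$ as $n\to\infty$ for each fixed $t$, let $$A(\mathcal P,\epsilon,\beta)=\sup\Big\{t>0:\ \liminf_{r\to+\infty}\frac{S^r_{\mathcal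 P}(\epsilon,\beta)}{a([r],t)}>0\Big\}$$ (supremum of the empty set being $0$), $A^\beta(\mathcal P)=\lim_{\epsilon\to0}A(\mathcal P,\epsilon,\beta)$, and $h^\beta_s(T_t)=\sup_{\mathcal P}A^\beta(\mathcal P)$, the supremum over all finite measurable partitions. **Kochergin flows.** Let $\mathbb T=\mathbb R/\mathbb Z$ with Lebesgue measure $\lambda$, $\alpha\in\mathbb R\setminus\mathbb Q$, $Tx=x+\alpha$ mod $1$. Let $\gamma\in(0,1)$, $h(x)=x^{-\gamma}$ on $(0,1)$, and let $f\in C^2(\mathbb T\setminus\{0\})$, $f>0$, satisfy, for some constants $A_i,B_i>0$ ($i=1,2,3$), identifying $\mathbb T\setminus\{0\}$ with $(0,1)$ (so $x\to0^-$ means $x\to1^-$ in $(0,1)$): $$\lim_{x\to0^+}\frac{f(x)}{h(x)}=A_1,\quad \lim_{x\to0^-}\frac{f(x)}{h(1-x)}=B_1,$$ $$\lim_{x\to0^+}\frac{f'(x)}{h'(x)}=A_2,\quad \lim_{x\to0^-}\frac{f'(x)}{h'(1-x)}=-B_2,$$ $$\lim_{x\to0^+}\frac{f''(x)}{h''(x)}=A_3,\quad \lim_{x\to0^-}\frac{f''(x)}{h''(1-x)}=B_3.$$ The special flow $(T^f_t)=(T^{f,\gamma}_t)$ acts on $\mathbb T^f=\{(x,s):x\in\mathbb T,\ 0\le s<f(x)\}$, equipped with the measure $\mu^f$ equal to the product of Lebesgue measures restricted to $\mathbb T^f$, normalized to be a probability measure; points move vertically with unit speed and $(x,f(x))$ is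 identified with $(Tx,0)$: $T^f_t(x,s)=(T^{N}x,\ s+t-f^{(N)}(x))$ with $N\in\mathbb Z$ the unique integer such that $f^{(N)}(x)\le s+t<f^{(N+1)}(x)$, where $f^{(n)}(x)=\sum_{i=0}^{n-1}f(T^ix)$ for $n\ge1$, $f^{(0)}=0$, $f^{(-n)}(x)=-\sum_{i=1}^nf(T^{-i}x)$. (The null set of points whose orbit meets the singularity is discarded.) This flow is called a Kochergin flow with frequency $\alpha$ and exponent $\gamma$. **Diophantine set.** Let $(q_n)$ be the sequence of denominators of the continued fraction convergents of $\alpha$. $\mathcal D$ is the set of $\alpha\in\mathbb R\setminus\mathbb Q$ for which there is a constant $C(\alpha)$ with $q_{n+1}\le C(\alpha)\,q_n\log q_n(\log n)^2$ for all $n\ge2$. *)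

theory Defs
  imports "HOL-Analysis.Analysis"
begin

section \<open>Slow entropy of a flow\<close>

text \<open>
  The number of balls, the growth exponents and the entropy take values in \<^typ>\<open>ennreal\<close>. There the
  infimum of the empty set is \<open>\<infinity>\<close> and the supremum of the empty set is \<open>0\<close>, which is the required
  convention for the growth exponent.
\<close>

definition word_space :: "nat \<Rightarrow> real \<Rightarrow> (real \<Rightarrow> nat) set" where
  "word_space k r = extensional {0..r} \<inter> measurable (lebesgue_on {0..r}) (count_space {1..k})"

definition hamming_dist :: "real \<Rightarrow> (real \<Rightarrow> nat) \<Rightarrow> (real \<Rightarrow> nat) \<Rightarrow> real" where
  "hamming_dist r w w' = 1 / r * (r - measure lebesgue {s\<in>{0..r}. w s = w' s})"

definition hamming_ball :: "nat \<Rightarrow> real \<Rightarrow> (real \<Rightarrow> nat) \<Rightarrow> real \<Rightarrow> (real \<Rightarrow> nat) set" where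
  "hamming_ball k r w \<epsilon> = {w' \<in> word_space k r. hamming_dist r w w' < \<epsilon>}"

text \<open>
  The word space carries the \<open>\<sigma>\<close>-algebra generated by the balls. As the Hamming pseudometric is
  separable, this is its Borel \<open>\<sigma>\<close>-algebra.
\<close>

definition word_algebra :: "nat \<Rightarrow> real \<Rightarrow> (real \<Rightarrow> nat) measure" where
  "word_algebra k r =
     sigma (word_space k r) {hamming_ball k r w \<epsilon> | w \<epsilon>. w \<in> word_space k r \<and> 0 < \<epsilon>}"

definition finite_measurable_partition :: "'a measure \<Rightarrow> nat \<Rightarrow> (nat \<Rightarrow> 'a set) \<Rightarrow> bool" where
  "finite_measurable_partition M k P \<longleftrightarrow>
     inj_on P {1..k} \<and> partition_on (space M) (P ` {1..k}) \<and> (\<forall>i\<in>{1..k}. P i \<in> sets M)"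

definition name_map ::
    "(real \<Rightarrow> 'a \<Rightarrow> 'a) \<Rightarrow> nat \<Rightarrow> (nat \<Rightarrow> 'a set) \<Rightarrow> real \<Rightarrow> 'a \<Rightarrow> real \<Rightarrow> nat" where
  "name_map T k P r x = (\<lambda>t\<in>{0..r}. THE i. i \<in> {1..k} \<and> T t x \<in> P i)"

definition name_measure ::
    "'a measure \<Rightarrow> (real \<Rightarrow> 'a \<Rightarrow> 'a) \<Rightarrow> nat \<Rightarrow> (nat \<Rightarrow> 'a set) \<Rightarrow> real \<Rightarrow> (real \<Rightarrow> nat) measure" where
  "name_measure M T k P r = distr M (word_algebra k r) (name_map T k P r)"

definition covering_number ::
    "'a measure \<Rightarrow> (real \<Rightarrow> 'a \<Rightarrow> 'a) \<Rightarrow> nat \<Rightarrow> (nat \<Rightarrow> 'a set) \<Rightarrow> real \<Rightarrow> real \<Rightarrow> real \<Rightarrow> ennreal" where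
  "covering_number M T k P r \<epsilon> \<beta> =
     (INF C \<in> {C. finite C \<and> C \<subseteq> word_space k r \<and>
                  measure (name_measure M T k P r) (\<Union>w\<in>C. hamming_ball k r w \<epsilon>) > \<beta> - \<epsilon>}.
        of_nat (card C))"

definition growth_exponent ::
    "(nat \<Rightarrow> real \<Rightarrow> real) \<Rightarrow> 'a measure \<Rightarrow> (real \<Rightarrow> 'a \<Rightarrow> 'a) \<Rightarrow> nat \<Rightarrow> (nat \<Rightarrow> 'a set) \<Rightarrow>
       real \<Rightarrow> real \<Rightarrow> ennreal" where
  "growth_exponent a M T k P \<epsilon> \<beta> =
     Sup {ennreal t | t. t > 0 \<and>
       Liminf at_top (\<lambda>r. covering_number M T k P r \<epsilon> \<beta> / ennreal (a (nat \<lfloor>r\<rfloor>) t)) > 0}"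

definition partition_entropy ::
    "(nat \<Rightarrow> real \<Rightarrow> real) \<Rightarrow> 'a measure \<Rightarrow> (real \<Rightarrow> 'a \<Rightarrow> 'a) \<Rightarrow> nat \<Rightarrow> (nat \<Rightarrow> 'a set) \<Rightarrow>
       real \<Rightarrow> ennreal" where
  "partition_entropy a M T k P \<beta> = Lim (at_right 0) (\<lambda>\<epsilon>. growth_exponent a M T k P \<epsilon> \<beta>)"

definition slow_entropy ::
    "(nat \<Rightarrow> real \<Rightarrow> real) \<Rightarrow> real \<Rightarrow> 'a measure \<Rightarrow> (real \<Rightarrow> 'a \<Rightarrow> 'a) \<Rightarrow> ennreal" where
  "slow_entropy a \<beta> M T =
     (SUP (k, P) \<in> {(k, P). finite_measurable_partition M k P}. partition_entropy a M T k P \<beta>)"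


section \<open>Kochergin flows\<close>

text \<open>
  The circle is represented by the interval \<open>[0,1)\<close>, and a roof function on the circle minus the
  origin by its values on \<open>(0,1)\<close>.
\<close>

definition rotation :: "real \<Rightarrow> int \<Rightarrow> real \<Rightarrow> real" where
  "rotation \<alpha> n x = frac (x + of_int n * \<alpha>)"

definition birkhoff_sum :: "real \<Rightarrow> (real \<Rightarrow> real) \<Rightarrow> int \<Rightarrow> real \<Rightarrow> real" where
  "birkhoff_sum \<alpha> f n x =
     (if 0 \<le> n then \<Sum>i\<in>{0..<n}. f (rotation \<alpha> i x)
      else - (\<Sum>i\<in>{1..-n}. f (rotation \<alpha> (-i) x)))"

text \<open>The points whose orbit meets the singularity are removed from the space.\<close>

definition special_flow_space :: "real \<Rightarrow> (real \<Rightarrow> real) \<Rightarrow> (real \<times> real) set" where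
  "special_flow_space \<alpha> f =
     {(x, s). x \<in> {0..<1} \<and> (\<forall>n. rotation \<alpha> n x \<noteq> 0) \<and> 0 \<le> s \<and> s < f x}"

definition special_flow_measure :: "real \<Rightarrow> (real \<Rightarrow> real) \<Rightarrow> (real \<times> real) measure" where
  "special_flow_measure \<alpha> f =
     uniform_measure (restrict_space lborel (special_flow_space \<alpha> f)) (special_flow_space \<alpha> f)"

definition special_flow :: "real \<Rightarrow> (real \<Rightarrow> real) \<Rightarrow> real \<Rightarrow> real \<times> real \<Rightarrow> real \<times> real" where
  "special_flow \<alpha> f t = (\<lambda>(x, s).
     let N = (THE N. birkhoff_sum \<alpha> f N x \<le> s + t \<and> s + t < birkhoff_sum \<alpha> f (N + 1) x)
     in (rotation \<alpha> N x, s + t - birkhoff_sum \<alpha> f N x))"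

definition kochergin_roof :: "real \<Rightarrow> (real \<Rightarrow> real) \<Rightarrow> bool" where
  "kochergin_roof \<gamma> f \<longleftrightarrow>
     (\<forall>x\<in>{0<..<1}. f x > 0) \<and>
     f differentiable_on {0<..<1} \<and> deriv f differentiable_on {0<..<1} \<and>
     continuous_on {0<..<1} (deriv (deriv f)) \<and>
     (let h = (\<lambda>x. x powr (-\<gamma>)) in
      \<exists>A\<^sub>1>0. \<exists>A\<^sub>2>0. \<exists>A\<^sub>3>0. \<exists>B\<^sub>1>0. \<exists>B\<^sub>2>0. \<exists>B\<^sub>3>0.
       ((\<lambda>x. f x / h x) \<longlongrightarrow> A\<^sub>1) (at_right 0) \<and>
       ((\<lambda>x. f x / h (1 - x)) \<longlongrightarrow> B\<^sub>1) (at_left 1) \<and>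
       ((\<lambda>x. deriv f x / deriv h x) \<longlongrightarrow> A\<^sub>2) (at_right 0) \<and>
       ((\<lambda>x. deriv f x / deriv h (1 - x)) \<longlongrightarrow> - B\<^sub>2) (at_left 1) \<and>
       ((\<lambda>x. deriv (deriv f) x / deriv (deriv h) x) \<longlongrightarrow> A\<^sub>3) (at_right 0) \<and>
       ((\<lambda>x. deriv (deriv f) x / deriv (deriv h) (1 - x)) \<longlongrightarrow> B\<^sub>3) (at_left 1))"


section \<open>The Diophantine condition\<close>

fun complete_quotient :: "real \<Rightarrow> nat \<Rightarrow> real" where
  "complete_quotient \<alpha> 0 = \<alpha>"
| "complete_quotient \<alpha> (Suc n) = 1 / frac (complete_quotient \<alpha> n)"

definition partial_quotient :: "real \<Rightarrow> nat \<Rightarrow> int" where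
  "partial_quotient \<alpha> n = \<lfloor>complete_quotient \<alpha> n\<rfloor>"

text \<open>
  The denominators are indexed so that \<open>q\<^sub>0 = 1\<close> belongs to the convergent \<open>\<lfloor>\<alpha>\<rfloor>\<close>. With this indexing
  \<open>q\<^sub>n \<ge> 2\<close> for \<open>n \<ge> 2\<close>, so the logarithms in the condition below are positive.
\<close>

fun conv_denom :: "real \<Rightarrow> nat \<Rightarrow> int" where
  "conv_denom \<alpha> 0 = 1"
| "conv_denom \<alpha> (Suc 0) = partial_quotient \<alpha> 1"
| "conv_denom \<alpha> (Suc (Suc n)) =
     partial_quotient \<alpha> (Suc (Suc n)) * conv_denom \<alpha> (Suc n) + conv_denom \<alpha> n"

definition diophantine_set :: "real set" where
  "diophantine_set = {\<alpha>. \<alpha> \<notin> \<rat> \<and>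
     (\<exists>C. \<forall>n\<ge>2. real_of_int (conv_denom \<alpha> (n + 1)) \<le>
        C * real_of_int (conv_denom \<alpha> n) * ln (real_of_int (conv_denom \<alpha> n)) * (ln (real n))\<^sup>2)}"

end

theory Submission
  imports Defs "HOL-Analysis.Kronecker_Approximation_Theorem"
begin

text \<open>
  Write \<open>S\<^sub>m(x)\<close> for the Birkhoff sum of the roof over the first \<open>m\<close> points of the orbit of \<open>x\<close>. Both
  bounds rest on one property of the rotation number: \<open>\<bar>i * \<alpha> - p\<bar> \<ge> c * i\<^sup>-\<^sup>(\<^sup>1\<^sup>+\<^sup>\<kappa>\<^sup>)\<close> for
  every \<open>\<kappa> > 0\<close> (\<open>diophantine_lower_bound\<close>). It separates the points of a finite orbit and, with
  Dirichlet's theorem, makes every orbit of length \<open>n\<close> enter \<open>(0, n\<^sup>-\<^sup>1\<^sup>+\<^sup>\<kappa>)\<close>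
  (\<open>orbit_visits_zero\<close>). All losses of a factor \<open>r\<^sup>\<kappa>\<close> are harmless, since the scale is polynomial.

  Upper bound. Off a set of small measure the first \<open>O(r)\<close> points of an orbit keep a distance
  \<open>r\<^sup>-\<^sup>1\<^sup>-\<^sup>\<kappa>\<close> from the singularity; as they are separated, the derivatives of all \<open>S\<^sub>m\<close> with
  \<open>m = O(r)\<close> are at most about \<open>r\<^sup>(\<^sup>1\<^sup>+\<^sup>\<gamma>\<^sup>)\<^sup>(\<^sup>1\<^sup>+\<^sup>\<kappa>\<^sup>)\<close> (\<open>bsum_close\<close>). Hence two such points at similar heights whose base
  coordinates differ by a small multiple of the inverse of this number stay close up to time \<open>r\<close>,
  except for short times near the roof, and their names are close by inner regularity of Lebesgue
  measure (\<open>covering_number_upper\<close>).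

  Lower bound. The partition is a grid below a high level. The claim (\<open>few_distant_matches\<close>) is that
  two orbits, whatever their starting points, spend at most a quarter of the time \<open>[0, r]\<close> in a common
  grid cell at horizontal distance more than \<open>r\<^sup>-\<^sup>(\<^sup>1\<^sup>+\<^sup>\<gamma>\<^sup>)\<^sup>+\<^sup>\<kappa>\<close>. So points with close names are for a
  positive proportion of the time within this horizontal distance of each other (unless the time above
  the high level is long, which is rare). As the flow preserves the measure, the part of a Hamming ball
  outside a fixed small proportion of the space has measure at most a constant times \<open>r\<^sup>-\<^sup>(\<^sup>1\<^sup>+\<^sup>\<gamma>\<^sup>)\<^sup>+\<^sup>\<kappa>\<close>
  (\<open>long_closeness_measure_le\<close>, \<open>slow_entropy_ge_exponent\<close>).

  To prove the claim, sort the matching times by the size \<open>\<delta> = L\<^sup>-\<^sup>(\<^sup>1\<^sup>+\<^sup>\<gamma>\<^sup>)\<close> of the horizontal distance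
  and look at a time window slightly longer than \<open>L\<close>. Two matching times at which the difference of the
  numbers of steps made by the two orbits is not the same would give a small value of \<open>\<bar>i * \<alpha> - p\<bar>\<close> with
  \<open>i\<close> about the length of the window, so this difference is constant (\<open>steps_difference_constant\<close>; here
  \<open>\<gamma> > 0\<close> enters). If both \<open>n\<close> and \<open>n + m\<close> are matching steps, then \<open>S\<^sub>m(y) - S\<^sub>m(y + \<delta>)\<close> is bounded at
  the \<open>n\<close>-th orbit point \<open>y\<close>. As a function of \<open>y\<close> this difference is monotone between the singularities of
  \<open>S\<^sub>m\<close>, at a rate of at least \<open>\<delta>\<close> times the minimum of the second derivative of \<open>S\<^sub>m\<close>, and a single visit
  near the singularity makes that derivative huge. So each of the \<open>O(m)\<close> arcs contains only few orbit
  points of this kind (\<open>card_hits_le\<close>). By an inclusion-exclusion over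
  many shifts the matching steps occupy only a proportion \<open>L\<^sup>-\<^sup>e\<close> of the window (\<open>few_matched_steps\<close>),
  and these proportions are summable over the dyadic classes of \<open>\<delta>\<close>.
\<close>

section \<open>Continued fractions and the rotation\<close>

fun conv_num :: "real \<Rightarrow> nat \<Rightarrow> int" where
  "conv_num \<alpha> 0 = partial_quotient \<alpha> 0"
| "conv_num \<alpha> (Suc 0) = partial_quotient \<alpha> 1 * partial_quotient \<alpha> 0 + 1"
| "conv_num \<alpha> (Suc (Suc n)) =
     partial_quotient \<alpha> (Suc (Suc n)) * conv_num \<alpha> (Suc n) + conv_num \<alpha> n"

definition conv_err :: "real \<Rightarrow> nat \<Rightarrow> real" where
  "conv_err \<alpha> n = of_int (conv_denom \<alpha> n) * \<alpha> - of_int (conv_num \<alpha> n)"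

lemma frac_irrational: "x \<notin> \<rat> \<Longrightarrow> frac x \<notin> \<rat>"
  by (metis Rats_add Rats_of_int add.commute frac_def diff_add_cancel)

lemma complete_quotient_irrational:
  assumes "\<alpha> \<notin> \<rat>"
  shows "complete_quotient \<alpha> n \<notin> \<rat>"
proof (induction n)
  case (Suc n)
  then have "frac (complete_quotient \<alpha> n) \<notin> \<rat>"
    by (rule frac_irrational)
  then show ?case
    by (metis Rats_inverse complete_quotient.simps(2) inverse_eq_divide inverse_inverse_eq)
qed (use assms in auto)

lemma frac_complete_quotient:
  assumes "\<alpha> \<notin> \<rat>"
  shows "0 < frac (complete_quotient \<alpha> n)" "frac (complete_quotient \<alpha> n) < 1"
proof -
  have "complete_quotient \<alpha> n \<notin> \<int>"
    using complete_quotient_irrational[OF assms, of n] Ints_subset_Rats by blast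
  then show "0 < frac (complete_quotient \<alpha> n)" "frac (complete_quotient \<alpha> n) < 1"
    by (auto simp: frac_gt_0_iff frac_lt_1)
qed

lemma partial_quotient_ge_1:
  assumes "\<alpha> \<notin> \<rat>"
  shows "1 \<le> partial_quotient \<alpha> (Suc n)"
  using frac_complete_quotient[OF assms, of n] by (simp add: partial_quotient_def)

lemma conv_err_0: "conv_err \<alpha> 0 = frac \<alpha>"
  by (simp add: conv_err_def partial_quotient_def frac_def)

text \<open>
  The complete quotients satisfy \<open>\<xi>\<^sub>n\<^sub>+\<^sub>1 * err\<^sub>n + err\<^sub>n\<^sub>-\<^sub>1 = 0\<close>; this form shows at once that the errors
  alternate in sign and decrease.
\<close>

lemma conv_err_Suc:
  assumes "\<alpha> \<notin> \<rat>"
  shows "conv_err \<alpha> (Suc n) = - conv_err \<alpha> n * frac (complete_quotient \<alpha> (Suc n))"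
proof (induction n)
  case 0
  have pos: "frac \<alpha> > 0" using frac_complete_quotient(1)[OF assms, of 0] by simp
  have "conv_err \<alpha> (Suc 0) = of_int (partial_quotient \<alpha> 1) * frac \<alpha> - 1"
    by (simp add: conv_err_def partial_quotient_def frac_def algebra_simps)
  also have "\<dots> = of_int (partial_quotient \<alpha> 1) * frac \<alpha> - (1 / frac \<alpha>) * frac \<alpha>"
    using pos by simp
  also have "\<dots> = - frac \<alpha> * frac (complete_quotient \<alpha> (Suc 0))"
    by (simp add: partial_quotient_def frac_def[of "1 / frac \<alpha>"] algebra_simps)
  finally show ?case by (simp add: conv_err_0)
next
  case (Suc n)
  let ?f = "frac (complete_quotient \<alpha> (Suc n))"
  have pos: "?f > 0" using frac_complete_quotient(1)[OF assms] by blast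
  then have prev: "conv_err \<alpha> n = - conv_err \<alpha> (Suc n) * (1 / ?f)"
    using Suc by simp
  have "conv_err \<alpha> (Suc (Suc n)) = of_int (partial_quotient \<alpha> (Suc (Suc n))) * conv_err \<alpha> (Suc n) + conv_err \<alpha> n"
    by (simp add: conv_err_def algebra_simps)
  also have "\<dots> = - conv_err \<alpha> (Suc n) * (1 / ?f - of_int (partial_quotient \<alpha> (Suc (Suc n))))"
    by (subst prev) (simp add: algebra_simps)
  also have "1 / ?f - of_int (partial_quotient \<alpha> (Suc (Suc n))) = frac (complete_quotient \<alpha> (Suc (Suc n)))"
    by (simp add: partial_quotient_def frac_def[of "complete_quotient \<alpha> (Suc (Suc n))"]
        del: complete_quotient.simps) (simp only: complete_quotient.simps)
  finally show ?case .
qed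

lemma conv_err_props:
  assumes "\<alpha> \<notin> \<rat>"
  shows "conv_err \<alpha> n \<noteq> 0" "\<bar>conv_err \<alpha> (Suc n)\<bar> \<le> \<bar>conv_err \<alpha> n\<bar>"
    "conv_err \<alpha> n * conv_err \<alpha> (Suc n) < 0"
proof -
  show nz: "conv_err \<alpha> n \<noteq> 0" for n
  proof (induction n)
    case 0
    then show ?case using frac_complete_quotient(1)[OF assms, of 0] by (simp add: conv_err_0)
  next
    case (Suc n)
    then show ?case using frac_complete_quotient(1)[OF assms, of "Suc n"] conv_err_Suc[OF assms, of n] by auto
  qed
  show "\<bar>conv_err \<alpha> (Suc n)\<bar> \<le> \<bar>conv_err \<alpha> n\<bar>"
    using frac_complete_quotient[OF assms, of "Suc n"]
    by (simp add: conv_err_Suc[OF assms] abs_mult mult_left_le del: complete_quotient.simps)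
  have "conv_err \<alpha> n * conv_err \<alpha> (Suc n) = - ((conv_err \<alpha> n)\<^sup>2 * frac (complete_quotient \<alpha> (Suc n)))"
    by (simp add: conv_err_Suc[OF assms] power2_eq_square)
  moreover have "(conv_err \<alpha> n)\<^sup>2 * frac (complete_quotient \<alpha> (Suc n)) > 0"
    using frac_complete_quotient(1)[OF assms, of "Suc n"] nz[of n] by (intro mult_pos_pos) auto
  ultimately show "conv_err \<alpha> n * conv_err \<alpha> (Suc n) < 0" by linarith
qed

lemma conv_det:
  "conv_num \<alpha> (Suc n) * conv_denom \<alpha> n - conv_num \<alpha> n * conv_denom \<alpha> (Suc n) = (-1) ^ n"
  by (induction n) (simp_all add: algebra_simps)

lemma conv_denom_pos:
  assumes "\<alpha> \<notin> \<rat>"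
  shows "1 \<le> conv_denom \<alpha> n \<and> 1 \<le> conv_denom \<alpha> (Suc n) \<and> int (Suc n) \<le> conv_denom \<alpha> (Suc n)"
proof (induction n)
  case 0
  then show ?case using partial_quotient_ge_1[OF assms, of 0] by simp
next
  case (Suc n)
  have "conv_denom \<alpha> (Suc n) \<le> partial_quotient \<alpha> (Suc (Suc n)) * conv_denom \<alpha> (Suc n)"
    using partial_quotient_ge_1[OF assms, of "Suc n"] Suc by simp
  then have "conv_denom \<alpha> (Suc n) + 1 \<le> conv_denom \<alpha> (Suc (Suc n))"
    using Suc by (simp only: conv_denom.simps) linarith
  then show ?case using Suc by linarith
qed

text \<open>
  Consecutive convergents form a basis of the integer lattice. In this basis the coefficients
  of a vector with first coordinate below \<open>q\<^sub>n\<^sub>+\<^sub>1\<close> do not have the same sign and the first one is not \<open>0\<close>;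
  since the errors alternate in sign, the two contributions cannot cancel.
\<close>

lemma best_approximation:
  fixes i p :: int
  assumes "\<alpha> \<notin> \<rat>" "0 < i" "i < conv_denom \<alpha> (Suc n)"
  shows "\<bar>conv_err \<alpha> n\<bar> \<le> \<bar>of_int i * \<alpha> - of_int p\<bar>"
proof -
  let ?q = "conv_denom \<alpha>" and ?p = "conv_num \<alpha>" and ?e = "conv_err \<alpha>"
  define D :: int where "D = (-1) ^ n"
  have D: "?p (Suc n) * ?q n - ?p n * ?q (Suc n) = D" "D * D = 1"
    using conv_det[of \<alpha> n] by (simp_all add: D_def flip: power_add)
  (* coordinates in the basis of the two convergents, by Cramer's rule *)
  define u where "u = D * (i * ?p (Suc n) - p * ?q (Suc n))"
  define v where "v = D * (p * ?q n - i * ?p n)"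
  have "u * ?q n + v * ?q (Suc n) = D * i * (?p (Suc n) * ?q n - ?p n * ?q (Suc n))"
    by (simp add: u_def v_def algebra_simps)
  then have i: "i = u * ?q n + v * ?q (Suc n)" using D by (simp add: mult.assoc mult.left_commute)
  have "u * ?p n + v * ?p (Suc n) = D * p * (?p (Suc n) * ?q n - ?p n * ?q (Suc n))"
    by (simp add: u_def v_def algebra_simps)
  then have p: "p = u * ?p n + v * ?p (Suc n)" using D by (simp add: mult.assoc mult.left_commute)
  have eq: "of_int i * \<alpha> - of_int p = of_int u * ?e n + of_int v * ?e (Suc n)"
    unfolding i p by (simp add: conv_err_def algebra_simps)
  have q: "1 \<le> ?q n" "1 \<le> ?q (Suc n)" using conv_denom_pos[OF assms(1), of n] by auto
  have u: "u \<noteq> 0"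
  proof
    assume u0: "u = 0"
    then have "0 < v" using i assms(2) q by (simp add: zero_less_mult_iff)
    then have "?q (Suc n) \<le> v * ?q (Suc n)" using q by simp
    then show False using i u0 assms(3) by simp
  qed
  have uv: "u * v \<le> 0"
  proof (rule ccontr)
    assume "\<not> ?thesis"
    then consider "u > 0" "v > 0" | "u < 0" "v < 0" by (auto simp: zero_less_mult_iff not_le)
    then show False
    proof cases
      case 1
      then have "?q (Suc n) \<le> v * ?q (Suc n)" "0 < u * ?q n" using q by simp_all
      then show False using i assms(3) by linarith
    next
      case 2
      then have "v * ?q (Suc n) < 0" "u * ?q n < 0" using q by (simp_all add: mult_neg_pos)
      then show False using i assms(2) by linarith
    qed
  qed
  have "0 \<le> (of_int u * ?e n) * (of_int v * ?e (Suc n))"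
  proof -
    have "(of_int u * ?e n) * (of_int v * ?e (Suc n)) = of_int (u * v) * (?e n * ?e (Suc n))"
      by simp
    also have "\<dots> \<ge> 0"
      using uv conv_err_props(3)[OF assms(1), of n] by (intro mult_nonpos_nonpos) (auto simp: of_int_le_0_iff simp del: of_int_mult)
    finally show ?thesis .
  qed
  then have "\<bar>of_int u * ?e n + of_int v * ?e (Suc n)\<bar> = \<bar>of_int u * ?e n\<bar> + \<bar>of_int v * ?e (Suc n)\<bar>"
    by (auto simp: zero_le_mult_iff)
  then have "\<bar>of_int u * ?e n\<bar> \<le> \<bar>of_int i * \<alpha> - of_int p\<bar>" unfolding eq by simp
  moreover have "\<bar>?e n\<bar> \<le> \<bar>of_int u * ?e n\<bar>"
  proof -
    have "1 \<le> \<bar>of_int u :: real\<bar>" using u by linarith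
    then show ?thesis by (simp add: abs_mult mult_le_cancel_right1)
  qed
  ultimately show ?thesis by linarith
qed

text \<open>
  The determinant of two consecutive convergents is \<open>q\<^sub>n\<^sub>+\<^sub>1 * \<bar>err\<^sub>n\<bar> + q\<^sub>n * \<bar>err\<^sub>n\<^sub>+\<^sub>1\<bar>\<close> up to sign.
\<close>

lemma conv_err_lower:
  assumes "\<alpha> \<notin> \<rat>"
  shows "1 / (2 * of_int (conv_denom \<alpha> (Suc n))) \<le> \<bar>conv_err \<alpha> n\<bar>"
proof -
  let ?q = "conv_denom \<alpha>" and ?p = "conv_num \<alpha>" and ?e = "conv_err \<alpha>"
  have q: "1 \<le> ?q n" "1 \<le> ?q (Suc n)" using conv_denom_pos[OF assms(1), of n] by auto
  have mono: "?q n \<le> ?q (Suc n)"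
  proof (cases n)
    case 0
    then show ?thesis using partial_quotient_ge_1[OF assms, of 0] by simp
  next
    case (Suc m)
    have "?q (Suc m) \<le> partial_quotient \<alpha> (Suc (Suc m)) * ?q (Suc m)"
      using partial_quotient_ge_1[OF assms, of "Suc m"] q Suc by simp
    then show ?thesis using Suc conv_denom_pos[OF assms(1), of m]
      by (simp only: conv_denom.simps) linarith
  qed
  have "of_int (?q (Suc n)) * ?e n - of_int (?q n) * ?e (Suc n)
      = real_of_int (?p (Suc n) * ?q n - ?p n * ?q (Suc n))"
    by (simp add: conv_err_def algebra_simps)
  also have "\<dots> = (-1) ^ n" by (simp only: conv_det) simp
  finally have "1 = \<bar>of_int (?q (Suc n)) * ?e n - of_int (?q n) * ?e (Suc n)\<bar>" by simp
  also have "\<dots> \<le> of_int (?q (Suc n)) * \<bar>?e n\<bar> + of_int (?q n) * \<bar>?e (Suc n)\<bar>"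
    using q by (intro order.trans[OF abs_triangle_ineq4]) (simp add: abs_mult)
  also have "\<dots> \<le> of_int (?q (Suc n)) * \<bar>?e n\<bar> + of_int (?q (Suc n)) * \<bar>?e n\<bar>"
    using q mono conv_err_props(2)[OF assms, of n] by (intro add_left_mono mult_mono) auto
  finally show ?thesis using q by (simp add: field_simps)
qed

text \<open>
  The only form in which the Diophantine condition is used. If \<open>q\<^sub>n \<le> i < q\<^sub>n\<^sub>+\<^sub>1\<close>, the best approximation
  property gives \<open>1 / (2 * q\<^sub>n\<^sub>+\<^sub>1)\<close> as a lower bound, and as \<open>n \<le> q\<^sub>n \<le> i\<close>, the condition bounds \<open>q\<^sub>n\<^sub>+\<^sub>1\<close> by a
  multiple of \<open>i * (ln i)\<^sup>3\<close>.
\<close>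

lemma diophantine_lower_bound:
  assumes "\<alpha> \<in> diophantine_set" "0 < \<kappa>"
  obtains c where "0 < c" "c \<le> 1"
    "\<And>(i::nat) (p::int). 0 < i \<Longrightarrow> c * real i powr (- (1 + \<kappa>)) \<le> \<bar>real i * \<alpha> - of_int p\<bar>"
proof -
  let ?q = "conv_denom \<alpha>"
  from assms(1) obtain C0 where irr: "\<alpha> \<notin> \<rat>"
    and C0: "\<And>n. n \<ge> 2 \<Longrightarrow> of_int (?q (n+1)) \<le> C0 * of_int (?q n) * ln (of_int (?q n)) * (ln (real n))\<^sup>2"
    unfolding diophantine_set_def by blast
  define C where "C = max C0 1"
  have q1: "1 \<le> ?q n" for n using conv_denom_pos[OF irr, of n] by auto
  have C: "of_int (?q (Suc n)) \<le> C * of_int (?q n) * ln (of_int (?q n)) * (ln (real n))\<^sup>2" if "n \<ge> 2" for n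
  proof -
    have "C0 * (of_int (?q n) * ln (of_int (?q n)) * (ln (real n))\<^sup>2) \<le> C * (of_int (?q n) * ln (of_int (?q n)) * (ln (real n))\<^sup>2)"
      using q1[of n] by (intro mult_right_mono) (auto simp: C_def)
    then show ?thesis using C0[OF that] by (simp add: mult.assoc)
  qed
  define K where "K = (3 / \<kappa>) ^ 3"
  have K: "ln x ^ 3 \<le> K * x powr \<kappa>" if "1 \<le> x" for x :: real
  proof -
    have "ln x ^ 3 \<le> (x powr (\<kappa>/3) / (\<kappa>/3)) ^ 3"
      using ln_powr_bound[OF that, of "\<kappa>/3"] assms(2) that by (intro power_mono) auto
    also have "\<dots> = K * (x powr (\<kappa>/3)) ^ 3" using assms(2)
      by (simp add: K_def power_divide)
    also have "(x powr (\<kappa>/3)) ^ 3 = x powr \<kappa>" using that by (simp add: powr_power)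
    finally show ?thesis .
  qed
  have Kpos: "K > 0" using assms(2) by (simp add: K_def)
  (* the last entry takes care of the finitely many i below the denominator with index 2 *)
  define c where "c = Min {1, 1 / (2 * C * K), \<bar>conv_err \<alpha> 1\<bar>}"
  have c: "0 < c" "c \<le> 1" "c \<le> 1 / (2 * C * K)" "c \<le> \<bar>conv_err \<alpha> 1\<bar>"
    using Kpos conv_err_props(1)[OF irr, of 1] by (auto simp: c_def C_def)
  show ?thesis
  proof (rule that[OF c(1,2)])
    fix i :: nat and p :: int
    assume i: "0 < i"
    have le1: "real i powr (- (1 + \<kappa>)) \<le> 1"
      using powr_mono[of "- (1 + \<kappa>)" 0 "real i"] i assms(2) by simp
    show "c * real i powr (- (1 + \<kappa>)) \<le> \<bar>real i * \<alpha> - of_int p\<bar>"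
    proof (cases "int i < ?q 2")
      case True
      have "c * real i powr (- (1 + \<kappa>)) \<le> c * 1" using le1 c by (intro mult_left_mono) auto
      also have "\<dots> \<le> \<bar>conv_err \<alpha> 1\<bar>" using c by simp
      also have "\<dots> \<le> \<bar>real i * \<alpha> - of_int p\<bar>"
        using best_approximation[OF irr, of "int i" 1 p] i True by (simp add: numeral_2_eq_2)
      finally show ?thesis .
    next
      case False
      define m where "m = (LEAST m. int i < ?q m)"
      have ex: "int i < ?q (Suc i)" using conv_denom_pos[OF irr, of i] by auto
      have m: "int i < ?q m" unfolding m_def using ex by (rule LeastI)
      have notm: "\<not> int i < ?q k" if "k < m" for k using that not_less_Least unfolding m_def by blast
      have "m \<noteq> 0" using m i by (intro notI) simp
      have "m \<noteq> 1"
      proof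
        assume "m = 1"
        moreover have "?q 1 \<le> ?q 2"
        proof -
          have "?q 1 \<le> partial_quotient \<alpha> (Suc 1) * ?q 1"
            using partial_quotient_ge_1[OF irr, of 1] q1[of 1] by simp
          then show ?thesis by (simp add: numeral_2_eq_2)
        qed
        ultimately show False using m False by simp
      qed
      have "m \<noteq> 2" using m False by auto
      then obtain n where n: "m = Suc n" "n \<ge> 2" using \<open>m \<noteq> 0\<close> \<open>m \<noteq> 1\<close>
        by (cases m) auto
      have qn: "?q n \<le> int i" using notm[of n] n by simp
      have nq: "real n \<le> of_int (?q n)" using conv_denom_pos[OF irr, of "n - 1"] n(2)
        by (metis Suc_diff_1 of_int_le_iff of_int_of_nat_eq not_numeral_le_zero neq0_conv)
      have qni: "real_of_int (?q n) \<le> real i" using qn by linarith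
      have lnn: "0 \<le> ln (real n)" "ln (real n) \<le> ln (real i)" "0 \<le> ln (real_of_int (?q n))" "ln (real_of_int (?q n)) \<le> ln (real i)"
        using n(2) nq qni q1[of n] by auto
      have "of_int (?q (Suc n)) \<le> C * (of_int (?q n) * ln (of_int (?q n)) * (ln (real n))\<^sup>2)"
        using C[OF n(2)] by (simp add: mult.assoc)
      also have "\<dots> \<le> C * (real i * ln (real i) * (ln (real i))\<^sup>2)"
        using lnn qni q1[of n] by (intro mult_left_mono mult_mono power_mono) (auto simp: C_def)
      also have "\<dots> = C * (real i * ln (real i) ^ 3)" by (simp add: power2_eq_square power3_eq_cube)
      also have "\<dots> \<le> C * (real i * (K * real i powr \<kappa>))"
        using K[of "real i"] i by (intro mult_left_mono) (auto simp: C_def)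
      also have "\<dots> = C * K * real i powr (1 + \<kappa>)" using i by (simp add: powr_add)
      finally have up: "of_int (?q (Suc n)) \<le> C * K * real i powr (1 + \<kappa>)" .
      have "c * real i powr (- (1 + \<kappa>)) \<le> 1 / (2 * C * K) * real i powr (- (1 + \<kappa>))"
        using c by (intro mult_right_mono) auto
      also have "\<dots> = 1 / (2 * (C * K * real i powr (1 + \<kappa>)))"
        unfolding powr_minus by (simp add: divide_simps)
      also have "\<dots> \<le> 1 / (2 * of_int (?q (Suc n)))"
        using up q1[of "Suc n"] Kpos i by (intro divide_left_mono) (auto intro!: mult_pos_pos simp: C_def)
      also have "\<dots> \<le> \<bar>conv_err \<alpha> n\<bar>" by (rule conv_err_lower[OF irr])
      also have "\<dots> \<le> \<bar>real i * \<alpha> - of_int p\<bar>"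
        using best_approximation[OF irr, of "int i" n p] i m n by simp
      finally show ?thesis .
    qed
  qed
qed

text \<open>
  By Dirichlet's theorem the orbit of length \<open>q \<le> n\<close> follows that of a rational rotation \<open>h / q\<close> up to
  \<open>1 / q\<close>, so it meets every arc of length \<open>3 / q\<close>; the Diophantine bound forces \<open>q\<close> to be almost as large
  as \<open>n\<close>.
\<close>

lemma orbit_visits_zero:
  fixes n :: nat
  assumes c: "0 < c" "c \<le> 1" "0 < \<kappa>"
    and dio: "\<And>(i::nat) (p::int). 0 < i \<Longrightarrow> c * real i powr (- (1 + \<kappa>)) \<le> \<bar>real i * \<alpha> - of_int p\<bar>"
    and n: "0 < n"
  shows "\<exists>i<n. frac (x + real i * \<alpha>) < 3 * (c * real n) powr (- (1 / (1 + \<kappa>)))"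
proof -
  obtain h k where hk: "coprime h k" "0 < k" "k \<le> int n" "\<bar>of_int k * \<alpha> - of_int h\<bar> < 1 / real n"
    using Dirichlet_approx_coprime[OF n] by metis
  define q where "q = nat k"
  have q: "0 < q" "q \<le> n" "k = int q" using hk by (auto simp: q_def)
  have hq: "\<bar>real q * \<alpha> - of_int h\<bar> < 1 / real n" using hk q by simp
  have "c * real q powr (- (1 + \<kappa>)) < 1 / real n"
    using dio[OF q(1), of h] hq by linarith
  then have "c * real n < real q powr (1 + \<kappa>)"
    using q n unfolding powr_minus by (simp add: field_simps)
  then have "(c * real n) powr (1 / (1 + \<kappa>)) < (real q powr (1 + \<kappa>)) powr (1 / (1 + \<kappa>))"
    using c n by (intro powr_less_mono2) auto
  also have "\<dots> = real q" using q c by (simp add: powr_powr)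
  finally have big: "(c * real n) powr (1 / (1 + \<kappa>)) < real q" .
  have goal: "3 / real q \<le> 3 * (c * real n) powr (- (1 / (1 + \<kappa>)))"
    using big q c n by (simp add: powr_minus divide_simps)
  show ?thesis
  proof (cases "q \<le> 3")
    case True
    then have "1 \<le> 3 / real q" using q by simp
    then have "frac (x + real 0 * \<alpha>) < 3 * (c * real n) powr (- (1 / (1 + \<kappa>)))"
      using goal frac_lt_1[of "x + real 0 * \<alpha>"] by linarith
    then show ?thesis using n by blast
  next
    case False
    (* the rational orbit is steered to [1/q, 2/q), so that an error below 1/q keeps it in (0, 3/q) *)
    define l where "l = \<lceil>1 - real q * x\<rceil>"
    have l: "1 \<le> real q * x + of_int l" "real q * x + of_int l < 2"
      unfolding l_def by linarith+
    obtain u v where uv: "u * h + v * int q = 1"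
      using bezout_int[of h "int q"] hk(1) q(3) by auto
    define i where "i = nat ((u * l) mod int q)"
    have i: "int i = (u * l) mod int q" "i < q" using q by (auto simp: i_def nat_less_iff)
    define d where "d = - (v * l) - h * ((u * l) div int q)"
    have "h * int i = h * (u * l - int q * ((u * l) div int q))"
      unfolding i(1) by (simp add: minus_mult_div_eq_mod)
    also have "\<dots> = (u * h) * l - int q * h * ((u * l) div int q)" by (simp add: algebra_simps)
    also have "u * h = 1 - v * int q" using uv by simp
    finally have d: "h * int i = l + int q * d" by (simp add: d_def algebra_simps)
    have "x + real i * \<alpha> - of_int d = (real q * x + of_int l) / real q + real i * (real q * \<alpha> - of_int h) / real q"
    proof -
      have "real_of_int h * real i = of_int l + real q * of_int d"
        using d by (metis of_int_add of_int_mult of_int_of_nat_eq)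
      then show ?thesis using q by (simp add: field_simps)
    qed
    moreover have "\<bar>real i * (real q * \<alpha> - of_int h) / real q\<bar> < 1 / real q"
    proof -
      have "real i * \<bar>real q * \<alpha> - of_int h\<bar> \<le> real q * \<bar>real q * \<alpha> - of_int h\<bar>"
        using i by (intro mult_right_mono) auto
      also have "\<dots> < real q * (1 / real n)" using hq q by (intro mult_strict_left_mono) auto
      also have "\<dots> \<le> 1" using q n by simp
      finally show ?thesis using q by (simp add: abs_mult divide_simps)
    qed
    moreover have "1 / real q \<le> (real q * x + of_int l) / real q" "(real q * x + of_int l) / real q < 2 / real q"
      using l q by (auto intro!: divide_right_mono divide_strict_right_mono)
    moreover have "3 / real q = 2 / real q + 1 / real q" by (simp add: field_simps)
    ultimately have b: "0 < x + real i * \<alpha> - of_int d" "x + real i * \<alpha> - of_int d < 3 / real q"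
      unfolding abs_less_iff by linarith+
    have "3 / real q < 1" using False by simp
    then have "frac (x + real i * \<alpha>) = x + real i * \<alpha> - of_int d"
      using b by (intro frac_unique_iff[THEN iffD2]) auto
    then have "frac (x + real i * \<alpha>) < 3 * (c * real n) powr (- (1 / (1 + \<kappa>)))" using b goal by linarith
    then show ?thesis using i q by (intro exI[of _ i]) auto
  qed
qed

section \<open>The roof function\<close>

lemma continuous_lower_bound:
  fixes g :: "real \<Rightarrow> real"
  assumes cont: "continuous_on {0<..<1} g"
    and "\<forall>\<^sub>F x in at_right 0. b \<le> g x" "\<forall>\<^sub>F x in at_left 1. b \<le> g x"
  obtains c where "c \<le> b" "\<And>x. 0 < x \<Longrightarrow> x < 1 \<Longrightarrow> c \<le> g x"
    "(\<And>x. 0 < x \<Longrightarrow> x < 1 \<Longrightarrow> 0 < g x) \<Longrightarrow> 0 < b \<Longrightarrow> 0 < c"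
proof -
  obtain u0 where u0: "0 < u0" "\<And>x. 0 < x \<Longrightarrow> x < u0 \<Longrightarrow> b \<le> g x"
    using assms(2) unfolding eventually_at_right_field by blast
  obtain v0 where v0: "v0 < 1" "\<And>x. v0 < x \<Longrightarrow> x < 1 \<Longrightarrow> b \<le> g x"
    using assms(3) unfolding eventually_at_left_field by blast
  define u where "u = min u0 (1/2)"
  define v where "v = max v0 (1/2)"
  have uv: "0 < u" "u \<le> v" "v < 1" using u0 v0 by (auto simp: u_def v_def)
  have "continuous_on {u..v} g" using cont by (rule continuous_on_subset) (use uv in auto)
  then obtain x0 where x0: "x0 \<in> {u..v}" "\<And>y. y \<in> {u..v} \<Longrightarrow> g x0 \<le> g y"
    using continuous_attains_inf[of "{u..v}" g] uv by auto
  show ?thesis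
  proof (rule that[of "min b (g x0)"])
    show "min b (g x0) \<le> g x" if "0 < x" "x < 1" for x
    proof -
      consider "x < u0" | "x > v0" | "x \<in> {u..v}"
        by (force simp: u_def v_def)
      then show ?thesis using u0(2)[of x] v0(2)[of x] x0(2)[of x] that by cases auto
    qed
    show "0 < min b (g x0)" if "\<And>x. 0 < x \<Longrightarrow> x < 1 \<Longrightarrow> 0 < g x" "0 < b"
      using that(1)[of x0] that(2) x0(1) uv by auto
  qed auto
qed

lemma power_singularity_bound:
  fixes u :: "real \<Rightarrow> real"
  assumes cont: "continuous_on {0<..<1} u"
    and "\<forall>\<^sub>F x in at_right 0. \<bar>u x\<bar> \<le> K * x powr - a"
    and "\<forall>\<^sub>F x in at_left 1. \<bar>u x\<bar> \<le> K * (1 - x) powr - a"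
  obtains C where "0 < C" "\<And>x. 0 < x \<Longrightarrow> x < 1 \<Longrightarrow> \<bar>u x\<bar> \<le> C * (x powr - a + (1 - x) powr - a)"
proof -
  let ?w = "\<lambda>x::real. x powr - a + (1 - x) powr - a"
  define K' where "K' = max K 0"
  have w: "0 < ?w x" if "0 < x" "x < 1" for x using that by (simp add: add_pos_pos)
  have near: "- K' \<le> - \<bar>u x\<bar> / ?w x" if "0 < x" "x < 1" "\<bar>u x\<bar> \<le> K * s" "0 \<le> s" "s \<le> ?w x" for x s
  proof -
    have "\<bar>u x\<bar> \<le> K' * s" using that by (intro order.trans[OF that(3)] mult_right_mono) (auto simp: K'_def)
    also have "\<dots> \<le> K' * ?w x" using that by (intro mult_left_mono) (auto simp: K'_def)
    finally show ?thesis using w[of x] that by (simp add: pos_divide_le_eq)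
  qed
  have c: "continuous_on {0<..<1} (\<lambda>x. - \<bar>u x\<bar> / ?w x)"
    using w by (intro continuous_on_divide continuous_on_minus continuous_on_rabs continuous_on_add
        continuous_on_powr continuous_on_diff continuous_on_id continuous_on_const cont) (auto simp: less_le)
  have 0: "\<forall>\<^sub>F x::real in at_right 0. 0 < x \<and> x < 1"
    unfolding eventually_at_right_field by (intro exI[of _ 1]) auto
  have 1: "\<forall>\<^sub>F x::real in at_left 1. 0 < x \<and> x < 1"
    unfolding eventually_at_left_field by (intro exI[of _ 0]) auto
  have e0: "\<forall>\<^sub>F x in at_right 0. - K' \<le> - \<bar>u x\<bar> / ?w x"
    using assms(2) 0 by eventually_elim (rule near, auto)
  have e1: "\<forall>\<^sub>F x in at_left 1. - K' \<le> - \<bar>u x\<bar> / ?w x"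
    using assms(3) 1 by eventually_elim (rule near, auto)
  obtain c where c: "c \<le> - K'" "\<And>x. 0 < x \<Longrightarrow> x < 1 \<Longrightarrow> c \<le> - \<bar>u x\<bar> / ?w x"
    using continuous_lower_bound[OF c e0 e1] by metis
  show ?thesis
  proof (rule that[of "max (- c) 1"])
    show "\<bar>u x\<bar> \<le> max (- c) 1 * ?w x" if "0 < x" "x < 1" for x
    proof -
      have "\<bar>u x\<bar> \<le> - c * ?w x" using c(2)[OF that] w[OF that] by (simp add: field_simps)
      also have "\<dots> \<le> max (- c) 1 * ?w x" using w[OF that] by (intro mult_right_mono) auto
      finally show ?thesis .
    qed
  qed auto
qed

lemma eventually_le_of_quotient_tendsto:
  fixes u v :: "real \<Rightarrow> real"
  assumes "((\<lambda>x. u x / v x) \<longlongrightarrow> A) F" "\<forall>\<^sub>F x in F. v x \<noteq> 0"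
  shows "\<forall>\<^sub>F x in F. \<bar>u x\<bar> \<le> (\<bar>A\<bar> + 1) * \<bar>v x\<bar>"
proof -
  have "((\<lambda>x. \<bar>u x / v x\<bar>) \<longlongrightarrow> \<bar>A\<bar>) F" using assms(1) by (rule tendsto_rabs)
  then have "\<forall>\<^sub>F x in F. \<bar>u x / v x\<bar> < \<bar>A\<bar> + 1" by (rule order_tendstoD) simp
  then show ?thesis using assms(2)
    by eventually_elim (simp add: field_simps)
qed

lemma deriv_powr_neg:
  fixes x :: real
  assumes "0 < x"
  shows "deriv (\<lambda>x. x powr - \<gamma>) x = - \<gamma> * x powr (- \<gamma> - 1)"
    "deriv (deriv (\<lambda>x. x powr - \<gamma>)) x = \<gamma> * (\<gamma> + 1) * x powr (- \<gamma> - 2)"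
proof -
  have 1: "deriv (\<lambda>x. x powr - \<gamma>) y = - \<gamma> * y powr (- \<gamma> - 1)" if "0 < y" for y :: real
    using that by (intro DERIV_imp_deriv) (auto intro!: derivative_eq_intros)
  then show "deriv (\<lambda>x. x powr - \<gamma>) x = - \<gamma> * x powr (- \<gamma> - 1)" using assms by simp
  have "\<forall>\<^sub>F y in nhds x. y \<in> {0<..}" using assms by (intro eventually_nhds_in_open) auto
  then have "\<forall>\<^sub>F y in nhds x. deriv (\<lambda>x. x powr - \<gamma>) y = - \<gamma> * y powr (- \<gamma> - 1)"
    by eventually_elim (use 1 in auto)
  then have "deriv (deriv (\<lambda>x. x powr - \<gamma>)) x = deriv (\<lambda>y. - \<gamma> * y powr (- \<gamma> - 1)) x"
    by (intro deriv_cong_ev) auto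
  also have "\<dots> = \<gamma> * (\<gamma> + 1) * x powr (- \<gamma> - 2)"
    using assms by (intro DERIV_imp_deriv) (auto intro!: derivative_eq_intros simp: algebra_simps)
  finally show "deriv (deriv (\<lambda>x. x powr - \<gamma>)) x = \<gamma> * (\<gamma> + 1) * x powr (- \<gamma> - 2)" .
qed

text \<open>
  All that is needed of the roof, with one constant \<open>c\<close> for lower and one constant \<open>C\<close> for upper bounds.
  The lower bound on the second derivative is only required to the right of the singularity, as visits
  from one side suffice.
\<close>

definition singular_roof :: "real \<Rightarrow> (real \<Rightarrow> real) \<Rightarrow> (real \<Rightarrow> real) \<Rightarrow> (real \<Rightarrow> real) \<Rightarrow> real \<Rightarrow> real \<Rightarrow> bool" where
  "singular_roof \<gamma> f f' f'' c C \<longleftrightarrow>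
     0 < c \<and> c \<le> 1 \<and> 1 \<le> C \<and>
     (\<forall>x\<in>{0<..<1}. (f has_real_derivative f' x) (at x) \<and> (f' has_real_derivative f'' x) (at x) \<and>
        c \<le> f x \<and> f x \<le> C * (x powr - \<gamma> + (1 - x) powr - \<gamma>) \<and>
        \<bar>f' x\<bar> \<le> C * (x powr - (1 + \<gamma>) + (1 - x) powr - (1 + \<gamma>)) \<and>
        - C \<le> f'' x \<and> (x < c \<longrightarrow> c * x powr - (2 + \<gamma>) \<le> f'' x))"

lemma kochergin_roof_singular_roof:
  assumes "kochergin_roof \<gamma> f" "0 < \<gamma>" "\<gamma> < 1"
  obtains c C where "singular_roof \<gamma> f (deriv f) (deriv (deriv f)) c C"
proof -
  let ?I = "{0<..<1} :: real set" and ?h = "\<lambda>x::real. x powr - \<gamma>"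
  from assms(1) obtain A1 A2 A3 B1 B2 B3 where pos: "\<forall>x\<in>?I. 0 < f x"
    and d1: "f differentiable_on ?I" and d2: "deriv f differentiable_on ?I"
    and c2: "continuous_on ?I (deriv (deriv f))"
    and l1: "((\<lambda>x. f x / ?h x) \<longlongrightarrow> A1) (at_right 0)" "((\<lambda>x. f x / ?h (1 - x)) \<longlongrightarrow> B1) (at_left 1)"
    and l2: "((\<lambda>x. deriv f x / deriv ?h x) \<longlongrightarrow> A2) (at_right 0)"
       "((\<lambda>x. deriv f x / deriv ?h (1 - x)) \<longlongrightarrow> - B2) (at_left 1)"
    and l3: "((\<lambda>x. deriv (deriv f) x / deriv (deriv ?h) x) \<longlongrightarrow> A3) (at_right 0)"
       "((\<lambda>x. deriv (deriv f) x / deriv (deriv ?h) (1 - x)) \<longlongrightarrow> B3) (at_left 1)"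
    and AB: "0 < A1" "0 < A2" "0 < A3" "0 < B1" "0 < B2" "0 < B3"
    unfolding kochergin_roof_def Let_def by (elim conjE exE) (rule that, assumption+)
  have D1: "(f has_real_derivative deriv f x) (at x)" if "x \<in> ?I" for x
    using d1 that by (simp add: differentiable_on_eq_differentiable_at DERIV_deriv_iff_real_differentiable)
  have D2: "(deriv f has_real_derivative deriv (deriv f) x) (at x)" if "x \<in> ?I" for x
    using d2 that by (simp add: differentiable_on_eq_differentiable_at DERIV_deriv_iff_real_differentiable)
  have c0: "continuous_on ?I f" using d1 by (rule differentiable_imp_continuous_on)
  have c1: "continuous_on ?I (deriv f)" using d2 by (rule differentiable_imp_continuous_on)
  have 0: "\<forall>\<^sub>F x::real in at_right 0. 0 < x \<and> x < 1"
    unfolding eventually_at_right_field by (intro exI[of _ 1]) auto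
  have 1: "\<forall>\<^sub>F x::real in at_left 1. 0 < x \<and> x < 1"
    unfolding eventually_at_left_field by (intro exI[of _ 0]) auto
  have h: "deriv ?h x = - \<gamma> * x powr - (1 + \<gamma>)" "deriv (deriv ?h) x = \<gamma> * (\<gamma> + 1) * x powr - (2 + \<gamma>)" if "0 < x" for x
  proof -
    have "- (1 + \<gamma>) = - \<gamma> - 1" "- (2 + \<gamma>) = - \<gamma> - 2" by auto
    then show "deriv ?h x = - \<gamma> * x powr - (1 + \<gamma>)" "deriv (deriv ?h) x = \<gamma> * (\<gamma> + 1) * x powr - (2 + \<gamma>)"
      using deriv_powr_neg[OF that, of \<gamma>] by metis+
  qed
  have ne: "?h x \<noteq> 0" "deriv ?h x \<noteq> 0" "deriv (deriv ?h) x \<noteq> 0" if "0 < x" for x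
    using that assms h[OF that] by auto
  have "\<forall>\<^sub>F x in at_right 0. A1 / 2 < f x / ?h x" using l1(1) by (rule order_tendstoD) (use AB in auto)
  then have f0: "\<forall>\<^sub>F x in at_right 0. min A1 B1 / 2 \<le> f x" using 0
  proof eventually_elim
    case (elim x)
    have "1 \<le> ?h x" using elim assms powr_mono'[of "-\<gamma>" 0 x] by simp
    then have "A1 / 2 * 1 \<le> A1 / 2 * ?h x" using AB by (intro mult_left_mono) auto
    also have "\<dots> < f x" using elim by (simp add: field_simps)
    finally show ?case by simp
  qed
  have "\<forall>\<^sub>F x in at_left 1. B1 / 2 < f x / ?h (1 - x)" using l1(2) by (rule order_tendstoD) (use AB in auto)
  then have f1: "\<forall>\<^sub>F x in at_left 1. min A1 B1 / 2 \<le> f x" using 1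
  proof eventually_elim
    case (elim x)
    have "1 \<le> ?h (1 - x)" using elim assms powr_mono'[of "-\<gamma>" 0 "1 - x"] by simp
    then have "B1 / 2 * 1 \<le> B1 / 2 * ?h (1 - x)" using AB by (intro mult_left_mono) auto
    also have "\<dots> < f x" using elim by (simp add: field_simps)
    finally show ?case by simp
  qed
  obtain ca where ca: "0 < ca" "\<And>x. x \<in> ?I \<Longrightarrow> ca \<le> f x"
    using continuous_lower_bound[OF c0 f0 f1] pos AB by (metis greaterThanLessThan_iff half_gt_zero min_less_iff_conj)
  have "\<forall>\<^sub>F x in at_right 0. \<bar>f x\<bar> \<le> (\<bar>A1\<bar> + 1) * \<bar>?h x\<bar>"
    by (rule eventually_le_of_quotient_tendsto[OF l1(1)]) (use 0 in \<open>eventually_elim, use ne in auto\<close>)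
  then have u0: "\<forall>\<^sub>F x in at_right 0. \<bar>f x\<bar> \<le> max (A1+1) (B1+1) * x powr - \<gamma>"
    using 0 by eventually_elim (use AB in \<open>auto intro: order.trans[OF _ mult_right_mono]\<close>)
  have "\<forall>\<^sub>F x in at_left 1. \<bar>f x\<bar> \<le> (\<bar>B1\<bar> + 1) * \<bar>?h (1 - x)\<bar>"
    by (rule eventually_le_of_quotient_tendsto[OF l1(2)]) (use 1 in \<open>eventually_elim, use ne in auto\<close>)
  then have u1: "\<forall>\<^sub>F x in at_left 1. \<bar>f x\<bar> \<le> max (A1+1) (B1+1) * (1 - x) powr - \<gamma>"
    using 1 by eventually_elim (use AB in \<open>auto intro: order.trans[OF _ mult_right_mono]\<close>)
  obtain Cf where Cf: "0 < Cf" "\<And>x. x \<in> ?I \<Longrightarrow> \<bar>f x\<bar> \<le> Cf * (x powr - \<gamma> + (1 - x) powr - \<gamma>)"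
    using power_singularity_bound[OF c0 u0 u1] by (metis greaterThanLessThan_iff)
  define K where "K = max (A2+1) (B2+1) * \<gamma>"
  have "\<forall>\<^sub>F x in at_right 0. \<bar>deriv f x\<bar> \<le> (\<bar>A2\<bar> + 1) * \<bar>deriv ?h x\<bar>"
    by (rule eventually_le_of_quotient_tendsto[OF l2(1)]) (use 0 in \<open>eventually_elim, use ne in auto\<close>)
  then have v0: "\<forall>\<^sub>F x in at_right 0. \<bar>deriv f x\<bar> \<le> K * x powr - (1 + \<gamma>)"
    using 0
  proof eventually_elim
    case (elim x)
    then have "\<bar>deriv f x\<bar> \<le> (A2 + 1) * (\<gamma> * x powr - (1 + \<gamma>))" using h[of x] AB assms by (simp add: abs_mult)
    also have "\<dots> \<le> max (A2+1) (B2+1) * (\<gamma> * x powr - (1 + \<gamma>))" using assms by (intro mult_right_mono) auto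
    finally show ?case by (simp add: K_def)
  qed
  have "\<forall>\<^sub>F x in at_left 1. \<bar>deriv f x\<bar> \<le> (\<bar>- B2\<bar> + 1) * \<bar>deriv ?h (1 - x)\<bar>"
    by (rule eventually_le_of_quotient_tendsto[OF l2(2)]) (use 1 in \<open>eventually_elim, use ne in auto\<close>)
  then have v1: "\<forall>\<^sub>F x in at_left 1. \<bar>deriv f x\<bar> \<le> K * (1 - x) powr - (1 + \<gamma>)"
    using 1
  proof eventually_elim
    case (elim x)
    then have "\<bar>deriv f x\<bar> \<le> (B2 + 1) * (\<gamma> * (1 - x) powr - (1 + \<gamma>))" using h[of "1 - x"] AB assms by (simp add: abs_mult)
    also have "\<dots> \<le> max (A2+1) (B2+1) * (\<gamma> * (1 - x) powr - (1 + \<gamma>))" using assms by (intro mult_right_mono) auto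
    finally show ?case by (simp add: K_def)
  qed
  obtain Cd where Cd: "0 < Cd" "\<And>x. x \<in> ?I \<Longrightarrow> \<bar>deriv f x\<bar> \<le> Cd * (x powr - (1 + \<gamma>) + (1 - x) powr - (1 + \<gamma>))"
    using power_singularity_bound[OF c1 v0 v1] by (metis greaterThanLessThan_iff)
  define cd where "cd = A3 / 2 * (\<gamma> * (\<gamma> + 1))"
  have cd: "0 < cd" using AB assms by (simp add: cd_def)
  have "\<forall>\<^sub>F x in at_right 0. A3 / 2 < deriv (deriv f) x / deriv (deriv ?h) x" using l3(1) by (rule order_tendstoD) (use AB in auto)
  then have w: "\<forall>\<^sub>F x in at_right 0. cd * x powr - (2 + \<gamma>) \<le> deriv (deriv f) x" using 0
  proof eventually_elim
    case (elim x)
    have p: "0 < \<gamma> * (\<gamma> + 1) * x powr - (2 + \<gamma>)" using elim assms by auto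
    have "A3 / 2 < deriv (deriv f) x / (\<gamma> * (\<gamma> + 1) * x powr - (2 + \<gamma>))"
      using elim h(2)[of x] by metis
    then have "A3 / 2 * (\<gamma> * (\<gamma> + 1) * x powr - (2 + \<gamma>)) < deriv (deriv f) x"
      by (rule iffD1[OF pos_less_divide_eq[OF p]])
    then show ?case by (simp add: cd_def mult.assoc)
  qed
  then obtain z where z: "0 < z" "\<And>x. 0 < x \<Longrightarrow> x < z \<Longrightarrow> cd * x powr - (2 + \<gamma>) \<le> deriv (deriv f) x"
    unfolding eventually_at_right_field by blast
  have w0: "\<forall>\<^sub>F x in at_right 0. 0 \<le> deriv (deriv f) x" using w
    by eventually_elim (use cd in \<open>meson mult_nonneg_nonneg order.trans less_imp_le powr_ge_zero\<close>)
  have "\<forall>\<^sub>F x in at_left 1. 0 < deriv (deriv f) x / deriv (deriv ?h) (1 - x)" using l3(2) by (rule order_tendstoD) (use AB in auto)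
  then have w1: "\<forall>\<^sub>F x in at_left 1. 0 \<le> deriv (deriv f) x" using 1
  proof eventually_elim
    case (elim x)
    have "0 < deriv (deriv ?h) (1 - x)" using elim assms h(2)[of "1 - x"] by auto
    then show ?case using elim(1) by (simp add: zero_less_divide_iff)
  qed
  obtain b where b: "b \<le> 0" "\<And>x. x \<in> ?I \<Longrightarrow> b \<le> deriv (deriv f) x"
    using continuous_lower_bound[OF c2 w0 w1] by (metis greaterThanLessThan_iff)
  define c where "c = Min {1, ca, cd, z}"
  define C where "C = Max {1, Cf, Cd, - b}"
  have c: "0 < c" "c \<le> 1" "c \<le> ca" "c \<le> cd" "c \<le> z" using ca cd z by (auto simp: c_def)
  have C: "1 \<le> C" "Cf \<le> C" "Cd \<le> C" "- b \<le> C" by (auto simp: C_def)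
  have "singular_roof \<gamma> f (deriv f) (deriv (deriv f)) c C"
    unfolding singular_roof_def
  proof (intro conjI ballI impI c(1,2) C(1))
    fix x :: real assume x: "x \<in> ?I"
    show "(f has_real_derivative deriv f x) (at x)" "(deriv f has_real_derivative deriv (deriv f) x) (at x)"
      using D1 D2 x by auto
    show "c \<le> f x" using ca x c by force
    have "f x \<le> Cf * (x powr - \<gamma> + (1 - x) powr - \<gamma>)" using Cf(2)[OF x] by linarith
    also have "\<dots> \<le> C * (x powr - \<gamma> + (1 - x) powr - \<gamma>)" using C by (intro mult_right_mono) auto
    finally show "f x \<le> C * (x powr - \<gamma> + (1 - x) powr - \<gamma>)" .
    have "Cd * (x powr - (1 + \<gamma>) + (1 - x) powr - (1 + \<gamma>)) \<le> C * (x powr - (1 + \<gamma>) + (1 - x) powr - (1 + \<gamma>))"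
      using C by (intro mult_right_mono) auto
    then show "\<bar>deriv f x\<bar> \<le> C * (x powr - (1 + \<gamma>) + (1 - x) powr - (1 + \<gamma>))" using Cd(2)[OF x] by linarith
    show "- C \<le> deriv (deriv f) x" using b(2)[OF x] C by linarith
    show "c * x powr - (2 + \<gamma>) \<le> deriv (deriv f) x" if "x < c"
    proof -
      have "c * x powr - (2 + \<gamma>) \<le> cd * x powr - (2 + \<gamma>)" using c by (intro mult_right_mono) auto
      also have "\<dots> \<le> deriv (deriv f) x" by (rule z(2)) (use x that c in auto)
      finally show ?thesis .
    qed
  qed
  then show ?thesis by (rule that)
qed

section \<open>Drift of two nearby orbits\<close>

locale kochergin =
  fixes \<alpha> \<gamma> :: real and f f' f'' :: "real \<Rightarrow> real" and cf Cf :: real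
  assumes dio: "\<alpha> \<in> diophantine_set" and \<gamma>: "0 < \<gamma>" "\<gamma> < 1"
    and roof: "singular_roof \<gamma> f f' f'' cf Cf"
begin

lemma cf: "0 < cf" "cf \<le> 1" and Cf: "1 \<le> Cf"
  using roof by (auto simp: singular_roof_def)

lemma roof_deriv:
  assumes "0 < x" "x < 1"
  shows "(f has_real_derivative f' x) (at x)" "(f' has_real_derivative f'' x) (at x)"
    "cf \<le> f x" "f x \<le> Cf * (x powr - \<gamma> + (1 - x) powr - \<gamma>)"
    "\<bar>f' x\<bar> \<le> Cf * (x powr - (1 + \<gamma>) + (1 - x) powr - (1 + \<gamma>))"
    "- Cf \<le> f'' x" "x < cf \<Longrightarrow> cf * x powr - (2 + \<gamma>) \<le> f'' x"
  using roof assms by (auto simp: singular_roof_def)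

definition bsum :: "nat \<Rightarrow> real \<Rightarrow> real" where
  "bsum m x = (\<Sum>i<m. f (frac (x + real i * \<alpha>)))"

lemma second_difference:
  assumes "0 < a" "a < b" "0 < \<delta>" "b + \<delta> < 1"
  obtains \<xi> where "a < \<xi>" "\<xi> < b + \<delta>" "(f a - f (a + \<delta>)) - (f b - f (b + \<delta>)) = (b - a) * \<delta> * f'' \<xi>"
proof -
  have "\<exists>\<tau>. a < \<tau> \<and> \<tau> < b \<and> (f (b + \<delta>) - f b) - (f (a + \<delta>) - f a) = (b - a) * (f' (\<tau> + \<delta>) - f' \<tau>)"
  proof (rule MVT2[OF assms(2), of "\<lambda>x. f (x + \<delta>) - f x" "\<lambda>x. f' (x + \<delta>) - f' x"])
    fix x assume x: "a \<le> x" "x \<le> b"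
    have "(f has_real_derivative f' (x + \<delta>)) (at (x + \<delta>))" "(f has_real_derivative f' x) (at x)"
      using x assms by (auto intro!: roof_deriv)
    then show "((\<lambda>x. f (x + \<delta>) - f x) has_real_derivative f' (x + \<delta>) - f' x) (at x)"
      by (auto intro!: DERIV_diff simp: DERIV_shift)
  qed
  then obtain \<tau> where \<tau>: "a < \<tau>" "\<tau> < b"
    "(f (b + \<delta>) - f b) - (f (a + \<delta>) - f a) = (b - a) * (f' (\<tau> + \<delta>) - f' \<tau>)" by blast
  have "\<exists>\<xi>. \<tau> < \<xi> \<and> \<xi> < \<tau> + \<delta> \<and> f' (\<tau> + \<delta>) - f' \<tau> = (\<tau> + \<delta> - \<tau>) * f'' \<xi>"
    by (rule MVT2) (use assms \<tau> roof_deriv(2) in auto)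
  then obtain \<xi> where "\<tau> < \<xi>" "\<xi> < \<tau> + \<delta>" "f' (\<tau> + \<delta>) - f' \<tau> = \<delta> * f'' \<xi>" by auto
  then show ?thesis using \<tau> by (intro that[of \<xi>]) auto
qed

lemma frac_eq_of_no_integer_between:
  fixes y t s :: real
  assumes "y \<le> t" "t \<le> s" "\<And>j::int. \<not> (y \<le> of_int j \<and> of_int j \<le> s)"
  shows "frac t = t - of_int \<lfloor>y\<rfloor>" "0 < t - of_int \<lfloor>y\<rfloor>" "t - of_int \<lfloor>y\<rfloor> < 1"
proof -
  have 1: "of_int \<lfloor>y\<rfloor> < y" using assms(3)[of "\<lfloor>y\<rfloor>"] assms(1,2) by linarith
  have 2: "s < of_int (\<lfloor>y\<rfloor> + 1)" using assms(3)[of "\<lfloor>y\<rfloor> + 1"] by linarith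
  have "\<lfloor>t\<rfloor> = \<lfloor>y\<rfloor>" using 1 2 assms by linarith
  then show "frac t = t - of_int \<lfloor>y\<rfloor>" "0 < t - of_int \<lfloor>y\<rfloor>" "t - of_int \<lfloor>y\<rfloor> < 1"
    using 1 2 assms by (auto simp: frac_def)
qed

text \<open>
  Each summand of the second difference is \<open>(x\<^sub>2 - x\<^sub>1) * \<delta>\<close> times a value of \<open>f''\<close>. These values are bounded
  below, and the summand at which the right end point visits \<open>(0, z)\<close> has its intermediate point to
  the left of that visit, so that there \<open>f''\<close> is at least \<open>cf * z powr - (2 + \<gamma>)\<close>.
\<close>

lemma bsum_second_difference:
  assumes x: "x1 < x2" "0 < \<delta>"
    and nosing: "\<And>i j. i < m \<Longrightarrow> \<not> (x1 \<le> of_int j - real i * \<alpha> \<and> of_int j - real i * \<alpha> \<le> x2 + \<delta>)"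
    and visit: "\<exists>i<m. frac (x2 + \<delta> + real i * \<alpha>) < z" and z: "z \<le> cf"
  shows "(x2 - x1) * \<delta> * (cf * z powr - (2 + \<gamma>) - Cf * real m)
    \<le> (bsum m x1 - bsum m (x1 + \<delta>)) - (bsum m x2 - bsum m (x2 + \<delta>))"
proof -
  let ?F = "\<lambda>x i. f (frac (x + real i * \<alpha>))"
  have summand: "\<exists>\<xi>. 0 < \<xi> \<and> \<xi> < frac (x2 + \<delta> + real i * \<alpha>) \<and>
    (?F x1 i - ?F (x1 + \<delta>) i) - (?F x2 i - ?F (x2 + \<delta>) i) = (x2 - x1) * \<delta> * f'' \<xi>" if i: "i < m" for i
  proof -
    let ?y = "x1 + real i * \<alpha>" and ?s = "x2 + \<delta> + real i * \<alpha>"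
    let ?j = "of_int \<lfloor>?y\<rfloor> :: real"
    have no: "\<not> (?y \<le> of_int j \<and> of_int j \<le> ?s)" for j :: int
      using nosing[OF i, of j] by linarith
    have fr: "frac t = t - ?j" "0 < t - ?j" "t - ?j < 1" if "?y \<le> t" "t \<le> ?s" for t
      using frac_eq_of_no_integer_between[OF that no] by auto
    have 1: "frac ?y = ?y - ?j" "0 < ?y - ?j" using fr[of ?y] x by auto
    have 2: "frac (x1 + \<delta> + real i * \<alpha>) = (?y - ?j) + \<delta>" using fr[of "x1 + \<delta> + real i * \<alpha>"] x by auto
    have 3: "frac (x2 + real i * \<alpha>) = x2 + real i * \<alpha> - ?j" using fr[of "x2 + real i * \<alpha>"] x by auto
    have 4: "frac ?s = (x2 + real i * \<alpha> - ?j) + \<delta>" "(x2 + real i * \<alpha> - ?j) + \<delta> < 1" using fr[of ?s] x by auto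
    obtain \<xi> where \<xi>: "?y - ?j < \<xi>" "\<xi> < (x2 + real i * \<alpha> - ?j) + \<delta>"
      "(f (?y - ?j) - f ((?y - ?j) + \<delta>)) - (f (x2 + real i * \<alpha> - ?j) - f ((x2 + real i * \<alpha> - ?j) + \<delta>))
        = ((x2 + real i * \<alpha> - ?j) - (?y - ?j)) * \<delta> * f'' \<xi>"
      by (rule second_difference[of "?y - ?j" "x2 + real i * \<alpha> - ?j" \<delta>]) (use 1 4 x in auto)
    show ?thesis
      using \<xi> 1 by (intro exI[of _ \<xi>]) (simp add: 1 2 3 4)
  qed
  obtain i0 where i0: "i0 < m" "frac (x2 + \<delta> + real i0 * \<alpha>) < z" using visit by blast
  have p: "0 < (x2 - x1) * \<delta>" using x by simp
  define T where "T i = (?F x1 i - ?F (x1 + \<delta>) i) - (?F x2 i - ?F (x2 + \<delta>) i)" for i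
  have T: "(x2 - x1) * \<delta> * (- Cf) \<le> T i" if i: "i < m" for i
  proof -
    obtain \<xi> where "0 < \<xi>" "\<xi> < frac (x2 + \<delta> + real i * \<alpha>)" "T i = (x2 - x1) * \<delta> * f'' \<xi>"
      using summand[OF i] unfolding T_def by blast
    moreover from this have "- Cf \<le> f'' \<xi>" using frac_lt_1[of "x2 + \<delta> + real i * \<alpha>"] by (intro roof_deriv) auto
    ultimately show ?thesis using p mult_left_mono[of "- Cf" "f'' \<xi>" "(x2 - x1) * \<delta>"] by simp
  qed
  have T0: "(x2 - x1) * \<delta> * (cf * z powr - (2 + \<gamma>)) \<le> T i0"
  proof -
    obtain \<xi> where \<xi>: "0 < \<xi>" "\<xi> < frac (x2 + \<delta> + real i0 * \<alpha>)" "T i0 = (x2 - x1) * \<delta> * f'' \<xi>"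
      using summand[OF i0(1)] unfolding T_def by blast
    have "cf * z powr - (2 + \<gamma>) \<le> cf * \<xi> powr - (2 + \<gamma>)"
      using \<xi> i0 cf \<gamma> by (intro mult_left_mono powr_mono2') auto
    also have "\<dots> \<le> f'' \<xi>"
      using \<xi> i0 z frac_lt_1[of "x2 + \<delta> + real i0 * \<alpha>"] by (intro roof_deriv) auto
    finally have "cf * z powr - (2 + \<gamma>) \<le> f'' \<xi>" .
    then show ?thesis using p unfolding \<xi>(3) by (intro mult_left_mono) auto
  qed
  have "(x2 - x1) * \<delta> * (cf * z powr - (2 + \<gamma>)) + (\<Sum>i\<in>{..<m} - {i0}. (x2 - x1) * \<delta> * (- Cf))
     \<le> T i0 + (\<Sum>i\<in>{..<m} - {i0}. T i)"
    using T T0 by (intro add_mono sum_mono) auto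
  also have "\<dots> = (\<Sum>i<m. T i)" using i0 by (subst sum.remove[of _ i0]) auto
  also have "\<dots> = (bsum m x1 - bsum m (x1 + \<delta>)) - (bsum m x2 - bsum m (x2 + \<delta>))"
    by (simp add: T_def bsum_def sum_subtractf)
  also have "(\<Sum>i\<in>{..<m} - {i0}. (x2 - x1) * \<delta> * (- Cf)) = (x2 - x1) * \<delta> * (- Cf) * real (m - 1)"
    using i0 by simp
  finally have "(x2 - x1) * \<delta> * (cf * z powr - (2 + \<gamma>)) + (x2 - x1) * \<delta> * (- Cf) * real (m - 1)
     \<le> (bsum m x1 - bsum m (x1 + \<delta>)) - (bsum m x2 - bsum m (x2 + \<delta>))" .
  moreover have "(x2 - x1) * \<delta> * (- Cf) * real m \<le> (x2 - x1) * \<delta> * (- Cf) * real (m - 1)"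
    using p Cf by (intro mult_left_mono_neg) (auto simp: mult_nonneg_nonpos)
  ultimately show ?thesis by (simp add: algebra_simps)
qed

end

lemma card_separated_le:
  fixes S :: "real set"
  assumes "finite S" "0 < \<sigma>" "0 \<le> \<rho>"
    and sep: "\<And>a b. a \<in> S \<Longrightarrow> b \<in> S \<Longrightarrow> a < b \<Longrightarrow> \<sigma> \<le> b - a"
    and diam: "\<And>a b. a \<in> S \<Longrightarrow> b \<in> S \<Longrightarrow> a < b \<Longrightarrow> b - a \<le> \<rho>"
  shows "real (card S) \<le> \<rho> / \<sigma> + 1"
proof (cases "S = {}")
  case False
  let ?m = "Min S"
  let ?g = "\<lambda>a. nat \<lfloor>(a - ?m) / \<sigma>\<rfloor>"
  have m: "?m \<in> S" "\<And>a. a \<in> S \<Longrightarrow> ?m \<le> a" using assms(1) False by auto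
  have lt: "?g a < ?g b" if "a \<in> S" "b \<in> S" "a < b" for a b
  proof -
    have "(a - ?m + \<sigma>) / \<sigma> \<le> (b - ?m) / \<sigma>"
      using sep[OF that] assms(2) by (intro divide_right_mono) auto
    then have "(a - ?m) / \<sigma> + 1 \<le> (b - ?m) / \<sigma>" using assms(2) by (simp add: add_divide_distrib)
    moreover have "0 \<le> (a - ?m) / \<sigma>" using m(2)[OF that(1)] assms(2) by simp
    ultimately show ?thesis by linarith
  qed
  have inj: "inj_on ?g S"
    by (rule inj_onI) (metis lt less_irrefl linorder_neqE_linordered_idom)
  have "?g ` S \<subseteq> {..nat \<lfloor>\<rho> / \<sigma>\<rfloor>}"
  proof (rule image_subsetI)
    fix a assume a: "a \<in> S"
    have "a - ?m \<le> \<rho>" using diam[OF m(1) a] m(2)[OF a] assms(3) by (cases "?m = a") auto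
    then have "(a - ?m) / \<sigma> \<le> \<rho> / \<sigma>" using assms(2) by (simp add: divide_right_mono)
    then show "?g a \<in> {..nat \<lfloor>\<rho> / \<sigma>\<rfloor>}" by (auto intro: nat_mono floor_mono)
  qed
  then have "card (?g ` S) \<le> card {..nat \<lfloor>\<rho> / \<sigma>\<rfloor>}" by (intro card_mono) auto
  then have "card S \<le> nat \<lfloor>\<rho> / \<sigma>\<rfloor> + 1" using card_image[OF inj] by simp
  moreover have "0 \<le> \<rho> / \<sigma>" using assms by simp
  ultimately show ?thesis by linarith
qed (use assms in auto)

text \<open>
  The second Bonferroni inequality.
\<close>

lemma sum_card_le_card_UN_plus_intersections:
  fixes A :: "nat \<Rightarrow> 'a set"
  assumes "\<And>m. m < M \<Longrightarrow> finite (A m)"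
  shows "(\<Sum>m<M. card (A m)) \<le> card (\<Union>m<M. A m) + (\<Sum>m'<M. \<Sum>m<m'. card (A m \<inter> A m'))"
  using assms
proof (induction M)
  case (Suc M)
  have fin: "finite (\<Union>m<M. A m)" "finite (A M)" using Suc.prems by auto
  have "card ((\<Union>m<M. A m) \<inter> A M) = card (\<Union>m<M. A m \<inter> A M)" by (simp add: Int_commute)
  also have "\<dots> \<le> (\<Sum>m<M. card (A m \<inter> A M))" by (rule card_UN_le) simp
  finally have "card (\<Union>m<M. A m) + card (A M) \<le> card ((\<Union>m<M. A m) \<union> A M) + (\<Sum>m<M. card (A m \<inter> A M))"
    using card_Un_Int[OF fin] by linarith
  moreover have "(\<Union>m<Suc M. A m) = (\<Union>m<M. A m) \<union> A M" by (auto simp: less_Suc_eq)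
  ultimately show ?case using Suc by (simp add: less_Suc_eq)
qed simp

text \<open>
  The translates of \<open>A\<close> by \<open>0, Q, \<dots>, (M - 1) * Q\<close> lie in an interval of length \<open>V + M * Q\<close> and overlap
  pairwise in at most \<open>B\<close> points.
\<close>

lemma card_le_of_few_close_pairs:
  fixes A :: "nat set" and B :: real
  assumes A: "A \<subseteq> {n0..<n0 + V}" and "0 < M" "0 < Q"
    and B: "\<And>m. Q \<le> m \<Longrightarrow> m \<le> M * Q \<Longrightarrow> real (card {n \<in> A. n + m \<in> A}) \<le> B" and "0 \<le> B"
  shows "real M * real (card A) \<le> real V + real M * real Q + (real M)\<^sup>2 * B"
proof -
  have finA: "finite A" using A finite_subset by blast
  define D where "D m = (\<lambda>n. n + m * Q) ` A" for m
  have fin: "finite (D m)" for m using finA by (simp add: D_def)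
  have cD: "card (D m) = card A" for m unfolding D_def by (intro card_image) (auto intro: inj_onI)
  have "(\<Union>m<M. D m) \<subseteq> {n0..<n0 + V + M * Q}"
  proof safe
    fix m n assume mn: "m < M" "n \<in> D m"
    then obtain a where a: "a \<in> A" "n = a + m * Q" by (auto simp: D_def)
    have "n0 \<le> a" "a < n0 + V" using A a by auto
    moreover have "m * Q \<le> M * Q" using mn by (intro mult_le_mono1) simp
    ultimately have "n0 \<le> n" "n < n0 + V + M * Q" unfolding a by linarith+
    then show "n \<in> {n0..<n0 + V + M * Q}" by simp
  qed
  then have "card (\<Union>m<M. D m) \<le> card {n0..<n0 + V + M * Q}" by (intro card_mono) auto
  then have 1: "card (\<Union>m<M. D m) \<le> V + M * Q" by simp
  have 2: "real (card (D m \<inter> D m')) \<le> B" if m: "m < m'" "m' < M" for m m'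
  proof -
    have "D m \<inter> D m' \<subseteq> (\<lambda>n. n + m' * Q) ` {n \<in> A. n + (m' - m) * Q \<in> A}"
    proof
      fix n assume "n \<in> D m \<inter> D m'"
      then obtain a b where ab: "a \<in> A" "b \<in> A" "n = a + m * Q" "n = b + m' * Q" by (auto simp: D_def)
      have "m' * Q = (m' - m) * Q + m * Q" using m by (simp flip: add_mult_distrib)
      then have "b + (m' - m) * Q = a" using ab by linarith
      then show "n \<in> (\<lambda>n. n + m' * Q) ` {n \<in> A. n + (m' - m) * Q \<in> A}" using ab by auto
    qed
    then have "card (D m \<inter> D m') \<le> card ((\<lambda>n. n + m' * Q) ` {n \<in> A. n + (m' - m) * Q \<in> A})"
      using finA by (intro card_mono) auto
    also have "\<dots> \<le> card {n \<in> A. n + (m' - m) * Q \<in> A}" using finA by (intro card_image_le) auto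
    finally have "real (card (D m \<inter> D m')) \<le> real (card {n \<in> A. n + (m' - m) * Q \<in> A})" by simp
    also have "\<dots> \<le> B"
    proof (rule B)
      have "1 * Q \<le> (m' - m) * Q" using m by (intro mult_le_mono1) simp
      then show "Q \<le> (m' - m) * Q" by simp
      show "(m' - m) * Q \<le> M * Q" using m by (intro mult_le_mono1) simp
    qed
    finally show ?thesis .
  qed
  have "real (\<Sum>m'<M. \<Sum>m<m'. card (D m \<inter> D m')) = (\<Sum>m'<M. \<Sum>m<m'. real (card (D m \<inter> D m')))" by simp
  also have "\<dots> \<le> (\<Sum>m'<M. \<Sum>m<m'. B)" by (intro sum_mono 2) auto
  also have "\<dots> \<le> (\<Sum>m'<M. real M * B)" using assms(5) by (intro sum_mono) (auto intro: mult_right_mono)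
  also have "\<dots> = (real M)\<^sup>2 * B" by (simp add: power2_eq_square)
  finally have 3: "real (\<Sum>m'<M. \<Sum>m<m'. card (D m \<inter> D m')) \<le> (real M)\<^sup>2 * B" .
  have "M * card A = (\<Sum>m<M. card (D m))" by (simp add: cD)
  also have "\<dots> \<le> card (\<Union>m<M. D m) + (\<Sum>m'<M. \<Sum>m<m'. card (D m \<inter> D m'))"
    by (rule sum_card_le_card_UN_plus_intersections) (rule fin)
  finally have "M * card A \<le> V + M * Q + (\<Sum>m'<M. \<Sum>m<m'. card (D m \<inter> D m'))" using 1 by linarith
  then have "real (M * card A) \<le> real (V + M * Q + (\<Sum>m'<M. \<Sum>m<m'. card (D m \<inter> D m')))" by (simp only: of_nat_le_iff)
  then show ?thesis using 3 by (simp only: of_nat_add of_nat_mult)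
qed

context kochergin
begin

text \<open>
  The singularities of \<open>bsum m\<close> cut the circle into \<open>m + 1\<close> arcs. Within one arc, the points with a
  singularity at distance at most \<open>\<delta>\<close> to their right lie in an interval of length \<open>\<delta>\<close>. On the other points the
  difference of the two Birkhoff sums is monotone with a large rate, so that those with a value in
  \<open>(-2, 2)\<close> lie in an interval of length \<open>\<rho>\<close>. Separation of the orbit bounds their number.
\<close>

lemma card_hits_le:
  fixes I :: "nat set" and x :: real
  defines "u \<equiv> \<lambda>n. frac (x + real n * \<alpha>)"
  assumes ns: "\<And>i (j::int). x + real i * \<alpha> \<noteq> of_int j" and I: "finite I"
    and sep: "\<And>n n'. n \<in> I \<Longrightarrow> n' \<in> I \<Longrightarrow> n \<noteq> n' \<Longrightarrow> \<sigma> \<le> \<bar>u n - u n'\<bar>"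
    and pos: "0 < \<sigma>" "0 < \<delta>" "\<delta> \<le> \<rho>"
    and visit: "\<And>y. \<exists>i<m. frac (y + real i * \<alpha>) < z" and z: "z \<le> cf"
    and big: "4 \<le> \<rho> * \<delta> * (cf * z powr - (2 + \<gamma>) - Cf * real m)"
  shows "real (card {n \<in> I. \<bar>bsum m (u n) - bsum m (u n + \<delta>)\<bar> < 2}) \<le> 2 * (real m + 1) * (\<rho> / \<sigma> + 1)"
proof -
  define H where "H = {n \<in> I. \<bar>bsum m (u n) - bsum m (u n + \<delta>)\<bar> < 2}"
  have finH: "finite H" using I by (simp add: H_def)
  (* the number of singularities to the left of y identifies the arc of y *)
  define arc where "arc y = card {i. i < m \<and> frac (- (real i * \<alpha>)) \<le> y}" for y
  define near where "near y \<longleftrightarrow> (\<exists>i<m. \<exists>j::int. y < of_int j - real i * \<alpha> \<and> of_int j - real i * \<alpha> \<le> y + \<delta>)" for y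
  have arc_le: "arc y \<le> m" for y
  proof -
    have "arc y \<le> card {..<m}" unfolding arc_def by (intro card_mono) auto
    then show ?thesis by simp
  qed
  have same_arc: "\<not> (x1 < of_int j - real i * \<alpha> \<and> of_int j - real i * \<alpha> \<le> x2)"
    if "0 \<le> x1" "x1 < x2" "x2 < 1" "arc x1 = arc x2" "i < m" for x1 x2 i and j :: int
  proof
    assume a: "x1 < of_int j - real i * \<alpha> \<and> of_int j - real i * \<alpha> \<le> x2"
    have "{i. i < m \<and> frac (- (real i * \<alpha>)) \<le> x1} = {i. i < m \<and> frac (- (real i * \<alpha>)) \<le> x2}"
      using that by (intro card_subset_eq) (auto simp: arc_def)
    moreover have "frac (- (real i * \<alpha>)) = of_int j - real i * \<alpha>"
      using a that by (intro frac_unique_iff[THEN iffD2]) auto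
    ultimately have "i \<in> {i. i < m \<and> frac (- (real i * \<alpha>)) \<le> x1} \<longleftrightarrow> of_int j - real i * \<alpha> \<le> x2"
      using that(5) by simp
    moreover have "i \<in> {i. i < m \<and> frac (- (real i * \<alpha>)) \<le> x1} \<longleftrightarrow> of_int j - real i * \<alpha> \<le> x1"
      using that(5) \<open>frac _ = _\<close> by simp
    ultimately show False using a by linarith
  qed
  have ub: "0 \<le> u n" "u n < 1" for n by (auto simp: u_def frac_lt_1)
  have nsu: "u n \<noteq> of_int j - real i * \<alpha>" for n i and j :: int
  proof
    assume "u n = of_int j - real i * \<alpha>"
    then have "x + real (n + i) * \<alpha> = of_int (j + \<lfloor>x + real n * \<alpha>\<rfloor>)"
      by (simp add: u_def frac_def algebra_simps)
    then show False using ns by blast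
  qed
  have class_card: "real (card {n \<in> H. arc (u n) = l \<and> near (u n) = b}) \<le> \<rho> / \<sigma> + 1" for l b
  proof -
    let ?K = "{n \<in> H. arc (u n) = l \<and> near (u n) = b}"
    have inj: "inj_on u ?K"
    proof (rule inj_onI)
      fix n n' assume "n \<in> ?K" "n' \<in> ?K" "u n = u n'"
      then show "n = n'" using sep[of n n'] pos by (auto simp: H_def)
    qed
    have "real (card (u ` ?K)) \<le> \<rho> / \<sigma> + 1"
    proof (rule card_separated_le)
      show "finite (u ` ?K)" using finH by simp
      show "\<sigma> \<le> x2 - x1" if xs: "x1 \<in> u ` ?K" "x2 \<in> u ` ?K" "x1 < x2" for x1 x2
      proof -
        obtain n n' where n: "n \<in> ?K" "n' \<in> ?K" "x1 = u n" "x2 = u n'" using xs by blast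
        then have "\<sigma> \<le> \<bar>u n - u n'\<bar>" using xs(3) by (intro sep) (auto simp: H_def)
        then show ?thesis using n xs(3) by simp
      qed
      show "x2 - x1 \<le> \<rho>" if xs: "x1 \<in> u ` ?K" "x2 \<in> u ` ?K" "x1 < x2" for x1 x2
      proof (rule ccontr)
        assume far: "\<not> x2 - x1 \<le> \<rho>"
        obtain n1 n2 where n: "n1 \<in> ?K" "n2 \<in> ?K" "x1 = u n1" "x2 = u n2" using xs by blast
        have arcs: "0 \<le> x1" "x2 < 1" "arc x1 = arc x2" using n ub by auto
        have no: "\<not> near x1"
        proof
          assume "near x1"
          then obtain i j where ij: "i < m" "x1 < of_int j - real i * \<alpha>" "of_int j - real i * \<alpha> \<le> x1 + \<delta>"
            unfolding near_def by blast
          then show False using same_arc[OF arcs(1) xs(3) arcs(2,3) ij(1), of j] far pos by linarith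
        qed
        then have no2: "\<not> near x2" using n by auto
        have "(x2 - x1) * \<delta> * (cf * z powr - (2 + \<gamma>) - Cf * real m)
          \<le> (bsum m x1 - bsum m (x1 + \<delta>)) - (bsum m x2 - bsum m (x2 + \<delta>))"
        proof (rule bsum_second_difference[OF xs(3) pos(2) _ visit z])
          fix i and j :: int assume i: "i < m"
          show "\<not> (x1 \<le> of_int j - real i * \<alpha> \<and> of_int j - real i * \<alpha> \<le> x2 + \<delta>)"
            using same_arc[OF arcs(1) xs(3) arcs(2,3) i, of j] no2 nsu[of n1 j i] n(3) i
            unfolding near_def by (metis less_le not_le)
        qed
        also have "\<dots> < 4" using n by (auto simp: H_def abs_less_iff)
        finally have "(x2 - x1) * \<delta> * (cf * z powr - (2 + \<gamma>) - Cf * real m) < 4" .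
        moreover have "0 < \<rho> * \<delta>" using pos by simp
        then have "0 < cf * z powr - (2 + \<gamma>) - Cf * real m"
          using big by (metis less_le_trans zero_less_mult_pos zero_less_numeral)
        then have "\<rho> * \<delta> * (cf * z powr - (2 + \<gamma>) - Cf * real m) \<le> (x2 - x1) * \<delta> * (cf * z powr - (2 + \<gamma>) - Cf * real m)"
          using far pos by (intro mult_right_mono) auto
        ultimately show False using big by linarith
      qed
    qed (use pos in auto)
    then show ?thesis using card_image[OF inj] by simp
  qed
  have "H = (\<Union>p\<in>{..m} \<times> UNIV. {n \<in> H. arc (u n) = fst p \<and> near (u n) = snd p})"
    using arc_le by auto
  then have "card H \<le> (\<Sum>p\<in>{..m} \<times> (UNIV::bool set). card {n \<in> H. arc (u n) = fst p \<and> near (u n) = snd p})"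
    using card_UN_le[of "{..m} \<times> (UNIV::bool set)" "\<lambda>p. {n \<in> H. arc (u n) = fst p \<and> near (u n) = snd p}"] by simp
  then have "real (card H) \<le> (\<Sum>p\<in>{..m} \<times> (UNIV::bool set). real (card {n \<in> H. arc (u n) = fst p \<and> near (u n) = snd p}))"
    by (simp flip: of_nat_sum)
  also have "\<dots> \<le> (\<Sum>p\<in>{..m} \<times> (UNIV::bool set). \<rho> / \<sigma> + 1)" by (intro sum_mono class_card)
  also have "\<dots> = 2 * (real m + 1) * (\<rho> / \<sigma> + 1)" by (simp add: card_cartesian_product algebra_simps)
  finally show ?thesis unfolding H_def .
qed

end

lemma frac_add_of_int: "frac (x + of_int j) = frac x"
  by (simp only: frac_def floor_add_int of_int_add) simp

lemma powr_eventually_large: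
  fixes a K :: real
  assumes "0 < a"
  obtains L0 where "1 \<le> L0" "\<And>L. L0 \<le> L \<Longrightarrow> K \<le> L powr a"
proof -
  define L0 where "L0 = max 1 (max 1 K powr (1/a))"
  show ?thesis
  proof (rule that[of L0])
    fix L assume "L0 \<le> L"
    then have "(max 1 K powr (1/a)) powr a \<le> L powr a" using assms by (intro powr_mono2) (auto simp: L0_def)
    then show "K \<le> L powr a" using assms by (simp add: powr_powr)
  qed (simp add: L0_def)
qed

context kochergin
begin

text \<open>
  With \<open>z = 3 * (c * m)\<^sup>-\<^sup>1\<^sup>/\<^sup>(\<^sup>1\<^sup>+\<^sup>\<kappa>\<^sup>)\<close>, the size of the arc visited within \<open>m\<close> steps, the power
  \<open>z powr - (2 + \<gamma>)\<close> grows faster than \<open>m\<close> and absorbs the negative part of the second derivative.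
\<close>

lemma visits_make_second_derivative_large:
  assumes \<kappa>: "0 < \<kappa>" "\<kappa> \<le> 1"
  obtains a m0 where "0 < a" "1 \<le> m0"
    "\<And>m. m0 \<le> real m \<Longrightarrow> \<exists>z\<le>cf. (\<forall>y. \<exists>i<m. frac (y + real i * \<alpha>) < z) \<and>
        a * real m powr ((2 + \<gamma>) / (1 + \<kappa>)) \<le> cf * z powr - (2 + \<gamma>) - Cf * real m"
proof -
  obtain c where c: "0 < c" "c \<le> 1"
    "\<And>(i::nat) (p::int). 0 < i \<Longrightarrow> c * real i powr (- (1 + \<kappa>)) \<le> \<bar>real i * \<alpha> - of_int p\<bar>"
    using diophantine_lower_bound[OF dio \<kappa>(1)] by metis
  define y where "y = 1 / (1 + \<kappa>)"
  have y: "1/2 \<le> y" "y < 1" using \<kappa> by (auto simp: y_def field_simps)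
  define b where "b = cf * 3 powr - (2 + \<gamma>) * c powr ((2 + \<gamma>) * y)"
  have b: "0 < b" using cf c by (simp add: b_def)
  have ex: "0 < (2 + \<gamma>) * y - 1" 
  proof -
    have "2 * y < (2 + \<gamma>) * y" using y \<gamma> by (intro mult_strict_right_mono) auto
    then show ?thesis using y by linarith
  qed
  obtain m1 where m1: "1 \<le> m1" "\<And>m. m1 \<le> m \<Longrightarrow> 2 * Cf / b \<le> m powr ((2 + \<gamma>) * y - 1)"
    using powr_eventually_large[OF ex] by metis
  obtain m2 where m2: "1 \<le> m2" "\<And>m. m2 \<le> m \<Longrightarrow> 3 / cf / c powr y \<le> m powr y"
    using powr_eventually_large[of y] y by auto
  show ?thesis
  proof (rule that[of "b / 2" "max m1 m2"])
    fix m :: nat assume m: "max m1 m2 \<le> real m"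
    have mpos: "0 < m" using m m1 by (cases m) auto
    define z where "z = 3 * (c * real m) powr - y"
    have z: "0 < z" using c mpos by (simp add: z_def)
    have "z \<le> cf"
    proof -
      have "3 / cf \<le> c powr y * real m powr y" using m2(2)[of "real m"] m c(1) cf by (simp add: divide_simps mult_ac)
      also have "\<dots> = (c * real m) powr y" using c by (simp add: powr_mult)
      finally have "3 / (c * real m) powr y \<le> cf" using cf c mpos by (simp add: field_simps)
      then show ?thesis by (simp add: z_def powr_minus divide_inverse)
    qed
    moreover have "\<forall>y. \<exists>i<m. frac (y + real i * \<alpha>) < z"
      using orbit_visits_zero[OF c(1,2) \<kappa>(1) c(3) mpos] by (auto simp: z_def y_def)
    moreover have "b / 2 * real m powr ((2 + \<gamma>) / (1 + \<kappa>)) \<le> cf * z powr - (2 + \<gamma>) - Cf * real m"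
    proof -
      have "z powr - (2 + \<gamma>) = 3 powr - (2 + \<gamma>) * ((c * real m) powr - y) powr - (2 + \<gamma>)"
        using c by (simp add: z_def powr_mult)
      also have "((c * real m) powr - y) powr - (2 + \<gamma>) = (c * real m) powr ((2 + \<gamma>) * y)"
      proof -
        have "- y * - (2 + \<gamma>) = (2 + \<gamma>) * y" by (simp add: algebra_simps)
        then show ?thesis by (simp only: powr_powr)
      qed
      also have "\<dots> = c powr ((2 + \<gamma>) * y) * real m powr ((2 + \<gamma>) * y)" using c by (simp add: powr_mult)
      finally have e: "cf * z powr - (2 + \<gamma>) = b * real m powr ((2 + \<gamma>) * y)" by (simp add: b_def)
      have "2 * Cf / b * real m \<le> real m powr ((2 + \<gamma>) * y - 1) * real m"
        using m1(2)[of "real m"] m by (intro mult_right_mono) auto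
      also have "\<dots> = real m powr ((2 + \<gamma>) * y)" using mpos
        by (metis powr_mult_base mult.commute add.commute diff_add_cancel of_nat_0_le_iff)
      finally have "Cf * real m \<le> b / 2 * real m powr ((2 + \<gamma>) * y)" using b by (simp add: field_simps)
      then show ?thesis unfolding e by (simp add: y_def field_simps)
    qed
    ultimately show "\<exists>z\<le>cf. (\<forall>y. \<exists>i<m. frac (y + real i * \<alpha>) < z) \<and>
        b / 2 * real m powr ((2 + \<gamma>) / (1 + \<kappa>)) \<le> cf * z powr - (2 + \<gamma>) - Cf * real m" by blast
  qed (use b m1 in auto)
qed

lemma frac_diff_lower_bound:
  assumes "\<And>(i::nat) (p::int). 0 < i \<Longrightarrow> c * real i powr (- (1 + \<kappa>)) \<le> \<bar>real i * \<alpha> - of_int p\<bar>"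
    "n \<noteq> n'" "0 < \<kappa>" "0 < c" "real n \<le> real n' + V" "real n' \<le> real n + V"
  shows "c * V powr (- (1 + \<kappa>)) \<le> \<bar>frac (x + real n * \<alpha>) - frac (x + real n' * \<alpha>)\<bar>"
proof -
  have *: "c * V powr (- (1 + \<kappa>)) \<le> \<bar>frac (x + real n * \<alpha>) - frac (x + real n' * \<alpha>)\<bar>"
    if "n' < n" "real n \<le> real n' + V" for n n' :: nat
  proof -
    have "c * V powr (- (1 + \<kappa>)) \<le> c * real (n - n') powr (- (1 + \<kappa>))"
      using that assms by (intro mult_left_mono powr_mono2') auto
    also have "\<dots> \<le> \<bar>real (n - n') * \<alpha> - of_int (\<lfloor>x + real n * \<alpha>\<rfloor> - \<lfloor>x + real n' * \<alpha>\<rfloor>)\<bar>"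
      using that by (intro assms(1)) auto
    also have "\<dots> = \<bar>frac (x + real n * \<alpha>) - frac (x + real n' * \<alpha>)\<bar>"
      using that by (simp add: frac_def of_nat_diff algebra_simps)
    finally show ?thesis .
  qed
  show ?thesis
  proof (cases "n' < n")
    case True
    then show ?thesis using *[of n' n] assms by simp
  next
    case False
    then show ?thesis using *[of n n'] assms by (simp add: abs_minus_commute)
  qed
qed

lemma bsum_add_int: "bsum m (x + of_int j) = bsum m x"
proof -
  have "frac (x + of_int j + real i * \<alpha>) = frac (x + real i * \<alpha>)" for i
    using frac_add_of_int[of "x + real i * \<alpha>" j] by (simp add: algebra_simps)
  then show ?thesis by (simp add: bsum_def)
qed

lemma bsum_frac_add: "bsum m (frac y + d) = bsum m (y + d)"
  using bsum_add_int[of m "frac y + d" "\<lfloor>y\<rfloor>"] by (simp add: frac_def)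

text \<open>
  Two matched steps at a time difference \<open>m\<close> form a hit for the function \<open>S\<^sub>m(y) - S\<^sub>m(y + \<delta>)\<close>. With the
  window \<open>V = L\<^sup>1\<^sup>+\<^sup>1\<^sup>2\<^sup>e\<close>, shifts by multiples of \<open>Q = L\<^sup>1\<^sup>+\<^sup>8\<^sup>e\<close> and \<open>M = L\<^sup>e\<close> of them, the monotonicity rate
  exceeds \<open>V\<close> (this fixes \<open>Q\<close>), so the number of hits is \<open>O(M * Q)\<close> up to a factor \<open>L\<^sup>e\<close>, and \<open>M\<close> times
  this number is still of the order of \<open>V / M\<close>.
\<close>

theorem few_matched_steps:
  assumes e: "0 < e" "12 * e \<le> 1" "12 * e \<le> \<gamma>"
  obtains K L0 where "0 < K" "1 \<le> L0"
    "\<And>L \<delta> V n0 x A. \<lbrakk>L0 \<le> L; L powr - (1 + \<gamma>) / 2 < \<delta>; \<delta> \<le> L powr - (1 + \<gamma>);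
       real V \<le> 2 * L powr (1 + 12 * e); \<And>i (j::int). x + real i * \<alpha> \<noteq> of_int j;
       A \<subseteq> {n0..<n0 + V};
       \<And>n m. n \<in> A \<Longrightarrow> n + m \<in> A \<Longrightarrow> 0 < m \<Longrightarrow>
         \<bar>bsum m (x + real n * \<alpha>) - bsum m (x + real n * \<alpha> + \<delta>)\<bar> < 2\<rbrakk>
     \<Longrightarrow> real (card A) \<le> K * L powr (1 + 11 * e)"
proof -
  (* small enough for the Diophantine losses to be absorbed by one factor L powr e *)
  define \<kappa> where "\<kappa> = e / 20"
  have \<kappa>: "0 < \<kappa>" "\<kappa> \<le> 1" using e by (auto simp: \<kappa>_def)
  obtain c where c: "0 < c" "c \<le> 1"
    "\<And>(i::nat) (p::int). 0 < i \<Longrightarrow> c * real i powr (- (1 + \<kappa>)) \<le> \<bar>real i * \<alpha> - of_int p\<bar>"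
    using diophantine_lower_bound[OF dio \<kappa>(1)] by metis
  obtain a m0 where a: "0 < a" "1 \<le> m0"
    "\<And>m. m0 \<le> real m \<Longrightarrow> \<exists>z\<le>cf. (\<forall>y. \<exists>i<m. frac (y + real i * \<alpha>) < z) \<and>
        a * real m powr ((2 + \<gamma>) / (1 + \<kappa>)) \<le> cf * z powr - (2 + \<gamma>) - Cf * real m"
    using visits_make_second_derivative_large[OF \<kappa>] by metis
  obtain L1 where L1: "1 \<le> L1" "\<And>L. L1 \<le> L \<Longrightarrow> 8 / a \<le> L powr (3 * e)"
    using powr_eventually_large[of "3 * e"] e by auto
  define K where "K = 32 * (8 / c + 1) + 4"
  show ?thesis
  proof (rule that[of K "max m0 L1"])
    show "0 < K" "1 \<le> max m0 L1" using c a by (auto simp: K_def intro!: add_pos_pos)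
  next
    fix L \<delta> x :: real and V n0 :: nat and A :: "nat set"
    assume L: "max m0 L1 \<le> L" and \<delta>: "L powr - (1 + \<gamma>) / 2 < \<delta>" "\<delta> \<le> L powr - (1 + \<gamma>)"
      and V: "real V \<le> 2 * L powr (1 + 12 * e)" and ns: "\<And>i (j::int). x + real i * \<alpha> \<noteq> of_int j"
      and A: "A \<subseteq> {n0..<n0 + V}"
      and match: "\<And>n m. n \<in> A \<Longrightarrow> n + m \<in> A \<Longrightarrow> 0 < m \<Longrightarrow>
         \<bar>bsum m (x + real n * \<alpha>) - bsum m (x + real n * \<alpha> + \<delta>)\<bar> < 2"
    have L1': "1 \<le> L" "m0 \<le> L" using L a by auto
    have Lp: "1 \<le> L powr b" if "0 \<le> b" for b using L1' that by (simp add: ge_one_powr_ge_zero)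
    have LL: "L powr u * L powr v = L powr w" if "u + v = w" for u v w
      using that by (metis powr_add)
    define M where "M = nat \<lceil>L powr e\<rceil>"
    define Q where "Q = nat \<lceil>L powr (1 + 8 * e)\<rceil>"
    define \<rho> where "\<rho> = L powr - (1 + 12 * e)"
    define \<sigma> where "\<sigma> = c * (2 * L powr (1 + 12 * e)) powr - (1 + \<kappa>)"
    have M: "L powr e \<le> real M" "real M \<le> 2 * L powr e" "0 < M"
      using Lp[of e] e unfolding M_def by linarith+
    have Q: "L powr (1 + 8 * e) \<le> real Q" "real Q \<le> 2 * L powr (1 + 8 * e)" "0 < Q"
      using Lp[of "1 + 8 * e"] e unfolding Q_def by linarith+
    have MQ: "real (M * Q) \<le> 4 * L powr (1 + 9 * e)"
    proof -
      have "real (M * Q) \<le> (2 * L powr e) * (2 * L powr (1 + 8 * e))"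
        using M Q by (simp only: of_nat_mult) (intro mult_mono, auto)
      also have "\<dots> = 4 * (L powr e * L powr (1 + 8 * e))" by simp
      also have "L powr e * L powr (1 + 8 * e) = L powr (e + (1 + 8 * e))" by (rule powr_add[symmetric])
      also have "e + (1 + 8 * e) = 1 + 9 * e" by simp
      finally show ?thesis .
    qed
    have \<sigma>: "0 < \<sigma>" using c L1' by (simp add: \<sigma>_def)
    have \<delta>\<rho>: "0 < \<delta>" "\<delta> \<le> \<rho>"
    proof -
      show "0 < \<delta>" using \<delta>(1) by (meson half_gt_zero_iff less_trans powr_gt_zero not_less_iff_gr_or_eq L1' less_le_trans zero_less_one powr_ge_zero divide_nonneg_nonneg zero_le_numeral le_less_trans)
      have "L powr - (1 + \<gamma>) \<le> \<rho>" unfolding \<rho>_def using L1' e by (intro powr_mono) auto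
      then show "\<delta> \<le> \<rho>" using \<delta> by linarith
    qed
    have \<rho>\<sigma>: "\<rho> / \<sigma> + 1 \<le> (8 / c + 1) * L powr e"
    proof -
      let ?W = "L powr (1 + 12 * e)"
      have W: "1 \<le> ?W" using Lp[of "1 + 12 * e"] e by simp
      have "\<rho> / \<sigma> = (1 / ?W) * (2 * ?W) powr (1 + \<kappa>) / c"
        unfolding \<rho>_def \<sigma>_def powr_minus by (simp add: divide_simps)
      also have "(2 * ?W) powr (1 + \<kappa>) = 2 powr (1 + \<kappa>) * (?W * ?W powr \<kappa>)" using W by (simp add: powr_mult powr_add)
      also have "(1 / ?W) * (2 powr (1 + \<kappa>) * (?W * ?W powr \<kappa>)) / c = 2 powr (1 + \<kappa>) * ?W powr \<kappa> / c"
        using W by simp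
      also have "?W powr \<kappa> = L powr ((1 + 12 * e) * \<kappa>)" by (simp add: powr_powr)
      also have "2 powr (1 + \<kappa>) * L powr ((1 + 12 * e) * \<kappa>) / c \<le> 2 powr 3 * L powr e / c"
      proof (intro divide_right_mono mult_mono powr_mono)
        have "(1 + 12 * e) * \<kappa> \<le> 2 * \<kappa>" using e \<kappa> by (intro mult_right_mono) auto
        then show "(1 + 12 * e) * \<kappa> \<le> e" using e by (simp add: \<kappa>_def)
      qed (use \<kappa> c L1' in auto)
      also have "\<dots> = 8 / c * L powr e" by simp
      finally show ?thesis using Lp[of e] e by (simp add: algebra_simps)
    qed
    have close: "real (card {n \<in> A. n + m \<in> A}) \<le> 16 * (8 / c + 1) * L powr (1 + 10 * e)"
      if m: "Q \<le> m" "m \<le> M * Q" for m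
    proof -
      have mL: "L powr (1 + 8 * e) \<le> real m" using Q m by linarith
      have "L \<le> L powr (1 + 8 * e)" using powr_mono[of 1 "1 + 8 * e" L] L1' e by simp
      then have "m0 \<le> real m" using L1' mL by linarith
      then obtain z where z: "z \<le> cf" "\<And>y. \<exists>i<m. frac (y + real i * \<alpha>) < z"
        "a * real m powr ((2 + \<gamma>) / (1 + \<kappa>)) \<le> cf * z powr - (2 + \<gamma>) - Cf * real m" using a(3) by blast
      have big: "4 \<le> \<rho> * \<delta> * (cf * z powr - (2 + \<gamma>) - Cf * real m)"
      proof -
        let ?E = "(1 + 8 * e) * ((2 + \<gamma>) / (1 + \<kappa>))"
        (* the exponent of L in the monotonicity rate divided by V; positivity is what fixes Q *)
        have E: "3 * e \<le> ?E - (2 + \<gamma> + 12 * e)"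
        proof -
          have "e * e \<le> e * (1 / 12)" using e by (intro mult_left_mono) auto
          moreover have "(1 + 7.5 * e) * (1 + \<kappa>) = 1 + 7.5 * e + e / 20 + 3 / 8 * (e * e)"
            by (simp add: \<kappa>_def field_simps)
          ultimately have "(1 + 7.5 * e) * (1 + \<kappa>) \<le> 1 + 8 * e" using e by linarith
          then have "1 + 7.5 * e \<le> (1 + 8 * e) / (1 + \<kappa>)" using \<kappa> by (simp add: pos_le_divide_eq)
          then have "(2 + \<gamma>) * (1 + 7.5 * e) \<le> (2 + \<gamma>) * ((1 + 8 * e) / (1 + \<kappa>))" using \<gamma> by (intro mult_left_mono) auto
          also have "\<dots> = ?E" by simp
          finally have "(2 + \<gamma>) + (2 + \<gamma>) * (7.5 * e) \<le> ?E" by (simp add: algebra_simps)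
          moreover have "2 * (7.5 * e) \<le> (2 + \<gamma>) * (7.5 * e)" using \<gamma> e by (intro mult_right_mono) auto
          ultimately show ?thesis by linarith
        qed
        have "4 \<le> (a / 2) * L powr (3 * e)" using L1(2)[of L] L a by (simp add: field_simps)
        also have "\<dots> \<le> (a / 2) * L powr (?E - (2 + \<gamma> + 12 * e))" using E L1' a by (intro mult_left_mono powr_mono) auto
        also have "\<dots> = \<rho> * (L powr - (1 + \<gamma>) / 2) * (a * L powr ?E)"
        proof -
          have "?E - (2 + \<gamma> + 12 * e) = - (1 + 12 * e) + (- (1 + \<gamma>)) + ?E" by simp
          then show ?thesis by (simp only: powr_add \<rho>_def)  simp
        qed
        also have "\<dots> \<le> \<rho> * \<delta> * (a * L powr ?E)" using \<delta> a by (intro mult_right_mono mult_left_mono) (auto simp: \<rho>_def)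
        also have "L powr ?E \<le> real m powr ((2 + \<gamma>) / (1 + \<kappa>))"
        proof -
          have "L powr ?E = (L powr (1 + 8 * e)) powr ((2 + \<gamma>) / (1 + \<kappa>))" by (simp only: powr_powr)
          also have "\<dots> \<le> real m powr ((2 + \<gamma>) / (1 + \<kappa>))" using mL \<gamma> \<kappa> by (intro powr_mono2) auto
          finally show ?thesis .
        qed
        also have "a * real m powr ((2 + \<gamma>) / (1 + \<kappa>)) \<le> cf * z powr - (2 + \<gamma>) - Cf * real m" by (rule z(3))
        finally show ?thesis using \<delta>\<rho> a by (simp add: mult_left_mono)
      qed
      let ?u = "\<lambda>n. frac (x + real n * \<alpha>)"
      let ?H = "{n \<in> {n0..<n0+V}. \<bar>bsum m (?u n) - bsum m (?u n + \<delta>)\<bar> < 2}"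
      have hits: "real (card ?H) \<le> 2 * (real m + 1) * (\<rho> / \<sigma> + 1)"
      proof (rule card_hits_le[OF ns _ _ \<sigma> \<delta>\<rho> z(2,1) big])
        fix n n' assume "n \<in> {n0..<n0 + V}" "n' \<in> {n0..<n0 + V}" "n \<noteq> n'"
        then show "\<sigma> \<le> \<bar>?u n - ?u n'\<bar>" unfolding \<sigma>_def
          using V by (intro frac_diff_lower_bound[OF c(3) _ \<kappa>(1) c(1)]) auto
      qed simp
      have "{n \<in> A. n + m \<in> A} \<subseteq> ?H"
      proof
        fix n assume n: "n \<in> {n \<in> A. n + m \<in> A}"
        have "0 < m" using m Q by linarith
        then show "n \<in> ?H" using n match[of n m] A bsum_frac_add[of m "x + real n * \<alpha>" 0] bsum_frac_add[of m "x + real n * \<alpha>" \<delta>] by auto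
      qed
      then have "real (card {n \<in> A. n + m \<in> A}) \<le> real (card ?H)" by (intro of_nat_mono card_mono) auto
      also have "\<dots> \<le> 2 * (real m + 1) * (\<rho> / \<sigma> + 1)" by (rule hits)
      also have "\<dots> \<le> 2 * (8 * L powr (1 + 9 * e)) * ((8 / c + 1) * L powr e)"
      proof (intro mult_mono \<rho>\<sigma>)
        have "real m \<le> real (M * Q)" using m by (intro of_nat_mono)
        then show "real m + 1 \<le> 8 * L powr (1 + 9 * e)" using MQ Lp[of "1 + 9 * e"] e by linarith
      qed (use \<sigma> \<delta>\<rho> in \<open>auto intro!: add_nonneg_nonneg divide_nonneg_pos\<close>)
      also have "\<dots> = 16 * (8 / c + 1) * (L powr (1 + 9 * e) * L powr e)" by (simp add: mult_ac)
      also have "L powr (1 + 9 * e) * L powr e = L powr (1 + 10 * e)" by (rule LL) simp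
      finally show ?thesis .
    qed
    define B where "B = 16 * (8 / c + 1) * L powr (1 + 10 * e)"
    have B0: "0 \<le> B" using c by (simp add: B_def)
    have "real M * real (card A) \<le> real V + real M * real Q + (real M)\<^sup>2 * B"
      by (rule card_le_of_few_close_pairs[OF A M(3) Q(3) _ B0]) (use close in \<open>simp add: B_def\<close>)
    then have "real (card A) \<le> real V / real M + real Q + real M * B"
      using M by (simp add: field_simps power2_eq_square)
    moreover have "real V / real M \<le> 2 * L powr (1 + 11 * e)"
    proof -
      have "real V / real M \<le> 2 * L powr (1 + 12 * e) / L powr e" using V M L1' by (intro frac_le) auto
      also have "\<dots> = 2 * L powr (1 + 11 * e)"
        using LL[of e "1 + 11 * e" "1 + 12 * e"] L1' by (simp add: divide_simps mult_ac)
      finally show ?thesis .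
    qed
    moreover have "real Q \<le> 2 * L powr (1 + 11 * e)"
    proof -
      have "L powr (1 + 8 * e) \<le> L powr (1 + 11 * e)" using L1' e by (intro powr_mono) auto
      then show ?thesis using Q by linarith
    qed
    moreover have "real M * B \<le> 32 * (8 / c + 1) * L powr (1 + 11 * e)"
    proof -
      have "real M * B \<le> (2 * L powr e) * B" using M B0 by (intro mult_right_mono) auto
      also have "\<dots> = 32 * (8 / c + 1) * (L powr e * L powr (1 + 10 * e))" by (simp add: B_def mult_ac)
      also have "L powr e * L powr (1 + 10 * e) = L powr (1 + 11 * e)" by (rule LL) simp
      finally show ?thesis .
    qed
    ultimately have "real (card A) \<le> (32 * (8 / c + 1) + 4) * L powr (1 + 11 * e)" by (simp only: distrib_right)
    then show "real (card A) \<le> K * L powr (1 + 11 * e)" by (simp only: K_def)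
  qed
qed

end

section \<open>The special flow and its invariant measure\<close>

lemma borel_measurable_fst_snd [measurable]:
  "(fst :: 'a::euclidean_space \<times> 'b::euclidean_space \<Rightarrow> 'a) \<in> borel_measurable borel"
  "(snd :: 'a::euclidean_space \<times> 'b::euclidean_space \<Rightarrow> 'b) \<in> borel_measurable borel"
  by (intro borel_measurable_continuous_onI continuous_intros)+

lemma borel_measurable_frac [measurable]: "(frac :: real \<Rightarrow> real) \<in> borel_measurable borel"
  unfolding frac_def by measurable

lemma nn_integral_rotation:
  fixes g :: "real \<Rightarrow> ennreal"
  assumes [measurable]: "g \<in> borel_measurable borel"
  shows "(\<integral>\<^sup>+x. indicator {0..<1} x * g (frac (x + a)) \<partial>lborel) = (\<integral>\<^sup>+x. indicator {0..<1} x * g x \<partial>lborel)"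
proof -
  define b where "b = frac a"
  have b: "0 \<le> b" "b < 1" by (auto simp: b_def frac_lt_1)
  have fr: "frac (x + a) = (if x < 1 - b then x + b else x + b - 1)" if "0 \<le> x" "x < 1" for x
  proof -
    have "frac (x + a) = frac (x + b)"
    proof -
      have "x + a = (x + b) + of_int \<lfloor>a\<rfloor>" by (simp add: b_def frac_def)
      then show ?thesis by (metis frac_add_of_int)
    qed
    then show ?thesis using that b by (auto simp: frac_def floor_eq_iff)
  qed
  have "(\<integral>\<^sup>+x. indicator {0..<1} x * g (frac (x + a)) \<partial>lborel)
      = (\<integral>\<^sup>+x. indicator {b..<1} (b + 1 * x) * g (b + 1 * x) + indicator {0..<b} ((b - 1) + 1 * x) * g ((b - 1) + 1 * x) \<partial>lborel)"
    using b by (intro nn_integral_cong) (auto simp: fr indicator_def algebra_simps)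
  also have "\<dots> = (\<integral>\<^sup>+x. indicator {b..<1} (b + 1 * x) * g (b + 1 * x) \<partial>lborel)
     + (\<integral>\<^sup>+x. indicator {0..<b} ((b - 1) + 1 * x) * g ((b - 1) + 1 * x) \<partial>lborel)"
    by (intro nn_integral_add) auto
  also have "\<dots> = (\<integral>\<^sup>+x. indicator {b..<1} x * g x \<partial>lborel) + (\<integral>\<^sup>+x. indicator {0..<b} x * g x \<partial>lborel)"
    using nn_integral_real_affine[of "\<lambda>x. indicator {b..<1} x * g x" 1 b]
      nn_integral_real_affine[of "\<lambda>x. indicator {0..<b} x * g x" 1 "b - 1"] by simp
  also have "\<dots> = (\<integral>\<^sup>+x. indicator {b..<1} x * g x + indicator {0..<b} x * g x \<partial>lborel)"
    by (intro nn_integral_add[symmetric]) auto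
  also have "\<dots> = (\<integral>\<^sup>+x. indicator {0..<1} x * g x \<partial>lborel)"
    using b by (intro nn_integral_cong) (auto simp: indicator_def)
  finally show ?thesis .
qed

lemma emeasure_lborel_shift:
  fixes B :: "real set"
  assumes [measurable]: "B \<in> sets borel"
  shows "emeasure lborel {s. s + a \<in> B} = emeasure lborel B"
proof -
  have "emeasure lborel B = emeasure (distr lborel borel ((+) a)) B" by (simp add: lborel_distr_plus)
  also have "\<dots> = emeasure lborel {s. s + a \<in> B}"
    by (subst emeasure_distr) (auto simp: vimage_def add.commute)
  finally show ?thesis by simp
qed

lemma emeasure_lborel_prod:
  fixes A :: "('a::euclidean_space \<times> 'b::euclidean_space) set"
  assumes "A \<in> sets borel"
  shows "emeasure lborel A = (\<integral>\<^sup>+x. emeasure lborel (Pair x -` A) \<partial>lborel)"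
    "(\<lambda>x. emeasure lborel (Pair x -` A)) \<in> borel_measurable borel"
proof -
  have A: "A \<in> sets (lborel \<Otimes>\<^sub>M lborel)" using assms unfolding lborel_prod by simp
  show "emeasure lborel A = (\<integral>\<^sup>+x. emeasure lborel (Pair x -` A) \<partial>lborel)"
    using lborel.emeasure_pair_measure_alt[OF A] by (simp add: lborel_prod)
  show "(\<lambda>x. emeasure lborel (Pair x -` A)) \<in> borel_measurable borel"
    using lborel.measurable_emeasure_Pair[OF A] by simp
qed

text \<open>
  Fubini: translations of the fibre and rotations of the base preserve Lebesgue measure.
\<close>

lemma emeasure_skew_rotation_vimage_le:
  fixes B :: "(real \<times> real) set" and \<psi> :: "real \<Rightarrow> real"
  assumes [measurable]: "B \<in> sets borel" "\<psi> \<in> borel_measurable borel"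
  shows "emeasure lborel {p. fst p \<in> {0..<1} \<and> (frac (fst p + a), snd p + \<psi> (fst p)) \<in> B} \<le> emeasure lborel B"
    (is "emeasure lborel ?S \<le> _")
proof -
  define g where "g x = emeasure lborel (Pair x -` B)" for x
  have [measurable]: "g \<in> borel_measurable borel" unfolding g_def by (rule emeasure_lborel_prod) simp
  have S: "?S \<in> sets borel"
  proof -
    have "{p \<in> space borel. fst p \<in> {0..<1} \<and> (frac (fst p + a), snd p + \<psi> (fst p)) \<in> B} \<in> sets (borel :: (real \<times> real) measure)"
      by measurable
    then show ?thesis by simp
  qed
  have "emeasure lborel ?S = (\<integral>\<^sup>+x. emeasure lborel (Pair x -` ?S) \<partial>lborel)"
    by (rule emeasure_lborel_prod(1)) (rule S)
  also have "\<dots> = (\<integral>\<^sup>+x. indicator {0..<1} x * g (frac (x + a)) \<partial>lborel)"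
  proof (intro nn_integral_cong)
    fix x :: real
    show "emeasure lborel (Pair x -` ?S) = indicator {0..<1} x * g (frac (x + a))"
    proof (cases "x \<in> {0..<1}")
      case True
      have "Pair (frac (x + a)) -` B \<in> sets borel"
      proof -
        have "Pair (frac (x + a)) \<in> borel_measurable (borel :: real measure)"
          by (intro borel_measurable_continuous_onI continuous_intros)
        from measurable_sets[OF this assms(1)] show ?thesis by simp
      qed
      moreover have "Pair x -` ?S = {s. s + \<psi> x \<in> Pair (frac (x + a)) -` B}" using True by auto
      ultimately have "emeasure lborel (Pair x -` ?S) = g (frac (x + a))"
        by (simp only: g_def emeasure_lborel_shift)
      then show ?thesis using True by simp
    next
      case False
      then have "Pair x -` ?S = {}" by auto
      moreover have "indicator {0..<1} x = (0 :: ennreal)" using False by simp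
      ultimately show ?thesis by (simp only: emeasure_empty mult_zero_left)
    qed
  qed
  also have "\<dots> = (\<integral>\<^sup>+x. indicator {0..<1} x * g x \<partial>lborel)" by (rule nn_integral_rotation) simp
  also have "\<dots> \<le> (\<integral>\<^sup>+x. g x \<partial>lborel)" by (intro nn_integral_mono) (auto simp: indicator_def)
  also have "\<dots> = emeasure lborel B" unfolding g_def by (rule emeasure_lborel_prod(1)[symmetric]) simp
  finally show ?thesis .
qed

context kochergin
begin

abbreviation X :: "(real \<times> real) set" where "X \<equiv> special_flow_space \<alpha> f"

definition regular :: "real \<Rightarrow> bool" where
  "regular x \<longleftrightarrow> (\<forall>n::int. frac (x + of_int n * \<alpha>) \<noteq> 0)"

lemma X_iff: "(x, s) \<in> X \<longleftrightarrow> 0 \<le> x \<and> x < 1 \<and> regular x \<and> 0 \<le> s \<and> s < f x"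
  by (auto simp: special_flow_space_def regular_def rotation_def)

lemma regular_frac: "regular x \<Longrightarrow> regular (frac (x + real n * \<alpha>))"
  unfolding regular_def
proof
  fix m :: int
  assume *: "\<forall>n::int. frac (x + of_int n * \<alpha>) \<noteq> 0"
  have "frac (x + real n * \<alpha>) + of_int m * \<alpha> = (x + of_int (int n + m) * \<alpha>) + of_int (- \<lfloor>x + real n * \<alpha>\<rfloor>)"
    by (simp add: frac_def algebra_simps)
  then have "frac (frac (x + real n * \<alpha>) + of_int m * \<alpha>) = frac (x + of_int (int n + m) * \<alpha>)"
    by (simp only: frac_add_of_int)
  then show "frac (frac (x + real n * \<alpha>) + of_int m * \<alpha>) \<noteq> 0" using * by metis
qed

lemma regular_not_int: "regular x \<Longrightarrow> x + of_int n * \<alpha> \<noteq> of_int j"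
  unfolding regular_def by (metis frac_of_int)

lemma regular_frac_bounds: "regular x \<Longrightarrow> 0 < frac (x + of_int n * \<alpha>)" "frac (x + of_int n * \<alpha>) < 1"
  unfolding regular_def by (metis frac_ge_0 less_le, rule frac_lt_1)

lemma f_ge_cf: "regular x \<Longrightarrow> cf \<le> f (frac (x + of_int n * \<alpha>))"
  using regular_frac_bounds by (intro roof_deriv) auto

lemma bsum_0 [simp]: "bsum 0 x = 0" by (simp add: bsum_def)

lemma bsum_Suc: "bsum (Suc n) x = bsum n x + f (frac (x + real n * \<alpha>))"
  by (simp add: bsum_def)

lemma bsum_add: "bsum (n + m) x = bsum n x + bsum m (x + real n * \<alpha>)"
  by (induction m) (simp_all add: bsum_Suc algebra_simps)

lemma bsum_ge:
  assumes "regular x"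
  shows "cf * real m \<le> bsum m (x + real n * \<alpha>)"
proof -
  have "cf * real m = (\<Sum>i<m. cf)" by simp
  also have "\<dots> \<le> (\<Sum>i<m. f (frac (x + of_int (int n + int i) * \<alpha>)))" by (intro sum_mono f_ge_cf assms)
  also have "\<dots> = bsum m (x + real n * \<alpha>)" by (simp add: bsum_def algebra_simps)
  finally show ?thesis .
qed

lemma bsum_diff_ge:
  assumes "regular x" "n \<le> n'"
  shows "cf * (real n' - real n) \<le> bsum n' x - bsum n x"
  using bsum_ge[OF assms(1), of "n' - n" n] bsum_add[of n "n' - n" x] assms(2) by (simp add: of_nat_diff)

lemma bsum_mono: "regular x \<Longrightarrow> n \<le> n' \<Longrightarrow> bsum n x \<le> bsum n' x"
  using bsum_diff_ge[of x n n'] cf by (smt (verit) mult_nonneg_nonneg of_nat_mono)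

lemma roof_measurable [measurable]: "(\<lambda>x. f (frac x)) \<in> borel_measurable borel"
proof -
  have "continuous_on {0<..<1} f"
    by (intro continuous_at_imp_continuous_on ballI DERIV_isCont[OF roof_deriv(1)]) auto
  then have [measurable]: "(\<lambda>x. indicator {0<..<1} x *\<^sub>R f x) \<in> borel_measurable borel"
    by (intro borel_measurable_continuous_on_indicator) auto
  have "f (frac x) = (if frac x = 0 then f 0 else indicator {0<..<1} (frac x) *\<^sub>R f (frac x))" for x
    using frac_ge_0[of x] frac_lt_1[of x] by (auto simp: indicator_def less_le simp del: frac_eq_0_iff)
  then have "(\<lambda>x. f (frac x)) = (\<lambda>x. if frac x = 0 then f 0 else indicator {0<..<1} (frac x) *\<^sub>R f (frac x))" by blast
  moreover have "\<dots> \<in> borel_measurable borel" by measurable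
  ultimately show ?thesis by simp
qed

lemma bsum_measurable [measurable]: "bsum n \<in> borel_measurable borel"
  unfolding bsum_def by measurable

lemma X_measurable [measurable]: "X \<in> sets borel"
proof -
  have "X = {p \<in> space borel. 0 \<le> fst p \<and> fst p < 1 \<and> (\<forall>n::int. frac (fst p + of_int n * \<alpha>) \<noteq> 0) \<and> 0 \<le> snd p \<and> snd p < f (frac (fst p))}"
    by (auto simp: X_iff regular_def frac_eq)
  also have "\<dots> \<in> sets borel" by measurable
  finally show ?thesis .
qed

text \<open>
  For nonnegative times the number of crossings of the roof is a natural number; as a least number it
  is a total and measurable function.
\<close>

definition steps :: "real \<Rightarrow> real \<times> real \<Rightarrow> nat" where
  "steps t p = (LEAST n. snd p + t < bsum (Suc n) (fst p))"

definition flow :: "real \<Rightarrow> real \<times> real \<Rightarrow> real \<times> real" where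
  "flow t p = (frac (fst p + real (steps t p) * \<alpha>), snd p + t - bsum (steps t p) (fst p))"

lemma steps_props:
  assumes "(x, s) \<in> X" "0 \<le> t"
  shows "bsum (steps t (x, s)) x \<le> s + t" "s + t < bsum (Suc (steps t (x, s))) x"
proof -
  have reg: "regular x" using assms X_iff by auto
  have "\<exists>n. s + t < bsum (Suc n) x"
  proof -
    obtain n where "(s + t) / cf < real n" using reals_Archimedean2 by blast
    then have "s + t < cf * real n" using cf by (simp add: field_simps)
    also have "\<dots> \<le> bsum n x" using bsum_ge[OF reg, of n 0] by simp
    also have "\<dots> \<le> bsum (Suc n) x" by (rule bsum_mono[OF reg]) simp
    finally show ?thesis by blast
  qed
  then show "s + t < bsum (Suc (steps t (x, s))) x" unfolding steps_def fst_conv snd_conv by (rule LeastI_ex)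
  show "bsum (steps t (x, s)) x \<le> s + t"
  proof (cases "steps t (x, s)")
    case 0
    then show ?thesis using assms X_iff by auto
  next
    case (Suc n)
    then have "n < (LEAST n. snd (x, s) + t < bsum (Suc n) (fst (x, s)))" by (simp add: steps_def)
    from not_less_Least[OF this] show ?thesis using Suc by auto
  qed
qed

lemma birkhoff_sum_nat: "birkhoff_sum \<alpha> f (int n) x = bsum n x"
proof -
  have "{0..<int n} = int ` {..<n}" by (auto simp: image_iff) (metis nat_less_iff int_nat_eq lessThan_iff)
  then show ?thesis by (simp add: birkhoff_sum_def bsum_def rotation_def sum.reindex)
qed

lemma birkhoff_sum_step: "birkhoff_sum \<alpha> f (N + 1) x = birkhoff_sum \<alpha> f N x + f (rotation \<alpha> N x)"
proof (cases "0 \<le> N")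
  case True
  then have "{0..<N + 1} = insert N {0..<N}" by auto
  then show ?thesis using True by (simp add: birkhoff_sum_def)
next
  case False
  have "{1..- N} = insert (- N) {1..- (N + 1)}" using False by auto
  moreover have "N + 1 = 0 \<or> N + 1 < 0" using False by linarith
  ultimately show ?thesis using False by (auto simp: birkhoff_sum_def)
qed

lemma birkhoff_sum_mono:
  assumes "regular x" "N \<le> N'"
  shows "birkhoff_sum \<alpha> f N x \<le> birkhoff_sum \<alpha> f N' x"
  using assms(2)
proof (induction N' rule: int_ge_induct)
  case (step i)
  have "0 < f (rotation \<alpha> i x)" using f_ge_cf[OF assms(1), of i] cf by (simp add: rotation_def)
  then show ?case using step by (simp add: birkhoff_sum_step)
qed simp

lemma special_flow_eq_flow:
  assumes "p \<in> X" "0 \<le> t"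
  shows "special_flow \<alpha> f t p = flow t p"
proof -
  obtain x s where p: "p = (x, s)" by fastforce
  have reg: "regular x" using assms p X_iff by auto
  let ?n = "steps t (x, s)"
  let ?P = "\<lambda>N. birkhoff_sum \<alpha> f N x \<le> s + t \<and> s + t < birkhoff_sum \<alpha> f (N + 1) x"
  have P: "?P (int ?n)" using steps_props[of x s t] assms p birkhoff_sum_nat[of "Suc ?n" x] birkhoff_sum_nat[of ?n x]
    by (simp add: add.commute)
  have "(THE N. ?P N) = int ?n"
  proof (rule the_equality)
    show "N = int ?n" if "?P N" for N
    proof (rule ccontr)
      assume "N \<noteq> int ?n"
      then consider "N + 1 \<le> int ?n" | "int ?n + 1 \<le> N" by linarith
      then show False using birkhoff_sum_mono[OF reg] P that by cases fastforce+
    qed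
  qed (rule P)
  then show ?thesis
    by (simp add: p special_flow_def flow_def Let_def birkhoff_sum_nat rotation_def)
qed

lemma flow_in_X:
  assumes "p \<in> X" "0 \<le> t"
  shows "flow t p \<in> X"
proof -
  obtain x s where p: "p = (x, s)" by fastforce
  have reg: "regular x" using assms p X_iff by auto
  show ?thesis using steps_props[of x s t] assms regular_frac[OF reg, of "steps t p"]
    by (auto simp: p flow_def X_iff frac_lt_1 bsum_Suc)
qed

lemma steps_mono_bound:
  assumes "p \<in> X" "0 \<le> t" "t \<le> t'"
  shows "steps t p \<le> steps t' p" "cf * (real (steps t' p) - real (steps t p) - 1) \<le> t' - t"
proof -
  obtain x s where p: "p = (x, s)" by fastforce
  have reg: "regular x" using assms p X_iff by auto
  note 1 = steps_props[of x s t] and 2 = steps_props[of x s t']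
  show le: "steps t p \<le> steps t' p"
  proof (rule ccontr)
    assume "\<not> ?thesis"
    then have "bsum (Suc (steps t' p)) x \<le> bsum (steps t p) x" by (intro bsum_mono reg) simp
    then show False using 1 2 assms p by auto
  qed
  show "cf * (real (steps t' p) - real (steps t p) - 1) \<le> t' - t"
  proof (cases "steps t' p = steps t p")
    case True
    then show ?thesis using assms cf by simp
  next
    case False
    then have "cf * (real (steps t' p) - real (Suc (steps t p))) \<le> bsum (steps t' p) x - bsum (Suc (steps t p)) x"
      using le by (intro bsum_diff_ge reg) simp
    also have "\<dots> \<le> t' - t" using 1 2 assms p by auto
    also have "real (steps t' p) - real (Suc (steps t p)) = real (steps t' p) - real (steps t p) - 1" by simp
    finally show ?thesis .
  qed
qed

lemma steps_measurable [measurable]: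
  "(\<lambda>q. steps (fst q) (snd q)) \<in> measurable (borel :: (real \<times> (real \<times> real)) measure) (count_space UNIV)"
  unfolding steps_def by measurable

lemma flow_measurable [measurable]:
  "(\<lambda>q. flow (fst q) (snd q)) \<in> borel_measurable (borel :: (real \<times> (real \<times> real)) measure)"
proof -
  define G where "G n q = (frac (fst (snd q) + real n * \<alpha>), snd (snd q) + fst q - bsum n (fst (snd q)))"
    for n and q :: "real \<times> (real \<times> real)"
  have "(\<lambda>q. G (steps (fst q) (snd q)) q) \<in> borel_measurable (borel :: (real \<times> (real \<times> real)) measure)"
    by (rule measurable_compose_countable) (simp_all add: G_def)
  then show ?thesis by (simp add: G_def flow_def)
qed

lemma steps_measurable_time [measurable]: "(\<lambda>t. real (steps t p)) \<in> borel_measurable borel"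
proof -
  have "(\<lambda>t. steps t p) \<in> measurable borel (count_space UNIV)"
    using measurable_compose[of "\<lambda>t. (t, p)" borel borel, OF _ steps_measurable] by simp
  then show ?thesis by (rule measurable_compose) simp
qed

lemma flow_measurable_swap [measurable]:
  "(\<lambda>q :: (real \<times> real) \<times> real. flow (snd q) (fst q)) \<in> borel_measurable borel"
  using measurable_compose[of "\<lambda>q::(real \<times> real) \<times> real. (snd q, fst q)" borel borel, OF _ flow_measurable] by simp

lemma flow_measurable_time [measurable]: "(\<lambda>t. flow t p) \<in> borel_measurable borel"
  using measurable_compose[of "\<lambda>t. (t, p)" borel borel, OF _ flow_measurable] by simp

lemma flow_measurable_point [measurable]: "flow t \<in> borel_measurable borel"
  using measurable_compose[of "\<lambda>p. (t, p)" borel borel, OF _ flow_measurable] by simp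

text \<open>
  On the points that cross the roof \<open>n\<close> times the flow acts as a skew rotation. The image of this piece
  lies in the region \<open>Z n\<close> of points from which the flow, run backwards for the time \<open>t\<close>, crosses the base
  exactly \<open>n\<close> times; these regions are disjoint.
\<close>

lemma emeasure_flow_vimage_le:
  assumes [measurable]: "A \<in> sets borel" and A: "A \<subseteq> X" and t: "0 \<le> t"
  shows "emeasure lborel {p \<in> X. flow t p \<in> A} \<le> emeasure lborel A"
proof -
  define r where "r n x = bsum n (x - real n * \<alpha>)" for n x
  define Z where "Z n = {p. t - r n (fst p) \<le> snd p \<and> snd p < t - r n (fst p) + f (frac (fst p - real n * \<alpha>))}" for n
  define Y where "Y n = {p. fst p \<in> {0..<1} \<and> (frac (fst p + real n * \<alpha>), snd p + (t - bsum n (fst p))) \<in> A \<inter> Z n}" for n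
  have [measurable]: "r n \<in> borel_measurable borel" for n unfolding r_def by measurable
  have "{p \<in> space borel. t - r n (fst p) \<le> snd p \<and> snd p < t - r n (fst p) + f (frac (fst p - real n * \<alpha>))} \<in> sets borel" for n
    by measurable
  then have Zm [measurable]: "Z n \<in> sets borel" for n by (simp add: Z_def)
  have "{p \<in> space borel. fst p \<in> {0..<1} \<and> (frac (fst p + real n * \<alpha>), snd p + (t - bsum n (fst p))) \<in> A \<inter> Z n} \<in> sets borel" for n
    by measurable
  then have Ym [measurable]: "Y n \<in> sets borel" for n by (simp add: Y_def)
  have sub: "{p \<in> X. flow t p \<in> A} \<subseteq> (\<Union>n. Y n)"
  proof
    fix p assume p: "p \<in> {p \<in> X. flow t p \<in> A}"
    obtain x s where xs: "p = (x, s)" by fastforce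
    let ?n = "steps t p"
    have x: "0 \<le> x" "x < 1" "0 \<le> s" "s < f x" using p xs X_iff by auto
    have 1: "r ?n (frac (x + real ?n * \<alpha>)) = bsum ?n x"
      using bsum_frac_add[of ?n "x + real ?n * \<alpha>" "- real ?n * \<alpha>"] by (simp add: r_def)
    have "frac (x + real ?n * \<alpha>) - real ?n * \<alpha> = x + of_int (- \<lfloor>x + real ?n * \<alpha>\<rfloor>)" by (simp add: frac_def)
    then have 2: "frac (frac (x + real ?n * \<alpha>) - real ?n * \<alpha>) = x"
      using x by (intro frac_unique_iff[THEN iffD2]) auto
    have "p \<in> Y ?n" using p x by (simp add: Y_def Z_def xs 1[unfolded xs] 2[unfolded xs] flow_def add_diff_eq)
    then show "p \<in> (\<Union>n. Y n)" by blast
  qed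
  have disj: "disjoint_family (\<lambda>n. A \<inter> Z n)"
  proof -
    have False if p: "(x, u) \<in> A" "(x, u) \<in> Z n" "(x, u) \<in> Z m" "n < m" for x u n m
    proof -
      have reg: "regular x" using p(1) A X_iff by auto
      have rS: "r (Suc k) x = f (frac (x - real (Suc k) * \<alpha>)) + r k x" for k
        using bsum_add[of 1 k "x - real (Suc k) * \<alpha>"] by (simp add: r_def bsum_def algebra_simps)
      have pos: "0 \<le> f (frac (x - real k * \<alpha>))" for k
        using f_ge_cf[OF reg, of "- int k"] cf by simp
      have mono: "r n x \<le> r k x" if "n \<le> k" for k
        using that by (induction k rule: dec_induct) (use rS pos in \<open>auto intro: order.trans simp del: of_nat_Suc\<close>)
      obtain k where k: "m = Suc k" "n \<le> k" using p(4) by (cases m) auto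
      have "u < t - r m x + f (frac (x - real m * \<alpha>))" using p(3) by (simp add: Z_def)
      also have "\<dots> = t - r k x" using rS[of k] k by simp
      also have "\<dots> \<le> t - r n x" using mono[OF k(2)] by simp
      finally show False using p(2) by (simp add: Z_def)
    qed
    then have no: "(A \<inter> Z n) \<inter> (A \<inter> Z m) = {}" if "n < m" for n m
      using that by fastforce
    show ?thesis
      unfolding disjoint_family_on_def
    proof (intro ballI impI)
      fix n m :: nat assume "n \<noteq> m"
      then consider "n < m" | "m < n" by linarith
      then show "(A \<inter> Z n) \<inter> (A \<inter> Z m) = {}" by cases (use no in blast)+
    qed
  qed
  have "emeasure lborel {p \<in> X. flow t p \<in> A} \<le> emeasure lborel (\<Union>n. Y n)"
    using sub by (intro emeasure_mono) auto
  also have "\<dots> \<le> (\<Sum>n. emeasure lborel (Y n))" by (intro emeasure_subadditive_countably) auto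
  also have "\<dots> \<le> (\<Sum>n. emeasure lborel (A \<inter> Z n))"
    unfolding Y_def by (intro suminf_le emeasure_skew_rotation_vimage_le) auto
  also have "\<dots> = emeasure lborel (\<Union>n. A \<inter> Z n)" using disj by (intro suminf_emeasure) auto
  also have "\<dots> \<le> emeasure lborel A" by (intro emeasure_mono) auto
  finally show ?thesis .
qed

end

lemma nn_integral_powr_unit_interval:
  assumes "0 < \<gamma>" "\<gamma> < (1::real)"
  shows "(\<integral>\<^sup>+x. indicator {0<..<1} x * ennreal (x powr - \<gamma>) \<partial>lborel) < \<infinity>"
proof -
  have "(\<lambda>x. x powr - \<gamma>) absolutely_integrable_on {0..1}"
    using assms by (intro nonnegative_absolutely_integrable_1 integrable_on_powr_from_0) auto
  then have "integrable lebesgue (\<lambda>x. indicator {0..1} x *\<^sub>R (x powr - \<gamma>))"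
    by (simp add: set_integrable_def)
  then have "integrable lborel (\<lambda>x. indicator {0..1} x *\<^sub>R (x powr - \<gamma>) :: real)"
    by (subst (asm) integrable_completion) auto
  then have "(\<integral>\<^sup>+x. ennreal (norm (indicator {0..1} x *\<^sub>R (x powr - \<gamma>))) \<partial>lborel) < \<infinity>"
    by (simp only: integrable_iff_bounded)
  moreover have "(\<integral>\<^sup>+x. indicator {0<..<1} x * ennreal (x powr - \<gamma>) \<partial>lborel)
     \<le> (\<integral>\<^sup>+x. ennreal (norm (indicator {0..1} x *\<^sub>R (x powr - \<gamma>))) \<partial>lborel)"
    by (intro nn_integral_mono) (auto simp: indicator_def)
  ultimately show ?thesis by (rule le_less_trans[rotated])
qed

context kochergin
begin

abbreviation M :: "(real \<times> real) measure" where "M \<equiv> special_flow_measure \<alpha> f"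

definition area :: real where "area = measure lborel X"

lemma X_section: "Pair x -` X = (if 0 \<le> x \<and> x < 1 \<and> regular x then {0..<f x} else {})"
  by (auto simp: X_iff)

lemma emeasure_X_finite: "emeasure lborel X < \<infinity>"
proof -
  let ?h = "\<lambda>x::real. indicator {0<..<1} x * ennreal (x powr - \<gamma>)"
  have "emeasure lborel X = (\<integral>\<^sup>+x. emeasure lborel (Pair x -` X) \<partial>lborel)"
    by (rule emeasure_lborel_prod(1)) simp
  also have "\<dots> \<le> (\<integral>\<^sup>+x. ennreal Cf * (?h x + ?h (1 + (-1) * x)) \<partial>lborel)"
  proof (intro nn_integral_mono)
    fix x :: real
    show "emeasure lborel (Pair x -` X) \<le> ennreal Cf * (?h x + ?h (1 + (-1) * x))"
    proof (cases "0 \<le> x \<and> x < 1 \<and> regular x")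
      case True
      then have x: "0 < x" "x < 1" using regular_frac_bounds[of x 0] by (auto simp: frac_eq less_le)
      have "emeasure lborel (Pair x -` X) = ennreal (f x)"
        using True roof_deriv(3)[OF x] cf by (simp add: X_section)
      also have "\<dots> \<le> ennreal (Cf * (x powr - \<gamma> + (1 - x) powr - \<gamma>))"
        using roof_deriv(4)[OF x] by (rule ennreal_leI)
      also have "\<dots> = ennreal Cf * (?h x + ?h (1 + (-1) * x))"
        using x Cf by (simp add: ennreal_mult'' ennreal_plus indicator_def)
      finally show ?thesis .
    next
      case False
      then have "Pair x -` X = {}" by (simp only: X_section if_False)
      then show ?thesis by (simp only: emeasure_empty zero_le)
    qed
  qed
  also have "\<dots> = ennreal Cf * ((\<integral>\<^sup>+x. ?h x \<partial>lborel) + (\<integral>\<^sup>+x. ?h (1 + (-1) * x) \<partial>lborel))"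
    by (subst nn_integral_cmult, simp, subst nn_integral_add) auto
  also have "(\<integral>\<^sup>+x. ?h (1 + (-1) * x) \<partial>lborel) = (\<integral>\<^sup>+x. ?h x \<partial>lborel)"
    using nn_integral_real_affine[of ?h "-1" 1] by simp
  also have "ennreal Cf * ((\<integral>\<^sup>+x. ?h x \<partial>lborel) + (\<integral>\<^sup>+x. ?h x \<partial>lborel)) < \<infinity>"
    using nn_integral_powr_unit_interval[OF \<gamma>] by (simp add: ennreal_mult_less_top)
  finally show ?thesis .
qed

lemma countable_irregular: "countable {x. \<not> regular x}"
proof -
  have "{x. \<not> regular x} \<subseteq> range (\<lambda>(j::int, n::int). of_int j - of_int n * \<alpha>)"
  proof
    fix x assume "x \<in> {x. \<not> regular x}"
    then obtain n :: int where "frac (x + of_int n * \<alpha>) = 0" by (auto simp: regular_def)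
    then have "x = of_int \<lfloor>x + of_int n * \<alpha>\<rfloor> - of_int n * \<alpha>" by (simp add: frac_def)
    then show "x \<in> range (\<lambda>(j::int, n::int). of_int j - of_int n * \<alpha>)"
      by (metis (mono_tags, lifting) case_prod_conv rangeI)
  qed
  then show ?thesis by (rule countable_subset) simp
qed

lemma emeasure_X_pos: "0 < emeasure lborel X"
proof -
  have irr: "{x. \<not> regular x} \<in> sets lborel"
    by (rule sets.countable[OF _ countable_irregular]) simp
  have "emeasure lborel {x. \<not> regular x} = 0" by (rule emeasure_lborel_countable[OF countable_irregular])
  then have AE: "AE x in lborel. regular x"
    by (intro AE_I'[of "{x. \<not> regular x}"]) (use irr in \<open>auto simp: null_sets_def\<close>)
  have "ennreal cf = (\<integral>\<^sup>+x. ennreal cf * indicator {0<..<1::real} x \<partial>lborel)"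
    by (subst nn_integral_cmult) auto
  also have "\<dots> \<le> (\<integral>\<^sup>+x. emeasure lborel (Pair x -` X) \<partial>lborel)"
  proof (rule nn_integral_mono_AE, use AE in eventually_elim)
    fix x :: real assume r: "regular x"
    show "ennreal cf * indicator {0<..<1} x \<le> emeasure lborel (Pair x -` X)"
    proof (cases "0 < x \<and> x < 1")
      case True
      then show ?thesis using r roof_deriv(3)[of x] cf by (simp add: X_section ennreal_leI)
    qed auto
  qed
  also have "\<dots> = emeasure lborel X" by (rule emeasure_lborel_prod(1)[symmetric]) simp
  finally have "ennreal cf \<le> emeasure lborel X" .
  moreover have "0 < ennreal cf" using cf by simp
  ultimately show ?thesis by (rule less_le_trans[rotated])
qed

lemma area_pos: "0 < area"
  using emeasure_X_pos emeasure_X_finite by (simp add: area_def measure_def enn2real_positive_iff)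

lemma emeasure_X: "emeasure lborel X = ennreal area"
  using emeasure_X_finite by (simp add: area_def emeasure_eq_ennreal_measure)

lemma space_M [simp]: "space M = X"
  by (simp add: special_flow_measure_def space_restrict_space)

lemma sets_M: "A \<in> sets M \<longleftrightarrow> A \<in> sets borel \<and> A \<subseteq> X"
  by (auto simp: special_flow_measure_def sets_restrict_space_iff)

lemma emeasure_M:
  assumes "A \<in> sets M"
  shows "emeasure M A = emeasure lborel A / ennreal area"
proof -
  have A: "A \<in> sets borel" "A \<subseteq> X" using assms sets_M by auto
  have 1: "emeasure (restrict_space lborel X) B = emeasure lborel B" if "B \<subseteq> X" for B
    using that by (intro emeasure_restrict_space) auto
  have "emeasure M A = emeasure (restrict_space lborel X) (X \<inter> A) / emeasure (restrict_space lborel X) X"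
    unfolding special_flow_measure_def using A
    by (intro emeasure_uniform_measure) (auto simp: sets_restrict_space_iff)
  also have "X \<inter> A = A" using A by auto
  finally show ?thesis using A by (simp add: 1 emeasure_X)
qed

lemma emeasure_M_X: "emeasure M X = 1"
  using area_pos by (subst emeasure_M) (auto simp: sets_M emeasure_X ennreal_divide_self)

sublocale M: finite_measure M
  by standard (simp add: emeasure_M_X)

lemma measure_M_X: "measure M X = 1"
  by (simp add: measure_def emeasure_M_X)

lemma measure_M:
  assumes "A \<in> sets M"
  shows "measure M A = measure lborel A / area"
proof -
  have A: "A \<in> sets borel" "A \<subseteq> X" using assms sets_M by auto
  have "emeasure lborel A \<le> ennreal area" using emeasure_mono[of A X lborel] A emeasure_X by simp
  then have "emeasure lborel A = ennreal (measure lborel A)"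
    by (intro emeasure_eq_ennreal_measure) (auto simp: top_unique)
  then have "emeasure M A = ennreal (measure lborel A / area)"
    using emeasure_M[OF assms] area_pos by (simp add: divide_ennreal)
  then show ?thesis using area_pos by (intro measure_eq_emeasure_eq_ennreal) auto
qed

lemma measure_M_le:
  assumes "A \<in> sets M" "emeasure lborel A \<le> ennreal m" "0 \<le> m"
  shows "measure M A \<le> m / area"
proof -
  have "measure lborel A \<le> m" unfolding measure_def using assms(2,3) by (simp add: enn2real_leI)
  then show ?thesis using measure_M[OF assms(1)] area_pos by (simp add: divide_right_mono)
qed

text \<open>
  By invariance the expected time spent in \<open>W\<close> is at most \<open>m * r / area\<close>, so this is Markov's inequality. The
  target set may move with time: the lower bound uses a neighbourhood of a moving point.
\<close>

lemma measure_long_stay_le: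
  fixes W :: "(real \<times> (real \<times> real)) set"
  assumes [measurable]: "W \<in> sets borel" and r: "0 < r" "0 < \<theta>" "0 \<le> m"
    and small: "\<And>t. 0 \<le> t \<Longrightarrow> t \<le> r \<Longrightarrow> emeasure lborel {p \<in> X. (t, p) \<in> W} \<le> ennreal m"
  defines "B \<equiv> {q \<in> X. \<theta> * r < measure lborel {t \<in> {0..r}. (t, flow t q) \<in> W}}"
  shows "B \<in> sets M" "measure M B \<le> m / (\<theta> * area)"
proof -
  define E where "E = {q. fst q \<in> {0..r} \<and> snd q \<in> X \<and> (fst q, flow (fst q) (snd q)) \<in> W}"
  have "{q \<in> space borel. fst q \<in> {0..r} \<and> snd q \<in> X \<and> (fst q, flow (fst q) (snd q)) \<in> W} \<in> sets (borel :: (real \<times> (real \<times> real)) measure)"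
    by measurable
  then have [measurable]: "E \<in> sets borel" by (simp add: E_def)
  define g where "g q = emeasure lborel {t \<in> {0..r}. (t, flow t q) \<in> W}" for q
  have "{q \<in> space borel. snd q \<in> {0..r} \<and> (snd q, flow (snd q) (fst q)) \<in> W} \<in> sets (borel :: ((real \<times> real) \<times> real) measure)"
    by measurable
  from emeasure_lborel_prod(2)[OF this]
  have g_meas [measurable]: "g \<in> borel_measurable borel" by (simp add: g_def[abs_def] vimage_def)
  have gfin: "g q < \<infinity>" for q
  proof -
    have "g q \<le> emeasure lborel {0..r}" unfolding g_def by (intro emeasure_mono) auto
    then show ?thesis using r by (auto intro: le_less_trans)
  qed
  then have gm: "g q = ennreal (measure lborel {t \<in> {0..r}. (t, flow t q) \<in> W})" for q
    unfolding g_def by (intro emeasure_eq_ennreal_measure) (auto simp: less_top[symmetric])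
  have B: "B = {q \<in> space borel. q \<in> X \<and> ennreal (\<theta> * r) < g q}"
    using r by (auto simp: B_def gm ennreal_less_iff)
  have Bb [measurable]: "B \<in> sets borel" unfolding B by measurable
  have "B \<subseteq> X" unfolding B_def by blast
  then show BM: "B \<in> sets M" using Bb sets_M by blast
  have "ennreal (\<theta> * r) * emeasure lborel B = (\<integral>\<^sup>+q. ennreal (\<theta> * r) * indicator B q \<partial>lborel)"
    by (simp add: nn_integral_cmult_indicator)
  also have "\<dots> \<le> (\<integral>\<^sup>+q. (\<integral>\<^sup>+t. indicator E (t, q) \<partial>lborel) \<partial>lborel)"
  proof (intro nn_integral_mono)
    fix q :: "real \<times> real"
    show "ennreal (\<theta> * r) * indicator B q \<le> (\<integral>\<^sup>+t. indicator E (t, q) \<partial>lborel)"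
    proof (cases "q \<in> B")
      case True
      then have "(\<integral>\<^sup>+t. indicator E (t, q) \<partial>lborel) = (\<integral>\<^sup>+t. indicator {t \<in> {0..r}. (t, flow t q) \<in> W} t \<partial>lborel)"
        by (intro nn_integral_cong) (auto simp: E_def B indicator_def)
      also have "\<dots> = g q" unfolding g_def by (intro nn_integral_indicator) auto
      finally show ?thesis using True by (auto simp: B less_imp_le)
    qed auto
  qed
  also have "\<dots> = (\<integral>\<^sup>+t. (\<integral>\<^sup>+q. indicator E (t, q) \<partial>lborel) \<partial>lborel)"
    by (rule lborel_pair.Fubini') (simp add: lborel_prod)
  also have "\<dots> \<le> (\<integral>\<^sup>+t. ennreal m * indicator {0..r} t \<partial>lborel)"
  proof (intro nn_integral_mono)
    fix t :: real
    show "(\<integral>\<^sup>+q. indicator E (t, q) \<partial>lborel) \<le> ennreal m * indicator {0..r} t"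
    proof (cases "t \<in> {0..r}")
      case True
      define A where "A = {p \<in> space borel. p \<in> X \<and> (t, p) \<in> W}"
      have [measurable]: "A \<in> sets borel" unfolding A_def by measurable
      have "{p \<in> space borel. p \<in> X \<and> flow t p \<in> A} \<in> sets (borel :: (real \<times> real) measure)" by measurable
      then have [measurable]: "{p \<in> X. flow t p \<in> A} \<in> sets borel" by simp
      have "(\<integral>\<^sup>+q. indicator E (t, q) \<partial>lborel) = (\<integral>\<^sup>+q. indicator {p \<in> X. flow t p \<in> A} q \<partial>lborel)"
        using True flow_in_X by (intro nn_integral_cong) (auto simp: E_def A_def indicator_def)
      also have "\<dots> = emeasure lborel {p \<in> X. flow t p \<in> A}" by (intro nn_integral_indicator) auto
      also have "\<dots> \<le> emeasure lborel A"
        by (rule emeasure_flow_vimage_le) (use True in \<open>auto simp: A_def\<close>)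
      also have "\<dots> \<le> ennreal m" using small[of t] True by (simp add: A_def)
      finally show ?thesis using True by simp
    next
      case False
      then have "indicator E (t, q) = (0::ennreal)" for q by (auto simp: E_def indicator_def)
      then show ?thesis by simp
    qed
  qed
  also have "\<dots> = ennreal (m * r)" using r by (simp add: nn_integral_cmult_indicator ennreal_mult)
  finally have "ennreal (\<theta> * r) * emeasure lborel B \<le> ennreal (m * r)" .
  moreover have fin: "emeasure lborel B = ennreal (measure lborel B)"
    using emeasure_mono[of B X lborel] emeasure_X by (intro emeasure_eq_ennreal_measure) (auto simp: B_def top_unique)
  ultimately have "ennreal (\<theta> * r * measure lborel B) \<le> ennreal (m * r)"
    using r by (simp add: ennreal_mult)
  then have "\<theta> * r * measure lborel B \<le> m * r" using r by (subst (asm) ennreal_le_iff) auto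
  then have "\<theta> * measure lborel B \<le> m" using r by (simp add: mult.commute mult.left_commute)
  then show "measure M B \<le> m / (\<theta> * area)"
    using r area_pos by (simp add: measure_M[OF BM] field_simps)
qed

end

section \<open>Matching times of two orbits\<close>

lemma sum_geometric_tail_le:
  fixes \<theta> :: real
  assumes "0 < \<theta>" "\<theta> < 1" "a \<le> b"
  shows "(\<Sum>j=a..<b. \<theta> ^ j) \<le> \<theta> ^ a / (1 - \<theta>)"
proof -
  have "(\<Sum>j=a..<b. \<theta> ^ j) * (1 - \<theta>) = \<theta> ^ a - \<theta> ^ b"
    using assms(3)
  proof (induction b rule: dec_induct)
    case (step n)
    have "(\<Sum>j=a..<Suc n. \<theta> ^ j) = (\<Sum>j=a..<n. \<theta> ^ j) + \<theta> ^ n" using step by simp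
    then have "(\<Sum>j=a..<Suc n. \<theta> ^ j) * (1 - \<theta>) = (\<theta> ^ a - \<theta> ^ n) + \<theta> ^ n * (1 - \<theta>)"
      by (simp only: distrib_right step.IH)
    then show ?case by (simp add: algebra_simps)
  qed simp
  also have "\<dots> \<le> \<theta> ^ a" using assms by simp
  finally show ?thesis using assms by (simp add: pos_le_divide_eq)
qed

lemma fmeasurable_lborel_Icc: "{a..b::real} \<in> fmeasurable lborel"
  by (cases "a \<le> b") (auto intro: fmeasurableI)

lemma lmeasurable_borel_subset_Icc: "A \<in> sets borel \<Longrightarrow> A \<subseteq> {0..r::real} \<Longrightarrow> A \<in> lmeasurable"
  by (intro bounded_set_imp_lmeasurable) (auto intro: bounded_subset[of "{0..r}"])

context kochergin
begin

lemma flow_eqs: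
  "fst (flow t (x, s)) = frac (x + real (steps t (x, s)) * \<alpha>)"
  "snd (flow t (x, s)) = s + t - bsum (steps t (x, s)) x"
  by (simp_all add: flow_def)

lemma steps_diff_bound:
  assumes "p \<in> X" "0 \<le> a" "a \<le> t" "t \<le> t'" "t' \<le> a + cf * W"
  shows "real (steps t' p) \<le> real (steps t p) + (W + 1)"
proof -
  have "cf * (real (steps t' p) - real (steps t p) - 1) \<le> cf * W"
    using steps_mono_bound(2)[of p t t'] assms by linarith
  then show ?thesis using cf by simp
qed

text \<open>
  The distance is taken with its sign, so that it does not change while the difference of the numbers of
  steps is constant; exchanging \<open>p\<close> and \<open>q\<close> covers the other sign.
\<close>

definition match_times :: "real \<Rightarrow> real \<Rightarrow> real \<times> real \<Rightarrow> real \<times> real \<Rightarrow> real set" where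
  "match_times H d p q = {t. snd (flow t p) < H \<and> \<bar>snd (flow t p) - snd (flow t q)\<bar> < 1 \<and>
     d / 2 < fst (flow t q) - fst (flow t p) \<and> fst (flow t q) - fst (flow t p) \<le> d}"

lemma match_times_measurable [measurable]: "match_times H d p q \<in> sets borel"
proof -
  have "{t \<in> space borel. snd (flow t p) < H \<and> \<bar>snd (flow t p) - snd (flow t q)\<bar> < 1 \<and>
     d / 2 < fst (flow t q) - fst (flow t p) \<and> fst (flow t q) - fst (flow t p) \<le> d} \<in> sets borel"
    by measurable
  then show ?thesis by (simp add: match_times_def)
qed

text \<open>
  If the difference of the numbers of steps changed by \<open>i \<noteq> 0\<close>, then \<open>i * \<alpha>\<close> would be within \<open>L\<^sup>-\<^sup>(\<^sup>1\<^sup>+\<^sup>\<gamma>\<^sup>)\<close> of an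
  integer, which forces \<open>i\<close> to be almost as large as \<open>L\<^sup>1\<^sup>+\<^sup>\<gamma>\<close>. But \<open>i\<close> is at most the number of steps in
  the window, about \<open>L\<^sup>1\<^sup>+\<^sup>1\<^sup>2\<^sup>e\<close>.
\<close>

lemma steps_difference_constant:
  assumes e: "0 < e" "15 * e \<le> \<gamma>"
  obtains L0 where "2 \<le> L0"
    "\<And>L p q a t t'. \<lbrakk>L0 \<le> L; p \<in> X; q \<in> X; 0 \<le> a; a \<le> t; t \<le> t'; t' \<le> a + cf * L powr (1 + 12 * e);
       t \<in> match_times H (L powr - (1 + \<gamma>)) p q; t' \<in> match_times H (L powr - (1 + \<gamma>)) p q\<rbrakk>
     \<Longrightarrow> int (steps t' p) - int (steps t p) = int (steps t' q) - int (steps t q) \<and>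
         fst (flow t' q) - fst (flow t' p) = fst (flow t q) - fst (flow t p)"
proof -
  obtain c where c: "0 < c" "c \<le> 1"
    "\<And>(i::nat) (j::int). 0 < i \<Longrightarrow> c * real i powr (- (1 + e)) \<le> \<bar>real i * \<alpha> - of_int j\<bar>"
    using diophantine_lower_bound[OF dio e(1)] by metis
  obtain L1 where L1: "1 \<le> L1" "\<And>L. L1 \<le> L \<Longrightarrow> 4 / c + 1 \<le> L powr e"
    using powr_eventually_large[OF e(1)] by metis
  show ?thesis
  proof (rule that[of "max 2 L1"])
    fix L a t t' :: real and p q :: "real \<times> real"
    assume L: "max 2 L1 \<le> L" and pq: "p \<in> X" "q \<in> X" and t: "0 \<le> a" "a \<le> t" "t \<le> t'" "t' \<le> a + cf * L powr (1 + 12 * e)"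
      and m: "t \<in> match_times H (L powr - (1 + \<gamma>)) p q" and m': "t' \<in> match_times H (L powr - (1 + \<gamma>)) p q"
    obtain x s y s' where xy: "p = (x, s)" "q = (y, s')" by fastforce
    define n n' k k' where "n = steps t p" and "n' = steps t' p" and "k = steps t q" and "k' = steps t' q"
    define W where "W = L powr (1 + 12 * e)"
    have W: "2 \<le> W" using powr_mono[of 1 "1 + 12 * e" L] L e by (simp add: W_def)
    have nn: "n \<le> n'" "k \<le> k'" using steps_mono_bound(1) pq t by (auto simp: n_def n'_def k_def k'_def)
    have nW: "real n' \<le> real n + 2 * W" "real k' \<le> real k + 2 * W"
      using steps_diff_bound[OF pq(1) t(1,2,3) t(4)] steps_diff_bound[OF pq(2) t(1,2,3) t(4)] W
      by (auto simp: n_def n'_def k_def k'_def W_def)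
    define u u' where "u = fst (flow t q) - fst (flow t p)" and "u' = fst (flow t' q) - fst (flow t' p)"
    have uu: "\<bar>u' - u\<bar> \<le> L powr - (1 + \<gamma>)"
      using m m' by (auto simp: match_times_def u_def u'_def abs_le_iff)
    define d where "d = (int n' - int n) - (int k' - int k)"
    define J where "J = (\<lfloor>y + real k' * \<alpha>\<rfloor> - \<lfloor>x + real n' * \<alpha>\<rfloor>) - (\<lfloor>y + real k * \<alpha>\<rfloor> - \<lfloor>x + real n * \<alpha>\<rfloor>)"
    have ueq: "u' - u = - of_int d * \<alpha> - of_int J"
      by (simp add: u_def u'_def xy flow_eqs frac_def d_def J_def n_def n'_def k_def k'_def algebra_simps)
    have "d = 0"
    proof (rule ccontr)
      assume d: "d \<noteq> 0"
      define i where "i = nat \<bar>d\<bar>"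
      have i: "0 < i" "real i = \<bar>of_int d\<bar>" using d by (auto simp: i_def)
      have iW: "real i \<le> 2 * W"
      proof -
        have "\<bar>d\<bar> \<le> max (int n' - int n) (int k' - int k)" using nn by (simp add: d_def)
        moreover have "real_of_int (max (int n' - int n) (int k' - int k)) \<le> 2 * W" using nW by (simp add: max_def)
        ultimately show ?thesis unfolding i(2) by linarith
      qed
      have "\<exists>j::int. \<bar>real i * \<alpha> - of_int j\<bar> = \<bar>u' - u\<bar>"
      proof (cases "0 < d")
        case True
        then show ?thesis by (intro exI[of _ "- J"]) (simp add: ueq i abs_minus_commute)
      next
        case False
        then show ?thesis by (intro exI[of _ J]) (simp add: ueq i)
      qed
      then have "c * real i powr (- (1 + e)) \<le> L powr - (1 + \<gamma>)"
        using c(3)[OF i(1)] uu by (metis order.trans)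
      then have "c * L powr (1 + \<gamma>) \<le> real i powr (1 + e)"
        using i(1) L unfolding powr_minus by (simp add: field_simps)
      also have "\<dots> \<le> (2 * W) powr (1 + e)" using iW e by (intro powr_mono2) auto
      also have "\<dots> = 2 powr (1 + e) * L powr ((1 + 12 * e) * (1 + e))"
        using L by (simp add: W_def powr_mult powr_powr)
      also have "\<dots> \<le> 2 powr 2 * L powr (1 + 14 * e)"
      proof (intro mult_mono powr_mono)
        have "12 * e * e \<le> 1 * e" using e \<gamma> by (intro mult_right_mono) auto
        then show "(1 + 12 * e) * (1 + e) \<le> 1 + 14 * e" by (simp add: algebra_simps)
      qed (use e \<gamma> L in auto)
      finally have 1: "c * L powr (1 + \<gamma>) \<le> 4 * L powr (1 + 14 * e)" by simp
      (* the spare factor L powr e beats the constants *)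
      have "L powr (1 + 14 * e) * L powr e = L powr (1 + 14 * e + e)" by (rule powr_add[symmetric])
      also have "1 + 14 * e + e = 1 + 15 * e" by simp
      also have "L powr (1 + 15 * e) \<le> L powr (1 + \<gamma>)" using e L by (intro powr_mono) auto
      finally have "c * (L powr (1 + 14 * e) * L powr e) \<le> 4 * L powr (1 + 14 * e)"
        using 1 c by (meson mult_left_mono less_imp_le order.trans)
      then have "L powr (1 + 14 * e) * (c * L powr e) \<le> L powr (1 + 14 * e) * 4" by (simp add: mult_ac)
      moreover have "0 < L powr (1 + 14 * e)" using L by simp
      ultimately have "c * L powr e \<le> 4" by simp
      moreover have "c * (4 / c + 1) \<le> c * L powr e" using L1(2)[of L] L c by (intro mult_left_mono) auto
      moreover have "c * (4 / c + 1) = 4 + c" using c by (simp add: algebra_simps)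
      ultimately show False using c by linarith
    qed
    then have eq: "int n' - int n = int k' - int k" by (simp add: d_def)
    have "u' - u = - of_int J" using ueq \<open>d = 0\<close> by simp
    moreover have "\<bar>u' - u\<bar> < 1"
    proof -
      (* an integer of absolute value below 1 vanishes *)
      have "L powr - (1 + \<gamma>) < 1" using L \<gamma> by (intro powr_less_one) auto
      then show ?thesis using uu by linarith
    qed
    ultimately have "J = 0" by simp
    then have "u' = u" using \<open>u' - u = - of_int J\<close> by simp
    then show "int (steps t' p) - int (steps t p) = int (steps t' q) - int (steps t q) \<and>
         fst (flow t' q) - fst (flow t' p) = fst (flow t q) - fst (flow t p)"
      using eq by (simp add: n_def n'_def k_def k'_def u_def u'_def)
  qed simp
qed

text \<open>
  Between two matching times the heights change by amounts that differ by less than \<open>2\<close>, and this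
  is the difference of the two Birkhoff sums. So the steps at the matching times form a set as in
  \<open>few_matched_steps\<close>, and below height \<open>H\<close> each step lasts at most the time \<open>H\<close>.
\<close>

lemma match_times_window:
  assumes e: "0 < e" "15 * e \<le> \<gamma>" and H: "0 < H"
  obtains K L0 where "0 < K" "2 \<le> L0"
    "\<And>L p q a. \<lbrakk>L0 \<le> L; p \<in> X; q \<in> X; 0 \<le> a\<rbrakk> \<Longrightarrow>
       measure lborel (match_times H (L powr - (1 + \<gamma>)) p q \<inter> {a..a + cf * L powr (1 + 12 * e)}) \<le> K * L powr (1 + 11 * e)"
proof -
  obtain L1 where L1: "2 \<le> L1" and const:
    "\<And>L p q a t t'. \<lbrakk>L1 \<le> L; p \<in> X; q \<in> X; 0 \<le> a; a \<le> t; t \<le> t'; t' \<le> a + cf * L powr (1 + 12 * e);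
       t \<in> match_times H (L powr - (1 + \<gamma>)) p q; t' \<in> match_times H (L powr - (1 + \<gamma>)) p q\<rbrakk>
     \<Longrightarrow> int (steps t' p) - int (steps t p) = int (steps t' q) - int (steps t q) \<and>
         fst (flow t' q) - fst (flow t' p) = fst (flow t q) - fst (flow t p)"
    by (rule steps_difference_constant[OF e, where H = H]) (rule that)
  obtain K L2 where K: "0 < K" "1 \<le> L2" and few:
    "\<And>L \<delta> V n0 x A. \<lbrakk>L2 \<le> L; L powr - (1 + \<gamma>) / 2 < \<delta>; \<delta> \<le> L powr - (1 + \<gamma>);
       real V \<le> 2 * L powr (1 + 12 * e); \<And>i (j::int). x + real i * \<alpha> \<noteq> of_int j;
       A \<subseteq> {n0..<n0 + V};
       \<And>n m. n \<in> A \<Longrightarrow> n + m \<in> A \<Longrightarrow> 0 < m \<Longrightarrow>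
         \<bar>bsum m (x + real n * \<alpha>) - bsum m (x + real n * \<alpha> + \<delta>)\<bar> < 2\<rbrakk>
     \<Longrightarrow> real (card A) \<le> K * L powr (1 + 11 * e)"
    by (rule few_matched_steps[of e]) (use e \<gamma> in auto)
  show ?thesis
  proof (rule that[of "H * K" "max L1 L2"])
    show "0 < H * K" "2 \<le> max L1 L2" using H K L1 by auto
  next
    fix L a :: real and p q :: "real \<times> real"
    assume L: "max L1 L2 \<le> L" and pq: "p \<in> X" "q \<in> X" and a: "0 \<le> a"
    obtain x s y s' where xy: "p = (x, s)" "q = (y, s')" by fastforce
    define W where "W = L powr (1 + 12 * e)"
    have W: "2 \<le> W" using powr_mono[of 1 "1 + 12 * e" L] L L1 e by (simp add: W_def)
    define E where "E = match_times H (L powr - (1 + \<gamma>)) p q \<inter> {a..a + cf * W}"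
    have [measurable]: "E \<in> sets borel" unfolding E_def by measurable
    define A where "A = (\<lambda>t. steps t p) ` E"
    define n0 where "n0 = steps a p"
    (* one step for the start of the window and one for rounding *)
    define V where "V = nat \<lfloor>W\<rfloor> + 2"
    have V: "real V \<le> 2 * W" using W unfolding V_def by linarith
    have Asub: "A \<subseteq> {n0..<n0 + V}"
    proof
      fix n assume "n \<in> A"
      then obtain t where t: "t \<in> E" "n = steps t p" by (auto simp: A_def)
      then have ta: "a \<le> t" "t \<le> a + cf * W" by (auto simp: E_def)
      have "n0 \<le> n" using steps_mono_bound(1)[OF pq(1) a ta(1)] t by (simp add: n0_def)
      moreover have "real n \<le> real n0 + (W + 1)"
        using steps_diff_bound[OF pq(1) a order_refl ta] t by (simp add: n0_def)
      then have "n < n0 + V" using W unfolding V_def by linarith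
      ultimately show "n \<in> {n0..<n0 + V}" by simp
    qed
    then have finA: "finite A" using finite_subset by blast
    have cardA: "real (card A) \<le> K * L powr (1 + 11 * e)"
    proof (cases "E = {}")
      case True
      then show ?thesis using K by (simp add: A_def)
    next
      case False
      then obtain t0 where t0: "t0 \<in> E" by blast
      define \<delta> where "\<delta> = fst (flow t0 q) - fst (flow t0 p)"
      have same: "int (steps t' p) - int (steps t p) = int (steps t' q) - int (steps t q) \<and>
         fst (flow t' q) - fst (flow t' p) = fst (flow t q) - fst (flow t p)" if "t \<in> E" "t' \<in> E" for t t'
      proof (cases "t \<le> t'")
        case True
        then show ?thesis using const[of L p q a t t'] L pq a that by (auto simp: E_def W_def)
      next
        case False
        then show ?thesis using const[of L p q a t' t] L pq a that by (auto simp: E_def W_def)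
      qed
      have \<delta>t: "fst (flow t q) - fst (flow t p) = \<delta>" if "t \<in> E" for t
        using same[OF t0 that] by (simp add: \<delta>_def)
      show ?thesis
      proof (rule few[where \<delta> = \<delta> and x = x and V = V and ?n0.0 = n0])
        show "L powr - (1 + \<gamma>) / 2 < \<delta>" "\<delta> \<le> L powr - (1 + \<gamma>)"
          using t0 by (auto simp: E_def match_times_def \<delta>_def)
        show "x + real i * \<alpha> \<noteq> of_int j" for i and j :: int
          using regular_not_int[of x "int i" j] pq xy X_iff by auto
      next
        fix n m assume nm: "n \<in> A" "n + m \<in> A" "0 < m"
        then obtain t t' where t: "t \<in> E" "n = steps t p" and t': "t' \<in> E" "n + m = steps t' p" by (auto simp: A_def)
        define k where "k = steps t q"
        have k': "steps t' q = k + m" using same[OF t(1) t'(1)] t t' by (simp add: k_def)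
        have "bsum m (x + real n * \<alpha>) = (snd (flow t p) - snd (flow t' p)) + (t' - t)"
          using bsum_add[of n m x] t(2) t'(2) by (simp add: xy flow_eqs)
        moreover have "bsum m (y + real k * \<alpha>) = (snd (flow t q) - snd (flow t' q)) + (t' - t)"
          using bsum_add[of k m y] k' by (simp add: xy flow_eqs k_def)
        moreover have "bsum m (y + real k * \<alpha>) = bsum m (x + real n * \<alpha> + \<delta>)"
        proof -
          have "frac (y + real k * \<alpha>) = frac (x + real n * \<alpha>) + \<delta>"
            using \<delta>t[OF t(1)] t(2) by (simp add: xy flow_eqs k_def)
          then show ?thesis
            using bsum_frac_add[of m "y + real k * \<alpha>" 0] bsum_frac_add[of m "x + real n * \<alpha>" \<delta>] by simp
        qed
        moreover have "\<bar>snd (flow t p) - snd (flow t q)\<bar> < 1" "\<bar>snd (flow t' p) - snd (flow t' q)\<bar> < 1"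
          using t t' by (auto simp: E_def match_times_def)
        ultimately show "\<bar>bsum m (x + real n * \<alpha>) - bsum m (x + real n * \<alpha> + \<delta>)\<bar> < 2" by linarith
      qed (use L V Asub in \<open>auto simp: W_def\<close>)
    qed
    have "E \<subseteq> (\<Union>n\<in>A. {bsum n x - s..bsum n x - s + H})"
    proof
      fix t assume t: "t \<in> E"
      then have "0 \<le> t" using a by (auto simp: E_def)
      then have "bsum (steps t p) x - s \<le> t" using steps_props(1)[of x s t] pq xy by auto
      moreover have "t \<le> bsum (steps t p) x - s + H" using t by (auto simp: E_def match_times_def xy flow_eqs)
      ultimately show "t \<in> (\<Union>n\<in>A. {bsum n x - s..bsum n x - s + H})" using t by (auto simp: A_def)
    qed
    moreover have "(\<Union>n\<in>A. {bsum n x - s..bsum n x - s + H}) \<in> fmeasurable lborel"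
      using finA by (intro fmeasurable.finite_UN) (auto intro: fmeasurable_lborel_Icc)
    ultimately have "measure lborel E \<le> measure lborel (\<Union>n\<in>A. {bsum n x - s..bsum n x - s + H})"
      by (intro measure_mono_fmeasurable) auto
    also have "\<dots> \<le> (\<Sum>n\<in>A. measure lborel {bsum n x - s..bsum n x - s + H})"
      using finA by (intro measure_UNION_le) auto
    also have "\<dots> = H * real (card A)" using H by simp
    also have "\<dots> \<le> H * (K * L powr (1 + 11 * e))" using cardA H by (intro mult_left_mono) auto
    finally show "measure lborel (match_times H (L powr - (1 + \<gamma>)) p q \<inter> {a..a + cf * L powr (1 + 12 * e)})
       \<le> H * K * L powr (1 + 11 * e)" by (simp add: E_def W_def mult.assoc)
  qed
qed

lemma match_times_density:
  assumes e: "0 < e" "15 * e \<le> \<gamma>" and H: "0 < H"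
  obtains K L0 where "0 < K" "2 \<le> L0"
    "\<And>L p q r. \<lbrakk>L0 \<le> L; p \<in> X; q \<in> X; L powr (1 + 12 * e) \<le> r\<rbrakk> \<Longrightarrow>
       measure lborel (match_times H (L powr - (1 + \<gamma>)) p q \<inter> {0..r}) \<le> K * r * L powr - e"
proof -
  obtain K L0 where K: "0 < K" "2 \<le> L0" and win:
    "\<And>L p q a. \<lbrakk>L0 \<le> L; p \<in> X; q \<in> X; 0 \<le> a\<rbrakk> \<Longrightarrow>
       measure lborel (match_times H (L powr - (1 + \<gamma>)) p q \<inter> {a..a + cf * L powr (1 + 12 * e)}) \<le> K * L powr (1 + 11 * e)"
    using match_times_window[OF e H] by metis
  show ?thesis
  proof (rule that[of "2 * K / cf" L0])
    fix L r :: real and p q :: "real \<times> real"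
    assume L: "L0 \<le> L" and pq: "p \<in> X" "q \<in> X" and r: "L powr (1 + 12 * e) \<le> r"
    define W where "W = L powr (1 + 12 * e)"
    define E where "E = match_times H (L powr - (1 + \<gamma>)) p q"
    have [measurable]: "E \<in> sets borel" unfolding E_def by measurable
    define T where "T = cf * W"
    have W: "1 \<le> W" using L K e by (simp add: W_def ge_one_powr_ge_zero)
    have "cf * W \<le> 1 * W" using W cf by (intro mult_right_mono) auto
    moreover have "W \<le> r" using r by (simp add: W_def)
    moreover have "0 < cf * W" using W cf by (intro mult_pos_pos) auto
    ultimately have T: "0 < T" "T \<le> r" unfolding T_def by linarith+
    define N where "N = nat \<lfloor>r / T\<rfloor> + 1"
    have "1 \<le> r / T" using T by simp
    then have N: "r / T < real N" "real N \<le> 2 * (r / T)" unfolding N_def by linarith+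
    have "E \<inter> {0..r} \<subseteq> (\<Union>i<N. E \<inter> {real i * T..real i * T + T})"
    proof
      fix t assume t: "t \<in> E \<inter> {0..r}"
      define i where "i = nat \<lfloor>t / T\<rfloor>"
      have "0 \<le> t / T" "t / T \<le> r / T" using t T by (auto intro: divide_right_mono)
      then have i: "real i \<le> t / T" "t / T < real i + 1" unfolding i_def by linarith+
      then have "i < N" using N \<open>t / T \<le> r / T\<close> by linarith
      moreover have "real i * T \<le> t" "t \<le> real i * T + T" using i T by (simp_all add: field_simps)
      ultimately show "t \<in> (\<Union>i<N. E \<inter> {real i * T..real i * T + T})" using t by auto
    qed
    moreover have "(\<Union>i<N. E \<inter> {real i * T..real i * T + T}) \<in> fmeasurable lborel"
    proof (intro fmeasurable.finite_UN)
      show "E \<inter> {real i * T..real i * T + T} \<in> fmeasurable lborel" for i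
        using fmeasurable_Int_fmeasurable[OF fmeasurable_lborel_Icc, of E] by (simp add: Int_commute)
    qed simp
    ultimately have "measure lborel (E \<inter> {0..r}) \<le> measure lborel (\<Union>i<N. E \<inter> {real i * T..real i * T + T})"
      by (intro measure_mono_fmeasurable) auto
    also have "\<dots> \<le> (\<Sum>i<N. measure lborel (E \<inter> {real i * T..real i * T + T}))"
      by (intro measure_UNION_le) auto
    also have "\<dots> \<le> (\<Sum>i<N. K * L powr (1 + 11 * e))"
      using win[OF L pq] T unfolding E_def T_def W_def by (intro sum_mono) auto
    also have "\<dots> = real N * (K * L powr (1 + 11 * e))" by simp
    also have "\<dots> \<le> 2 * (r / T) * (K * L powr (1 + 11 * e))" using N K by (intro mult_right_mono) auto
    also have "\<dots> = 2 * K / cf * r * (L powr (1 + 11 * e) / W)" by (simp add: T_def)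
    also have "L powr (1 + 11 * e) / W = L powr - e" by (simp add: W_def flip: powr_diff)
    finally show "measure lborel (match_times H (L powr - (1 + \<gamma>)) p q \<inter> {0..r}) \<le> 2 * K / cf * r * L powr - e"
      by (simp add: E_def)
  qed (use K cf in auto)
qed

text \<open>
  The class of horizontal distances near \<open>2\<^sup>-\<^sup>j\<close> occupies a proportion \<open>O(\<theta>\<^sup>j)\<close> of the time. It is
  relevant for \<open>j\<close> between the logarithm of \<open>N\<close> and the largest \<open>j\<close> whose window fits into
  \<open>[0, r]\<close>, so a fine mesh makes the sum of the geometric series small.
\<close>

theorem few_distant_matches:
  assumes e: "0 < e" "15 * e \<le> \<gamma>" and H: "0 < H"
  obtains N :: nat where "0 < N"
    "\<And>p q r. \<lbrakk>p \<in> X; q \<in> X; 0 < r\<rbrakk> \<Longrightarrow>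
       measure lborel {t \<in> {0..r}. snd (flow t p) < H \<and> snd (flow t q) < H \<and> \<bar>snd (flow t p) - snd (flow t q)\<bar> < 1 \<and>
         \<bar>fst (flow t p) - fst (flow t q)\<bar> < 1 / real N \<and>
         r powr - ((1 + \<gamma>) / (1 + 12 * e)) < \<bar>fst (flow t p) - fst (flow t q)\<bar>} \<le> r / 4"
proof -
  obtain K L0 where K: "0 < K" "2 \<le> L0" and dens:
    "\<And>L p q r. \<lbrakk>L0 \<le> L; p \<in> X; q \<in> X; L powr (1 + 12 * e) \<le> r\<rbrakk> \<Longrightarrow>
       measure lborel (match_times H (L powr - (1 + \<gamma>)) p q \<inter> {0..r}) \<le> K * r * L powr - e"
    using match_times_density[OF e H] by metis
  define Lj where "Lj j = 2 powr (real j / (1 + \<gamma>))" for j :: nat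
  have Lj: "Lj j powr - (1 + \<gamma>) = (1/2) ^ j" for j
  proof -
    have "real j / (1 + \<gamma>) * - (1 + \<gamma>) = - real j" using \<gamma> by (simp only: mult_minus_right) simp
    then have "Lj j powr - (1 + \<gamma>) = 2 powr - real j" by (simp only: Lj_def powr_powr)
    then show ?thesis by (simp add: powr_minus powr_realpow power_one_over inverse_eq_divide)
  qed
  have Lj_mono: "Lj i \<le> Lj j" if "i \<le> j" for i j
    using that \<gamma> by (auto simp: Lj_def intro!: powr_mono divide_right_mono)
  define \<theta> where "\<theta> = 2 powr - (e / (1 + \<gamma>))"
  have \<theta>: "0 < \<theta>" "\<theta> < 1" using e \<gamma> by (auto simp: \<theta>_def intro!: powr_less_one)
  have Lje: "Lj j powr - e = \<theta> ^ j" for j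
    by (simp add: Lj_def \<theta>_def powr_powr powr_power mult.commute)
  obtain j1 where j1: "L0 \<le> Lj j1"
  proof -
    obtain j :: nat where "log 2 L0 * (1 + \<gamma>) \<le> real j" using real_arch_simple by blast
    then have "log 2 L0 \<le> real j / (1 + \<gamma>)" using \<gamma> by (simp add: pos_le_divide_eq)
    then have "2 powr log 2 L0 \<le> Lj j" unfolding Lj_def by (intro powr_mono) auto
    then show ?thesis using K by (intro that[of j]) auto
  qed
  obtain j2 where j2: "\<theta> ^ j2 < (1 - \<theta>) / (8 * K)"
    using real_arch_pow_inv[of "(1 - \<theta>) / (8 * K)" \<theta>] \<theta> K by auto
  define j0 where "j0 = max j1 j2"
  have j0: "L0 \<le> Lj j" if "j0 \<le> j" for j using j1 Lj_mono[of j1 j] that by (simp add: j0_def)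
  have "\<theta> ^ j0 \<le> \<theta> ^ j2" using \<theta> by (intro power_decreasing) (auto simp: j0_def)
  then have "\<theta> ^ j0 < (1 - \<theta>) / (8 * K)" using j2 by linarith
  then have small: "2 * K * (\<theta> ^ j0 / (1 - \<theta>)) \<le> 1 / 4"
    using \<theta> K by (simp add: field_simps)
  show ?thesis
  proof (rule that[of "2 ^ j0"])
    fix p q :: "real \<times> real" and r :: real
    assume pq: "p \<in> X" "q \<in> X" and r: "0 < r"
    define \<rho> where "\<rho> = r powr - ((1 + \<gamma>) / (1 + 12 * e))"
    define E where "E = {t \<in> {0..r}. snd (flow t p) < H \<and> snd (flow t q) < H \<and> \<bar>snd (flow t p) - snd (flow t q)\<bar> < 1 \<and>
         \<bar>fst (flow t p) - fst (flow t q)\<bar> < 1 / real (2 ^ j0) \<and> \<rho> < \<bar>fst (flow t p) - fst (flow t q)\<bar>}"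
    have \<rho>: "0 < \<rho>" using r by (simp add: \<rho>_def)
    obtain J where J: "(1/2) ^ J < \<rho>" using real_arch_pow_inv[of \<rho> "1/2"] \<rho> by auto
    define I where "I = {j \<in> {j0..<max j0 J}. Lj j powr (1 + 12 * e) \<le> r}"
    define G where "G j = (match_times H ((1/2) ^ j) p q \<union> match_times H ((1/2) ^ j) q p) \<inter> {0..r}" for j
    have [measurable]: "G j \<in> sets borel" for j unfolding G_def by measurable
    have "E \<subseteq> (\<Union>j\<in>I. G j)"
    proof
      fix t assume t: "t \<in> E"
      define d where "d = \<bar>fst (flow t p) - fst (flow t q)\<bar>"
      have d: "d < (1/2) ^ j0" "\<rho> < d" using t by (auto simp: E_def d_def power_one_over)
      then have d0: "0 < d" using \<rho> by linarith
      obtain j' where "(1/2) ^ j' < d" using real_arch_pow_inv[of d "1/2"] d0 by auto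
      (* the first j with (1/2) ^ j < d; then d lies in the class of j - 1 *)
      define j3 where "j3 = (LEAST j. (1/2) ^ j < d)"
      have j3: "(1/2) ^ j3 < d" unfolding j3_def by (rule LeastI) fact
      have "j3 \<noteq> 0"
      proof
        assume "j3 = 0"
        then have "1 < d" using j3 by simp
        moreover have "(1/2::real) ^ j0 \<le> 1" by (simp add: power_le_one)
        ultimately show False using d by linarith
      qed
      then obtain j where j: "j3 = Suc j" by (cases j3) auto
      have up: "d \<le> (1/2) ^ j" using not_less_Least[of j "\<lambda>j. (1/2) ^ j < d"] j unfolding j3_def by auto
      have lo: "(1/2) ^ j / 2 < d" using j3 j by simp
      have "j0 \<le> j"
      proof (rule ccontr)
        assume "\<not> j0 \<le> j"
        then have "(1/2::real) ^ j0 \<le> (1/2) ^ j3" using j by (intro power_decreasing) auto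
        then show False using j3 d by linarith
      qed
      moreover have "j < J"
      proof (rule ccontr)
        assume "\<not> j < J"
        then have "(1/2::real) ^ j \<le> (1/2) ^ J" by (intro power_decreasing) auto
        then show False using J up d by linarith
      qed
      moreover have "Lj j powr (1 + 12 * e) \<le> r"
      proof -
        have "\<rho> < Lj j powr - (1 + \<gamma>)" using up d Lj[of j] by linarith
        then have "Lj j powr (1 + \<gamma>) < r powr ((1 + \<gamma>) / (1 + 12 * e))"
          using r unfolding \<rho>_def powr_minus by (simp add: Lj_def)
        then have "(Lj j powr (1 + \<gamma>)) powr ((1 + 12 * e) / (1 + \<gamma>)) \<le> (r powr ((1 + \<gamma>) / (1 + 12 * e))) powr ((1 + 12 * e) / (1 + \<gamma>))"
          using e \<gamma> by (intro powr_mono2) auto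
        then show ?thesis using r e \<gamma> by (simp add: powr_powr)
      qed
      ultimately have "j \<in> I" by (auto simp: I_def)
      moreover have "t \<in> G j"
        using t up lo unfolding G_def E_def match_times_def d_def by (auto simp: abs_if split: if_splits)
      ultimately show "t \<in> (\<Union>j\<in>I. G j)" by blast
    qed
    moreover have fI: "finite I" by (simp add: I_def)
    moreover have "(\<Union>j\<in>I. G j) \<in> fmeasurable lborel"
      using fI by (intro fmeasurable.finite_UN)
       (auto intro!: fmeasurable_Int_fmeasurable fmeasurable_lborel_Icc simp: G_def Int_commute)
    moreover have "{t \<in> space borel. t \<in> {0..r} \<and> snd (flow t p) < H \<and> snd (flow t q) < H \<and> \<bar>snd (flow t p) - snd (flow t q)\<bar> < 1 \<and>
         \<bar>fst (flow t p) - fst (flow t q)\<bar> < 1 / real (2 ^ j0) \<and> \<rho> < \<bar>fst (flow t p) - fst (flow t q)\<bar>} \<in> sets borel"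
      by measurable
    then have "E \<in> sets borel" by (simp add: E_def)
    ultimately have "measure lborel E \<le> measure lborel (\<Union>j\<in>I. G j)"
      by (intro measure_mono_fmeasurable) auto
    also have "\<dots> \<le> (\<Sum>j\<in>I. measure lborel (G j))" using fI by (intro measure_UNION_le) auto
    also have "\<dots> \<le> (\<Sum>j\<in>I. 2 * K * r * \<theta> ^ j)"
    proof (intro sum_mono)
      fix j assume j: "j \<in> I"
      then have "L0 \<le> Lj j" "Lj j powr (1 + 12 * e) \<le> r" using j0 by (auto simp: I_def)
      then have "measure lborel (match_times H ((1/2) ^ j) p q \<inter> {0..r}) \<le> K * r * \<theta> ^ j"
        "measure lborel (match_times H ((1/2) ^ j) q p \<inter> {0..r}) \<le> K * r * \<theta> ^ j"
        using dens[of "Lj j"] pq unfolding Lj Lje by auto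
      moreover have "measure lborel (G j) \<le> measure lborel (match_times H ((1/2) ^ j) p q \<inter> {0..r})
          + measure lborel (match_times H ((1/2) ^ j) q p \<inter> {0..r})"
        unfolding G_def Int_Un_distrib2 by (intro measure_Un_le) auto
      ultimately show "measure lborel (G j) \<le> 2 * K * r * \<theta> ^ j" by linarith
    qed
    also have "\<dots> \<le> (\<Sum>j=j0..<max j0 J. 2 * K * r * \<theta> ^ j)"
      using K r \<theta> by (intro sum_mono2) (auto simp: I_def)
    also have "\<dots> = 2 * K * r * (\<Sum>j=j0..<max j0 J. \<theta> ^ j)" by (simp add: sum_distrib_left)
    also have "\<dots> \<le> 2 * K * r * (\<theta> ^ j0 / (1 - \<theta>))"
      using K r \<theta> by (intro mult_left_mono sum_geometric_tail_le) auto
    also have "\<dots> = (2 * K * (\<theta> ^ j0 / (1 - \<theta>))) * r" by simp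
    also have "\<dots> \<le> 1 / 4 * r" using small r by (intro mult_right_mono) auto
    finally show "measure lborel {t \<in> {0..r}. snd (flow t p) < H \<and> snd (flow t q) < H \<and> \<bar>snd (flow t p) - snd (flow t q)\<bar> < 1 \<and>
         \<bar>fst (flow t p) - fst (flow t q)\<bar> < 1 / real (2 ^ j0) \<and>
         r powr - ((1 + \<gamma>) / (1 + 12 * e)) < \<bar>fst (flow t p) - fst (flow t q)\<bar>} \<le> r / 4"
      by (simp add: E_def \<rho>_def)
  qed simp
qed

end

section \<open>Names, Hamming distance and covering numbers\<close>

lemma word_space_level_set:
  assumes "w \<in> word_space k r" "i \<in> {1..k}"
  shows "{s \<in> {0..r}. w s = i} \<in> sets lebesgue"
proof -
  have "w \<in> measurable (lebesgue_on {0..r}) (count_space {1..k})" using assms by (simp add: word_space_def)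
  then have "w -` {i} \<inter> space (lebesgue_on {0..r}) \<in> sets (lebesgue_on {0..r})"
    by (rule measurable_sets) (use assms in auto)
  moreover have "w -` {i} \<inter> space (lebesgue_on {0..r}) = {s \<in> {0..r}. w s = i}" by auto
  ultimately show ?thesis by (simp add: sets_restrict_space_iff)
qed

lemma word_space_range:
  assumes "w \<in> word_space k r" "s \<in> {0..r}"
  shows "w s \<in> {1..k}"
  using assms measurable_space[of w "lebesgue_on {0..r}" "count_space {1..k}" s] by (simp add: word_space_def)

lemma agreement_measurable:
  assumes "w \<in> word_space k r" "w' \<in> word_space k r"
  shows "{s \<in> {0..r}. w s = w' s} \<in> lmeasurable"
proof -
  have "{s \<in> {0..r}. w s = w' s} = (\<Union>i\<in>{1..k}. {s \<in> {0..r}. w s = i} \<inter> {s \<in> {0..r}. w' s = i})"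
  proof (intro equalityI subsetI)
    fix s assume s: "s \<in> {s \<in> {0..r}. w s = w' s}"
    then have "w s \<in> {1..k}" by (intro word_space_range[OF assms(1)]) simp
    then show "s \<in> (\<Union>i\<in>{1..k}. {s \<in> {0..r}. w s = i} \<inter> {s \<in> {0..r}. w' s = i})"
      using s by (intro UN_I[of "w s"]) simp_all
  qed auto
  also have "\<dots> \<in> sets lebesgue"
    by (intro sets.finite_UN sets.Int word_space_level_set[OF assms(1)] word_space_level_set[OF assms(2)]) simp_all
  finally show ?thesis by (intro bounded_set_imp_lmeasurable) (auto intro: bounded_subset[of "{0..r}"])
qed

lemma agreement_triangle:
  assumes w: "w \<in> word_space k r" "w' \<in> word_space k r" "w'' \<in> word_space k r" and r: "0 \<le> r"
  shows "measure lebesgue {s \<in> {0..r}. w s = w' s} + measure lebesgue {s \<in> {0..r}. w' s = w'' s}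
    \<le> r + measure lebesgue {s \<in> {0..r}. w s = w'' s}"
proof -
  let ?A = "{s \<in> {0..r}. w s = w' s}" and ?B = "{s \<in> {0..r}. w' s = w'' s}" and ?C = "{s \<in> {0..r}. w s = w'' s}"
  have m: "?A \<in> lmeasurable" "?B \<in> lmeasurable" "?C \<in> lmeasurable" using agreement_measurable w by blast+
  have "measure lebesgue ?A + measure lebesgue ?B = measure lebesgue (?A \<union> ?B) + measure lebesgue (?A \<inter> ?B)"
    using measure_Un3[OF m(1,2)] by simp
  also have "measure lebesgue (?A \<union> ?B) \<le> measure lebesgue {0..r}"
    using m by (intro measure_mono_fmeasurable) auto
  also have "measure lebesgue {0..r} = r" using r by simp
  also have "measure lebesgue (?A \<inter> ?B) \<le> measure lebesgue ?C"
    using m by (intro measure_mono_fmeasurable) auto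
  finally show ?thesis by simp
qed

lemma hamming_dist_sym: "hamming_dist r w w' = hamming_dist r w' w"
proof -
  have "{s \<in> {0..r}. w s = w' s} = {s \<in> {0..r}. w' s = w s}" by auto
  then show ?thesis by (simp add: hamming_dist_def)
qed

lemma hamming_dist_triangle:
  assumes "w \<in> word_space k r" "w' \<in> word_space k r" "w'' \<in> word_space k r" "0 < r"
  shows "hamming_dist r w w'' \<le> hamming_dist r w w' + hamming_dist r w' w''"
proof -
  have "1 / r * (r - measure lebesgue {s \<in> {0..r}. w s = w'' s})
    \<le> 1 / r * ((r - measure lebesgue {s \<in> {0..r}. w s = w' s}) + (r - measure lebesgue {s \<in> {0..r}. w' s = w'' s}))"
    using agreement_triangle[OF assms(1-3)] assms(4) by (intro mult_left_mono) auto
  then show ?thesis by (simp only: hamming_dist_def distrib_left)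
qed

locale kochergin_partition = kochergin +
  fixes k :: nat and P :: "nat \<Rightarrow> (real \<times> real) set"
  assumes part: "finite_measurable_partition M k P"
begin

abbreviation name :: "real \<Rightarrow> real \<times> real \<Rightarrow> real \<Rightarrow> nat" where
  "name r \<equiv> name_map (special_flow \<alpha> f) k P r"

lemma P_sets: "i \<in> {1..k} \<Longrightarrow> P i \<in> sets borel"
  using part by (auto simp: finite_measurable_partition_def sets_M)

lemma name_iff:
  assumes "p \<in> X" "t \<in> {0..r}"
  shows "i \<in> {1..k} \<Longrightarrow> name r p t = i \<longleftrightarrow> flow t p \<in> P i"
    and "name r p t \<in> {1..k}"
proof -
  have inj: "inj_on P {1..k}" and U: "\<Union>(P ` {1..k}) = X" and disj: "disjoint (P ` {1..k})"
    using part by (auto simp: finite_measurable_partition_def partition_on_def)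
  have fl: "flow t p \<in> X" using assms flow_in_X by simp
  then obtain j where j: "j \<in> {1..k}" "flow t p \<in> P j" using U by blast
  have uniq: "i = j" if "i \<in> {1..k}" "flow t p \<in> P i" for i
  proof -
    have "P i = P j" using disj that j unfolding disjoint_def by blast
    then show ?thesis using inj that j by (meson inj_onD)
  qed
  have "name r p t = (THE i. i \<in> {1..k} \<and> flow t p \<in> P i)"
    using assms special_flow_eq_flow by (simp add: name_map_def)
  also have "\<dots> = j" by (intro the_equality) (use j uniq in blast)+
  finally have nm: "name r p t = j" .
  then show "name r p t \<in> {1..k}" using j by simp
  show "name r p t = i \<longleftrightarrow> flow t p \<in> P i" if "i \<in> {1..k}"
    unfolding nm using uniq[OF that] j by blast
qed

lemma name_in_word_space:
  assumes "p \<in> X"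
  shows "name r p \<in> word_space k r"
proof -
  have "name r p \<in> measurable (lebesgue_on {0..r}) (count_space {1..k})"
  proof (subst measurable_count_space_eq2)
    show "name r p \<in> space (lebesgue_on {0..r}) \<rightarrow> {1..k} \<and>
      (\<forall>i\<in>{1..k}. name r p -` {i} \<inter> space (lebesgue_on {0..r}) \<in> sets (lebesgue_on {0..r}))"
    proof (intro conjI ballI)
      show "name r p \<in> space (lebesgue_on {0..r}) \<rightarrow> {1..k}" 
      proof
        fix t assume t: "t \<in> space (lebesgue_on {0..r})"
        then show "name r p t \<in> {1..k}" by (intro name_iff(2)[OF assms]) simp
      qed
      fix i assume i: "i \<in> {1..k}"
      have "name r p -` {i} \<inter> space (lebesgue_on {0..r}) = {t \<in> space borel. t \<in> {0..r} \<and> flow t p \<in> P i}"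
        using name_iff(1)[OF assms _ i, of _ r] by (auto simp del: atLeastAtMost_iff)
      also have "\<dots> \<in> sets borel" using P_sets[OF i] by measurable
      finally show "name r p -` {i} \<inter> space (lebesgue_on {0..r}) \<in> sets (lebesgue_on {0..r})"
        by (simp add: sets_restrict_space_iff)
    qed
  qed simp
  then show ?thesis by (simp add: word_space_def name_map_def)
qed

text \<open>
  The letter sets of an arbitrary word are only Lebesgue measurable; replacing them by Borel sets up to null
  sets makes Fubini's theorem applicable on the product with the flow space.
\<close>

lemma agreement_with_name_measurable:
  assumes w: "w \<in> word_space k r"
  obtains g where "g \<in> borel_measurable borel"
    "\<And>p. p \<in> X \<Longrightarrow> measure lebesgue {s \<in> {0..r}. w s = name r p s} = enn2real (g p)"
proof -
  have ex: "\<forall>i\<in>{1..k}. \<exists>z. fst z \<in> sets borel \<and> snd z \<in> null_sets lebesgue \<and> {s \<in> {0..r}. w s = i} = fst z \<union> snd z"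
  proof
    fix i assume i: "i \<in> {1..k}"
    obtain S N N' where SN: "{s \<in> {0..r}. w s = i} = S \<union> N" "N \<subseteq> N'" "N' \<in> null_sets lborel" "S \<in> sets lborel"
      using word_space_level_set[OF w i] by (rule sets_completionE)
    have "N \<in> null_sets lebesgue" using null_sets_completion_subset[OF SN(2) null_sets_completionI[OF SN(3)]] .
    then show "\<exists>z. fst z \<in> sets borel \<and> snd z \<in> null_sets lebesgue \<and> {s \<in> {0..r}. w s = i} = fst z \<union> snd z"
      using SN by (intro exI[of _ "(S, N)"]) simp
  qed
  obtain F where F: "\<forall>i\<in>{1..k}. fst (F i) \<in> sets borel \<and> snd (F i) \<in> null_sets lebesgue \<and> {s \<in> {0..r}. w s = i} = fst (F i) \<union> snd (F i)"
    using bchoice[OF ex] ..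
  define S N where "S i = fst (F i)" and "N i = snd (F i)" for i
  have SN: "S i \<in> sets borel" "N i \<in> null_sets lebesgue" "{s \<in> {0..r}. w s = i} = S i \<union> N i" if "i \<in> {1..k}" for i
    using bspec[OF F that] by (simp_all only: S_def N_def)
  define Q where "Q = (\<Union>i\<in>{1..k}. {q :: (real \<times> real) \<times> real. snd q \<in> S i \<and> snd q \<in> {0..r} \<and> flow (snd q) (fst q) \<in> P i})"
  have Q: "Q \<in> sets borel"
    unfolding Q_def
  proof (intro sets.finite_UN)
    fix i assume i: "i \<in> {1..k}"
    have [measurable]: "S i \<in> sets borel" "P i \<in> sets borel" using SN(1)[OF i] P_sets[OF i] by auto
    have "{q \<in> space borel. snd q \<in> S i \<and> snd q \<in> {0..r} \<and> flow (snd q) (fst q) \<in> P i} \<in> sets (borel :: ((real \<times> real) \<times> real) measure)"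
      by measurable
    then show "{q :: (real \<times> real) \<times> real. snd q \<in> S i \<and> snd q \<in> {0..r} \<and> flow (snd q) (fst q) \<in> P i} \<in> sets borel" by simp
  qed simp
  show ?thesis
  proof (rule that[of "\<lambda>p. emeasure lborel (Pair p -` Q)"])
    show "(\<lambda>p. emeasure lborel (Pair p -` Q)) \<in> borel_measurable borel" by (rule emeasure_lborel_prod(2)[OF Q])
    fix p assume p: "p \<in> X"
    have Qp: "Pair p -` Q \<in> sets borel"
    proof -
      have "Pair p \<in> borel_measurable (borel :: real measure)"
        by (intro borel_measurable_continuous_onI continuous_intros)
      from measurable_sets[OF this Q] show ?thesis by simp
    qed
    have "measure lebesgue {s \<in> {0..r}. w s = name r p s} = measure lebesgue (Pair p -` Q)"
    proof (rule measure_eq_AE)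
      have "(\<Union>i\<in>{1..k}. N i) \<in> null_sets lebesgue" using SN(2) by (intro null_sets.finite_UN) auto
      then show "AE s in lebesgue. (s \<in> {s \<in> {0..r}. w s = name r p s}) = (s \<in> Pair p -` Q)"
      proof (rule AE_I')
        show "{s \<in> space lebesgue. \<not> ((s \<in> {s \<in> {0..r}. w s = name r p s}) = (s \<in> Pair p -` Q))} \<subseteq> (\<Union>i\<in>{1..k}. N i)"
        proof
          fix s assume s: "s \<in> {s \<in> space lebesgue. \<not> ((s \<in> {s \<in> {0..r}. w s = name r p s}) = (s \<in> Pair p -` Q))}"
          have sr: "s \<in> {0..r}" using s by (auto simp: Q_def)
          have wr: "w s \<in> {1..k}" by (rule word_space_range[OF w sr])
          show "s \<in> (\<Union>i\<in>{1..k}. N i)"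
          proof (rule ccontr)
            assume no: "s \<notin> (\<Union>i\<in>{1..k}. N i)"
            have "s \<in> S i \<longleftrightarrow> w s = i" if "i \<in> {1..k}" for i using SN(3)[OF that] no that sr by blast
            then have "s \<in> Pair p -` Q \<longleftrightarrow> flow s p \<in> P (w s)" using sr wr by (auto simp: Q_def)
            also have "\<dots> \<longleftrightarrow> name r p s = w s" using name_iff(1)[OF p sr wr] by simp
            finally show False using s sr by auto
          qed
        qed
      qed
      show "{s \<in> {0..r}. w s = name r p s} \<in> sets lebesgue"
        by (rule fmeasurableD) (rule agreement_measurable[OF w name_in_word_space[OF p]])
      show "Pair p -` Q \<in> sets lebesgue" using Qp by simp
    qed
    also have "\<dots> = enn2real (emeasure lborel (Pair p -` Q))" using Qp by (simp add: measure_def)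
    finally show "measure lebesgue {s \<in> {0..r}. w s = name r p s} = enn2real (emeasure lborel (Pair p -` Q))" .
  qed
qed

lemma ball_vimage_sets:
  assumes w: "w \<in> word_space k r"
  shows "{p \<in> X. hamming_dist r w (name r p) < \<epsilon>} \<in> sets M"
proof -
  obtain g where g [measurable]: "g \<in> borel_measurable borel"
    and eq: "\<And>p. p \<in> X \<Longrightarrow> measure lebesgue {s \<in> {0..r}. w s = name r p s} = enn2real (g p)"
    using agreement_with_name_measurable[OF w] by blast
  have "{p \<in> X. hamming_dist r w (name r p) < \<epsilon>} = {p \<in> space borel. p \<in> X \<and> 1 / r * (r - enn2real (g p)) < \<epsilon>}"
    using eq by (auto simp: hamming_dist_def)
  also have "\<dots> \<in> sets borel" by measurable
  finally show ?thesis by (auto simp: sets_M)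
qed

lemma name_measurable: "name r \<in> measurable M (word_algebra k r)"
  unfolding word_algebra_def
proof (rule measurable_measure_of)
  show "{hamming_ball k r w \<epsilon> |w \<epsilon>. w \<in> word_space k r \<and> 0 < \<epsilon>} \<subseteq> Pow (word_space k r)"
    by (auto simp: hamming_ball_def)
  show "name r \<in> space M \<rightarrow> word_space k r" using name_in_word_space by simp
  fix B assume "B \<in> {hamming_ball k r w \<epsilon> |w \<epsilon>. w \<in> word_space k r \<and> 0 < \<epsilon>}"
  then obtain w \<epsilon> where w: "B = hamming_ball k r w \<epsilon>" "w \<in> word_space k r" by blast
  have "name r -` B \<inter> space M = {p \<in> X. hamming_dist r w (name r p) < \<epsilon>}"
    using name_in_word_space by (auto simp: w hamming_ball_def)
  then show "name r -` B \<inter> space M \<in> sets M" using ball_vimage_sets[OF w(2)] by simp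
qed

lemma name_measure_balls:
  assumes C: "finite C" "C \<subseteq> word_space k r" and \<epsilon>: "0 < \<epsilon>"
  shows "measure (name_measure M (special_flow \<alpha> f) k P r) (\<Union>w\<in>C. hamming_ball k r w \<epsilon>)
    = measure M {p \<in> X. \<exists>w\<in>C. hamming_dist r w (name r p) < \<epsilon>}"
    "{p \<in> X. \<exists>w\<in>C. hamming_dist r w (name r p) < \<epsilon>} \<in> sets M"
proof -
  have "hamming_ball k r w \<epsilon> \<in> sets (word_algebra k r)" if "w \<in> C" for w
    unfolding word_algebra_def using that C \<epsilon> by (subst sets_measure_of) (auto simp: hamming_ball_def)
  then have U: "(\<Union>w\<in>C. hamming_ball k r w \<epsilon>) \<in> sets (word_algebra k r)" using C by (intro sets.finite_UN) auto
  have eq: "name r -` (\<Union>w\<in>C. hamming_ball k r w \<epsilon>) \<inter> space M = {p \<in> X. \<exists>w\<in>C. hamming_dist r w (name r p) < \<epsilon>}"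
    using name_in_word_space by (auto simp: hamming_ball_def)
  show "measure (name_measure M (special_flow \<alpha> f) k P r) (\<Union>w\<in>C. hamming_ball k r w \<epsilon>)
    = measure M {p \<in> X. \<exists>w\<in>C. hamming_dist r w (name r p) < \<epsilon>}"
    unfolding name_measure_def by (subst measure_distr[OF name_measurable U]) (simp only: eq)
  show "{p \<in> X. \<exists>w\<in>C. hamming_dist r w (name r p) < \<epsilon>} \<in> sets M"
    using measurable_sets[OF name_measurable U] by (simp only: eq)
qed

abbreviation cov :: "real \<Rightarrow> real \<Rightarrow> real \<Rightarrow> ennreal" where
  "cov r \<epsilon> \<beta> \<equiv> covering_number M (special_flow \<alpha> f) k P r \<epsilon> \<beta>"

lemma covering_number_le:
  assumes C: "finite C" "C \<subseteq> word_space k r" and \<epsilon>: "0 < \<epsilon>"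
    and "\<beta> - \<epsilon> < measure M {p \<in> X. \<exists>w\<in>C. hamming_dist r w (name r p) < \<epsilon>}"
  shows "cov r \<epsilon> \<beta> \<le> of_nat (card C)"
  unfolding covering_number_def
  using assms by (intro INF_lower) (simp add: name_measure_balls)

lemma covering_number_ge:
  assumes \<epsilon>: "0 < \<epsilon>" and "\<And>C. finite C \<Longrightarrow> C \<subseteq> word_space k r \<Longrightarrow>
    \<beta> - \<epsilon> < measure M {p \<in> X. \<exists>w\<in>C. hamming_dist r w (name r p) < \<epsilon>} \<Longrightarrow> b \<le> of_nat (card C)"
  shows "b \<le> cov r \<epsilon> \<beta>"
  unfolding covering_number_def
proof (rule INF_greatest)
  fix C assume "C \<in> {C. finite C \<and> C \<subseteq> word_space k r \<and>
    \<beta> - \<epsilon> < measure (name_measure M (special_flow \<alpha> f) k P r) (\<Union>w\<in>C. hamming_ball k r w \<epsilon>)}"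
  then have C: "finite C" "C \<subseteq> word_space k r"
    and "\<beta> - \<epsilon> < measure (name_measure M (special_flow \<alpha> f) k P r) (\<Union>w\<in>C. hamming_ball k r w \<epsilon>)"
    by auto
  then show "b \<le> of_nat (card C)" using assms(2)[OF C] name_measure_balls(1)[OF C \<epsilon>] by simp
qed

lemma covering_number_antimono:
  assumes "0 < \<epsilon>" "\<epsilon> \<le> \<epsilon>'"
  shows "cov r \<epsilon>' \<beta> \<le> cov r \<epsilon> \<beta>"
proof (rule covering_number_ge[OF assms(1)])
  fix C assume C: "finite C" "C \<subseteq> word_space k r" "\<beta> - \<epsilon> < measure M {p \<in> X. \<exists>w\<in>C. hamming_dist r w (name r p) < \<epsilon>}"
  have "measure M {p \<in> X. \<exists>w\<in>C. hamming_dist r w (name r p) < \<epsilon>} \<le> measure M {p \<in> X. \<exists>w\<in>C. hamming_dist r w (name r p) < \<epsilon>'}"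
    using assms C by (intro M.finite_measure_mono name_measure_balls(2)) (auto intro: less_le_trans)
  then show "cov r \<epsilon>' \<beta> \<le> of_nat (card C)" using C assms by (intro covering_number_le) auto
qed

abbreviation growth :: "real \<Rightarrow> real \<Rightarrow> ennreal" where
  "growth \<epsilon> \<beta> \<equiv> growth_exponent (\<lambda>n t. real n powr t) M (special_flow \<alpha> f) k P \<epsilon> \<beta>"

lemma growth_antimono:
  assumes "0 < \<epsilon>" "\<epsilon> \<le> \<epsilon>'"
  shows "growth \<epsilon>' \<beta> \<le> growth \<epsilon> \<beta>"
  unfolding growth_exponent_def
proof (rule Sup_subset_mono, safe)
  fix t :: real
  assume t: "0 < t"
  assume "0 < Liminf at_top (\<lambda>r. cov r \<epsilon>' \<beta> / ennreal (real (nat \<lfloor>r\<rfloor>) powr t))"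
  also have "\<dots> \<le> Liminf at_top (\<lambda>r. cov r \<epsilon> \<beta> / ennreal (real (nat \<lfloor>r\<rfloor>) powr t))"
    using covering_number_antimono[OF assms]
    by (intro Liminf_mono always_eventually allI divide_right_mono_ennreal)
  finally show "\<exists>t'. ennreal t = ennreal t' \<and> 0 < t' \<and> 0 < Liminf at_top (\<lambda>r. cov r \<epsilon> \<beta> / ennreal (real (nat \<lfloor>r\<rfloor>) powr t'))"
    using t by blast
qed

text \<open>
  The growth exponent is antitone in \<open>\<epsilon>\<close>, so the limit at \<open>0\<close> is the supremum.
\<close>

lemma partition_entropy_eq:
  "partition_entropy (\<lambda>n t. real n powr t) M (special_flow \<alpha> f) k P \<beta> = (SUP \<epsilon>\<in>{0<..}. growth \<epsilon> \<beta>)"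
proof -
  let ?S = "SUP \<epsilon>\<in>{0<..}. growth \<epsilon> \<beta>"
  have "((\<lambda>\<epsilon>. growth \<epsilon> \<beta>) \<longlongrightarrow> ?S) (at_right 0)"
  proof (rule order_tendstoI)
    fix a assume "a < ?S"
    then obtain \<epsilon>0 where \<epsilon>0: "0 < \<epsilon>0" "a < growth \<epsilon>0 \<beta>" by (auto simp: less_SUP_iff)
    then show "\<forall>\<^sub>F \<epsilon> in at_right 0. a < growth \<epsilon> \<beta>"
      unfolding eventually_at_right_field using growth_antimono
      by (intro exI[of _ \<epsilon>0]) (auto intro: less_le_trans)
  next
    fix a assume "?S < a"
    then have "growth \<epsilon> \<beta> < a" if "0 < \<epsilon>" for \<epsilon>
      using SUP_upper[of \<epsilon> "{0<..}" "\<lambda>\<epsilon>. growth \<epsilon> \<beta>"] that by (auto intro: le_less_trans)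
    then show "\<forall>\<^sub>F \<epsilon> in at_right 0. growth \<epsilon> \<beta> < a"
      unfolding eventually_at_right_field by (intro exI[of _ 1]) auto
  qed
  then show ?thesis unfolding partition_entropy_def by (intro tendsto_Lim) auto
qed

end

section \<open>The lower bound\<close>

lemma emeasure_lborel_Times:
  fixes A B :: "real set"
  assumes "A \<in> sets borel" "B \<in> sets borel"
  shows "emeasure lborel (A \<times> B) = emeasure lborel A * emeasure lborel B"
  using lborel.emeasure_pair_measure_Times[of A lborel B] assms by (simp add: lborel_prod)

context kochergin
begin

lemma partition_of_finite_coloring:
  fixes col :: "real \<times> real \<Rightarrow> 'c"
  assumes fin: "finite (col ` X)" and meas: "\<And>v. {p \<in> X. col p = v} \<in> sets borel"
  obtains k P where "finite_measurable_partition M k P"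
    "\<And>i p q. i \<in> {1..k} \<Longrightarrow> p \<in> P i \<Longrightarrow> q \<in> P i \<Longrightarrow> col p = col q"
proof -
  define F where "F v = {p \<in> X. col p = v}" for v
  obtain h where h: "bij_betw h {1..card (col ` X)} (col ` X)"
    using ex_bij_betw_nat_finite_1[OF fin] by blast
  have img: "h ` {1..card (col ` X)} = col ` X" using h by (simp add: bij_betw_def)
  show ?thesis
  proof (rule that[of "card (col ` X)" "\<lambda>i. F (h i)"])
    have "inj_on F (col ` X)" by (rule inj_onI) (auto simp: F_def)
    then have inj: "inj_on (\<lambda>i. F (h i)) {1..card (col ` X)}"
      using h comp_inj_on[of h "{1..card (col ` X)}" F] by (simp add: bij_betw_def comp_def)
    have im: "(\<lambda>i. F (h i)) ` {1..card (col ` X)} = F ` col ` X"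
      using img by (metis image_image)
    have part: "partition_on X (F ` col ` X)"
      unfolding partition_on_def
    proof (intro conjI)
      show "\<Union>(F ` col ` X) = X" by (auto simp: F_def)
      show "{} \<notin> F ` col ` X" by (auto simp: F_def)
      show "disjoint (F ` col ` X)" unfolding disjoint_def by (auto simp: F_def)
    qed
    show "finite_measurable_partition M (card (col ` X)) (\<lambda>i. F (h i))"
      unfolding finite_measurable_partition_def im space_M
      using inj part meas by (auto simp: sets_M F_def)
  qed (auto simp: F_def)
qed

lemma small_cusp:
  assumes "0 < \<eta>"
  obtains H where "0 < H" "{p \<in> X. H \<le> snd p} \<in> sets M" "measure M {p \<in> X. H \<le> snd p} \<le> \<eta>"
    "emeasure lborel {p \<in> X. H \<le> snd p} \<le> ennreal (\<eta> * area)"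
proof -
  define A where "A n = {p \<in> X. real n \<le> snd p}" for n
  have Am: "A n \<in> sets M" for n
  proof -
    have "{p \<in> space borel. p \<in> X \<and> real n \<le> snd p} \<in> sets borel" by measurable
    then show ?thesis by (auto simp: sets_M A_def)
  qed
  have "(\<lambda>n. measure M (A n)) \<longlonglongrightarrow> measure M (\<Inter>n. A n)"
    using Am by (intro M.finite_Lim_measure_decseq) (auto simp: decseq_def A_def)
  moreover have "(\<Inter>n. A n) = {}"
  proof -
    have "p \<notin> (\<Inter>n. A n)" for p
    proof -
      obtain n :: nat where "snd p < real n" using reals_Archimedean2 by blast
      then show ?thesis by (auto simp: A_def not_le intro!: exI[of _ n])
    qed
    then show ?thesis by blast
  qed
  ultimately have "(\<lambda>n. measure M (A n)) \<longlonglongrightarrow> 0" by simp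
  then have "\<forall>\<^sub>F n in sequentially. measure M (A n) < \<eta>" using assms by (rule order_tendstoD)
  then obtain n0 where n0: "\<And>n. n0 \<le> n \<Longrightarrow> measure M (A n) < \<eta>"
    unfolding eventually_sequentially by blast
  have meas: "measure M (A (Suc n0)) \<le> \<eta>" using n0[of "Suc n0"] by simp
  have "emeasure lborel (A (Suc n0)) = ennreal (measure lborel (A (Suc n0)))"
    using emeasure_mono[of "A (Suc n0)" X lborel] emeasure_X
    by (intro emeasure_eq_ennreal_measure) (auto simp: top_unique A_def)
  also have "\<dots> \<le> ennreal (\<eta> * area)"
    using meas area_pos measure_M[OF Am] by (intro ennreal_leI) (simp add: pos_divide_le_eq)
  finally have "emeasure lborel (A (Suc n0)) \<le> ennreal (\<eta> * area)" .
  then show ?thesis using that[of "real (Suc n0)"] Am[of "Suc n0"] meas by (simp only: A_def of_nat_0_less_iff zero_less_Suc)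
qed

lemma long_closeness_measure_le:
  assumes "0 < r" "0 < \<delta>" "0 < H" "p \<in> X"
  defines "Q \<equiv> {q \<in> X. 1/4 * r < measure lborel {t \<in> {0..r}. (t, flow t q) \<in>
      {z. snd (snd z) < H \<and> 0 \<le> snd (snd z) \<and> \<bar>fst (snd z) - fst (flow (fst z) p)\<bar> \<le> \<delta>}}}"
  shows "Q \<in> sets M" "measure M Q \<le> 8 * H / area * \<delta>"
proof -
  define W where "W = {z :: real \<times> (real \<times> real). snd (snd z) < H \<and> 0 \<le> snd (snd z) \<and> \<bar>fst (snd z) - fst (flow (fst z) p)\<bar> \<le> \<delta>}"
  have [measurable]: "(\<lambda>z::real \<times> (real \<times> real). flow (fst z) p) \<in> borel_measurable borel"
    using measurable_compose[of fst borel borel, OF _ flow_measurable_time] by simp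
  have "{z \<in> space (borel :: (real \<times> (real \<times> real)) measure). snd (snd z) < H \<and> 0 \<le> snd (snd z) \<and> \<bar>fst (snd z) - fst (flow (fst z) p)\<bar> \<le> \<delta>} \<in> sets borel"
    by measurable
  then have W: "W \<in> sets borel" by (simp add: W_def)
  have small: "emeasure lborel {q \<in> X. (t, q) \<in> W} \<le> ennreal (2 * \<delta> * H)" for t
  proof -
    let ?x = "fst (flow t p)"
    have "emeasure lborel {q \<in> X. (t, q) \<in> W} \<le> emeasure lborel ({?x - \<delta>..?x + \<delta>} \<times> {0..H})"
      by (intro emeasure_mono) (auto simp: W_def abs_le_iff intro!: borel_closed closed_Times)
    also have "\<dots> = ennreal (2 * \<delta> * H)" using assms(2,3) by (subst emeasure_lborel_Times) (auto simp: ennreal_mult)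
    finally show ?thesis .
  qed
  have Q: "Q = {q \<in> X. 1/4 * r < measure lborel {t \<in> {0..r}. (t, flow t q) \<in> W}}"
    by (simp add: Q_def W_def)
  have pos: "0 < (1/4 :: real)" "0 \<le> 2 * \<delta> * H" using assms(2,3) by auto
  show "Q \<in> sets M" unfolding Q by (rule measure_long_stay_le(1)[OF W assms(1) pos small])
  have "measure M Q \<le> 2 * \<delta> * H / (1/4 * area)"
    unfolding Q by (rule measure_long_stay_le(2)[OF W assms(1) pos small])
  then show "measure M Q \<le> 8 * H / area * \<delta>" by (simp add: mult_ac)
qed

text \<open>
  The partition is the grid of mesh \<open>1 / N\<close> horizontally and \<open>1\<close> vertically below the level \<open>H\<close>, with one
  further atom above it. Names at distance below \<open>1/4\<close> agree for more than \<open>3/4\<close> of the time; a quarter is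
  lost to the atom above \<open>H\<close> and a quarter to distant matches, so for a quarter of the time the two orbits
  are horizontally \<open>\<delta>\<close>-close.
\<close>

lemma slow_entropy_ge_exponent:
  assumes \<beta>: "0 < \<beta>" "\<beta> \<le> 1" and t: "0 < t" "t < 1 + \<gamma>"
  shows "ennreal t \<le> slow_entropy (\<lambda>n t. real n powr t) \<beta> M (special_flow \<alpha> f)"
proof -
  (* e so small that the loss 12 * e in the exponent keeps it above t *)
  define u where "u = (1 + \<gamma>) / t"
  have u: "1 < u" using t by (simp add: u_def)
  define e where "e = min (\<gamma> / 15) ((u - 1) / 12)"
  have e: "0 < e" "15 * e \<le> \<gamma>" "12 * e \<le> u - 1" using \<gamma> u by (auto simp: e_def min_def)
  have te: "t \<le> (1 + \<gamma>) / (1 + 12 * e)"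
  proof -
    have "1 + 12 * e \<le> u" using e by linarith
    then show ?thesis using t e(1) by (simp add: u_def field_simps)
  qed
  obtain H where H: "0 < H" "emeasure lborel {p \<in> X. H \<le> snd p} \<le> ennreal (\<beta> / 16 * area)"
    using small_cusp[of "\<beta> / 16"] \<beta> by auto
  obtain N :: nat where N: "0 < N" and few:
    "\<And>p q r. \<lbrakk>p \<in> X; q \<in> X; 0 < r\<rbrakk> \<Longrightarrow>
       measure lborel {t \<in> {0..r}. snd (flow t p) < H \<and> snd (flow t q) < H \<and> \<bar>snd (flow t p) - snd (flow t q)\<bar> < 1 \<and>
         \<bar>fst (flow t p) - fst (flow t q)\<bar> < 1 / real N \<and>
         r powr - ((1 + \<gamma>) / (1 + 12 * e)) < \<bar>fst (flow t p) - fst (flow t q)\<bar>} \<le> r / 4"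
    by (rule few_distant_matches[OF e(1,2) H(1)]) (rule that)
  define col where "col p = (if snd p < H then Some (\<lfloor>real N * fst p\<rfloor>, \<lfloor>snd p\<rfloor>) else None)" for p :: "real \<times> real"
  have fin: "finite (col ` X)"
  proof -
    have "col ` X \<subseteq> insert None (Some ` ({0..int N} \<times> {0..\<lfloor>H\<rfloor>}))"
    proof
      fix v assume "v \<in> col ` X"
      then obtain x s where xs: "(x, s) \<in> X" "v = col (x, s)" by auto
      then have b: "0 \<le> x" "x < 1" "0 \<le> s" using X_iff by auto
      have "real N * x \<le> real N * 1" using b by (intro mult_left_mono) auto
      then have "\<lfloor>real N * x\<rfloor> \<le> int N" "0 \<le> \<lfloor>real N * x\<rfloor>" using b by (auto simp: floor_le_iff)
      then show "v \<in> insert None (Some ` ({0..int N} \<times> {0..\<lfloor>H\<rfloor>}))"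
        using b xs by (auto simp: col_def intro!: floor_mono imageI)
    qed
    then show ?thesis by (rule finite_subset) auto
  qed
  have meas: "{p \<in> X. col p = v} \<in> sets borel" for v
  proof (cases v)
    case None
    then have "{p \<in> X. col p = v} = {p \<in> space borel. p \<in> X \<and> \<not> snd p < H}" by (auto simp: col_def)
    also have "\<dots> \<in> sets borel" by measurable
    finally show ?thesis .
  next
    case (Some ab)
    then have "{p \<in> X. col p = v} = {p \<in> space borel. p \<in> X \<and> snd p < H \<and> \<lfloor>real N * fst p\<rfloor> = fst ab \<and> \<lfloor>snd p\<rfloor> = snd ab}"
      by (auto simp: col_def)
    also have "\<dots> \<in> sets borel" by measurable
    finally show ?thesis .
  qed
  obtain k P where part: "finite_measurable_partition M k P"
    and same_col: "\<And>i p q. i \<in> {1..k} \<Longrightarrow> p \<in> P i \<Longrightarrow> q \<in> P i \<Longrightarrow> col p = col q"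
    using partition_of_finite_coloring[OF fin meas] by blast
  interpret kochergin_partition \<alpha> \<gamma> f f' f'' cf Cf k P
    by unfold_locales (rule part)
  (* two names in one ball of radius \<epsilon> are at distance below 1/4 *)
  define \<epsilon> where "\<epsilon> = min (1/8) (\<beta> / 4)"
  have \<epsilon>: "0 < \<epsilon>" "2 * \<epsilon> \<le> 1/4" "\<epsilon> \<le> \<beta> / 4" using \<beta> by (auto simp: \<epsilon>_def)
  define D where "D = 8 * H / area"
  have D: "0 < D" using H area_pos by (simp add: D_def)
  have cov_ge: "ennreal (\<beta> / (2 * D) * r powr t) \<le> cov r \<epsilon> \<beta>" if r: "1 \<le> r" for r
  proof (rule covering_number_ge[OF \<epsilon>(1)])
    fix C assume C: "finite C" "C \<subseteq> word_space k r"
      and big: "\<beta> - \<epsilon> < measure M {p \<in> X. \<exists>w\<in>C. hamming_dist r w (name r p) < \<epsilon>}"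
    have r0: "0 < r" using r by simp
    define \<delta> where "\<delta> = r powr - ((1 + \<gamma>) / (1 + 12 * e))"
    have \<delta>: "0 < \<delta>" using r by (simp add: \<delta>_def)
    define cusp where "cusp = {z :: real \<times> (real \<times> real). H \<le> snd (snd z)}"
    have "{z \<in> space (borel :: (real \<times> (real \<times> real)) measure). H \<le> snd (snd z)} \<in> sets borel" by measurable
    then have cusp [measurable]: "cusp \<in> sets borel" by (simp add: cusp_def)
    define B where "B = {q \<in> X. 1/4 * r < measure lborel {t \<in> {0..r}. (t, flow t q) \<in> cusp}}"
    have Bs: "B \<in> sets M" and B: "measure M B \<le> \<beta> / 4"
    proof -
      have "{p \<in> X. (t, p) \<in> cusp} = {p \<in> X. H \<le> snd p}" for t by (auto simp: cusp_def)
      then have small: "emeasure lborel {p \<in> X. (t, p) \<in> cusp} \<le> ennreal (\<beta> / 16 * area)" for t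
        using H(2) by simp
      have pos: "0 < (1/4 :: real)" "0 \<le> \<beta> / 16 * area" using \<beta> area_pos by auto
      show "B \<in> sets M" unfolding B_def by (rule measure_long_stay_le(1)[OF cusp r0 pos small])
      have "measure M B \<le> (\<beta> / 16 * area) / (1/4 * area)"
        unfolding B_def by (rule measure_long_stay_le(2)[OF cusp r0 pos small])
      then show "measure M B \<le> \<beta> / 4" using area_pos by simp
    qed
    define W where "W p = {z. snd (snd z) < H \<and> 0 \<le> snd (snd z) \<and> \<bar>fst (snd z) - fst (flow (fst z) p)\<bar> \<le> \<delta>}" for p
    define Q where "Q p = {q \<in> X. 1/4 * r < measure lborel {t \<in> {0..r}. (t, flow t q) \<in> W p}}" for p
    have Qs: "Q p \<in> sets M" "measure M (Q p) \<le> D * \<delta>" if "p \<in> X" for p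
      unfolding Q_def W_def D_def by (rule long_closeness_measure_le[OF r0 \<delta> H(1) that])+
    have close: "q \<in> Q p" if p: "p \<in> X" "p \<notin> B" and q: "q \<in> X" and d: "hamming_dist r (name r p) (name r q) < 1/4" for p q
    proof -
      define S where "S = {s \<in> {0..r}. name r p s = name r q s}"
      define S1 where "S1 = {t \<in> {0..r}. (t, flow t p) \<in> cusp}"
      define S2 where "S2 = {t \<in> {0..r}. snd (flow t p) < H \<and> snd (flow t q) < H \<and> \<bar>snd (flow t p) - snd (flow t q)\<bar> < 1 \<and>
         \<bar>fst (flow t p) - fst (flow t q)\<bar> < 1 / real N \<and>
         \<delta> < \<bar>fst (flow t p) - fst (flow t q)\<bar>}"
      define S3 where "S3 = {t \<in> {0..r}. (t, flow t q) \<in> W p}"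
      have "{t \<in> space borel. t \<in> {0..r} \<and> H \<le> snd (flow t p)} \<in> sets borel" by measurable
      then have 1: "S1 \<in> sets borel" by (simp add: S1_def cusp_def)
      have "{t \<in> space borel. t \<in> {0..r} \<and> snd (flow t p) < H \<and> snd (flow t q) < H \<and> \<bar>snd (flow t p) - snd (flow t q)\<bar> < 1 \<and>
         \<bar>fst (flow t p) - fst (flow t q)\<bar> < 1 / real N \<and> \<delta> < \<bar>fst (flow t p) - fst (flow t q)\<bar>} \<in> sets borel" by measurable
      then have 2: "S2 \<in> sets borel" by (simp add: S2_def)
      have "{t \<in> space borel. t \<in> {0..r} \<and> snd (flow t q) < H \<and> 0 \<le> snd (flow t q) \<and> \<bar>fst (flow t q) - fst (flow t p)\<bar> \<le> \<delta>} \<in> sets borel"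
        by measurable
      then have 3: "S3 \<in> sets borel" by (simp add: S3_def W_def)
      have sub: "S \<subseteq> S1 \<union> (S2 \<union> S3)"
      proof
        fix s assume "s \<in> S"
        then have s: "s \<in> {0..r}" "name r p s = name r q s" by (auto simp: S_def)
        have "flow s p \<in> P (name r p s)" "flow s q \<in> P (name r p s)"
          using name_iff[OF p(1) s(1)] name_iff[OF q s(1)] s(2) by metis+
        then have "col (flow s p) = col (flow s q)" using same_col name_iff(2)[OF p(1) s(1)] by blast
        moreover have "flow s q \<in> X" using flow_in_X[OF q] s by auto
        then have "0 \<le> snd (flow s q)" using X_iff[of "fst (flow s q)" "snd (flow s q)"] by simp
        moreover have "\<bar>fst (flow s p) - fst (flow s q)\<bar> < 1 / real N"
          if "\<lfloor>real N * fst (flow s p)\<rfloor> = \<lfloor>real N * fst (flow s q)\<rfloor>"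
        proof -
          have "\<bar>real N * fst (flow s p) - real N * fst (flow s q)\<bar> < 1" using that by linarith
          then have "real N * \<bar>fst (flow s p) - fst (flow s q)\<bar> < 1"
            by (simp add: abs_mult flip: right_diff_distrib)
          then show ?thesis using N by (simp add: field_simps)
        qed
        moreover have "\<bar>snd (flow s p) - snd (flow s q)\<bar> < 1" if "\<lfloor>snd (flow s p)\<rfloor> = \<lfloor>snd (flow s q)\<rfloor>"
          using that by linarith
        ultimately show "s \<in> S1 \<union> (S2 \<union> S3)"
          using s(1) by (auto simp: S1_def S2_def S3_def cusp_def W_def col_def abs_minus_commute split: if_splits)
      qed
      have fms: "S1 \<in> lmeasurable" "S2 \<in> lmeasurable" "S3 \<in> lmeasurable"
        by (intro lmeasurable_borel_subset_Icc[where r = r] 1 2 3; auto simp: S1_def S2_def S3_def)+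
      have "measure lebesgue S \<le> measure lebesgue (S1 \<union> (S2 \<union> S3))"
        using sub fms agreement_measurable[OF name_in_word_space[OF p(1)] name_in_word_space[OF q]]
        unfolding S_def by (intro measure_mono_fmeasurable) auto
      also have "\<dots> \<le> measure lebesgue S1 + (measure lebesgue S2 + measure lebesgue S3)"
        using fms by (meson measure_Un_le add_left_mono order.trans fmeasurableD sets.Un)
      finally have "measure lebesgue S \<le> measure lborel S1 + measure lborel S2 + measure lborel S3"
        using 1 2 3 by (simp add: measure_def)
      moreover have "measure lborel S1 \<le> r / 4" using p by (auto simp: B_def S1_def)
      moreover have "measure lborel S2 \<le> r / 4" using few[OF p(1) q r0] by (simp add: S2_def \<delta>_def)
      moreover have "3/4 * r < measure lebesgue S"
        using d r0 by (simp add: hamming_dist_def S_def field_simps)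
      ultimately have "1/4 * r < measure lborel S3" by linarith
      then show ?thesis using q by (simp add: Q_def S3_def)
    qed
    define U where "U w = {p \<in> X. hamming_dist r w (name r p) < \<epsilon>} - B" for w
    have Us: "U w \<in> sets M" if "w \<in> C" for w
      unfolding U_def using that C Bs by (intro sets.Diff ball_vimage_sets) auto
    have U: "measure M (U w) \<le> D * \<delta>" if w: "w \<in> C" for w
    proof (cases "U w = {}")
      case True
      then show ?thesis using D \<delta> by simp
    next
      case False
      then obtain p where p: "p \<in> U w" by blast
      then have pX: "p \<in> X" by (simp add: U_def)
      have "U w \<subseteq> Q p"
      proof
        fix q assume q: "q \<in> U w"
        have "hamming_dist r (name r p) (name r q) \<le> hamming_dist r (name r p) w + hamming_dist r w (name r q)"
        proof (rule hamming_dist_triangle[OF _ _ _ r0])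
          show "name r p \<in> word_space k r" "name r q \<in> word_space k r"
            using p q by (auto simp: U_def simp del: split_paired_All intro!: name_in_word_space)
          show "w \<in> word_space k r" using w C by auto
        qed
        also have "\<dots> < 1/4" using p q \<epsilon>(2) hamming_dist_sym[of r w "name r p"] by (simp add: U_def)
        finally show "q \<in> Q p" using p q by (intro close) (auto simp: U_def)
      qed
      then have "measure M (U w) \<le> measure M (Q p)" by (intro M.finite_measure_mono Qs pX)
      then show ?thesis using Qs(2)[OF pX] by linarith
    qed
    have "measure M {p \<in> X. \<exists>w\<in>C. hamming_dist r w (name r p) < \<epsilon>} \<le> measure M (B \<union> (\<Union>w\<in>C. U w))"
      using C Us Bs by (intro M.finite_measure_mono sets.Un sets.finite_UN) (auto simp: U_def)
    also have "\<dots> \<le> measure M B + measure M (\<Union>w\<in>C. U w)"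
      using C Us Bs by (intro measure_Un_le sets.finite_UN) auto
    finally have split: "measure M {p \<in> X. \<exists>w\<in>C. hamming_dist r w (name r p) < \<epsilon>} \<le> measure M B + measure M (\<Union>w\<in>C. U w)" .
    have "measure M (\<Union>w\<in>C. U w) \<le> (\<Sum>w\<in>C. measure M (U w))"
      using C Us by (intro measure_UNION_le) auto
    also have "\<dots> \<le> (\<Sum>w\<in>C. D * \<delta>)" using U by (intro sum_mono) auto
    finally have "measure M {p \<in> X. \<exists>w\<in>C. hamming_dist r w (name r p) < \<epsilon>} \<le> measure M B + real (card C) * (D * \<delta>)"
      using split by simp
    then have "\<beta> / 2 \<le> real (card C) * (D * \<delta>)" using B big \<epsilon>(3) by linarith
    then have "\<beta> / (2 * D) * (1 / \<delta>) \<le> real (card C)" using D \<delta> by (simp add: field_simps)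
    moreover have "r powr t \<le> 1 / \<delta>"
    proof -
      have "r powr t \<le> r powr ((1 + \<gamma>) / (1 + 12 * e))" using te r by (intro powr_mono) auto
      also have "\<dots> = 1 / \<delta>" by (simp add: \<delta>_def powr_minus_divide)
      finally show ?thesis .
    qed
    then have "\<beta> / (2 * D) * r powr t \<le> \<beta> / (2 * D) * (1 / \<delta>)" using D \<beta> by (intro mult_left_mono) auto
    ultimately have "\<beta> / (2 * D) * r powr t \<le> real (card C)" by linarith
    then have "ennreal (\<beta> / (2 * D) * r powr t) \<le> ennreal (real (card C))" by (rule ennreal_leI)
    then show "ennreal (\<beta> / (2 * D) * r powr t) \<le> of_nat (card C)" by (simp only: ennreal_of_nat_eq_real_of_nat)
  qed
  have "0 < ennreal (\<beta> / (2 * D))" using \<beta> D by simp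
  also have "\<dots> \<le> Liminf at_top (\<lambda>r. cov r \<epsilon> \<beta> / ennreal (real (nat \<lfloor>r\<rfloor>) powr t))"
  proof (rule Liminf_bounded)
    show "\<forall>\<^sub>F r in at_top. ennreal (\<beta> / (2 * D)) \<le> cov r \<epsilon> \<beta> / ennreal (real (nat \<lfloor>r\<rfloor>) powr t)"
      using eventually_ge_at_top[of 1]
    proof eventually_elim
      case (elim r)
      define n where "n = real (nat \<lfloor>r\<rfloor>)"
      have "n = of_int \<lfloor>r\<rfloor>" using elim by (simp add: n_def)
      then have n: "1 \<le> n" "n \<le> r" using elim by (simp_all add: le_floor_iff)
      have np: "0 < n powr t" using n by simp
      have "n powr t \<le> r powr t" using n t by (intro powr_mono2) auto
      then have "\<beta> / (2 * D) * n powr t \<le> \<beta> / (2 * D) * r powr t" using \<beta> D by (intro mult_left_mono) auto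
      then have "\<beta> / (2 * D) \<le> (\<beta> / (2 * D) * r powr t) / n powr t" using np by (subst pos_le_divide_eq) auto
      then have "ennreal (\<beta> / (2 * D)) \<le> ennreal ((\<beta> / (2 * D) * r powr t) / n powr t)" by (rule ennreal_leI)
      also have "\<dots> = ennreal (\<beta> / (2 * D) * r powr t) / ennreal (n powr t)"
        using \<beta> D np by (intro divide_ennreal[symmetric]) auto
      also have "\<dots> \<le> cov r \<epsilon> \<beta> / ennreal (n powr t)"
        using cov_ge[OF elim] by (rule divide_right_mono_ennreal)
      finally show ?case by (simp add: n_def)
    qed
  qed
  finally have "ennreal t \<le> growth \<epsilon> \<beta>"
    unfolding growth_exponent_def using t by (intro Sup_upper) auto
  also have "\<dots> \<le> partition_entropy (\<lambda>n t. real n powr t) M (special_flow \<alpha> f) k P \<beta>"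
    unfolding partition_entropy_eq using \<epsilon> by (intro SUP_upper) auto
  also have "\<dots> \<le> slow_entropy (\<lambda>n t. real n powr t) \<beta> M (special_flow \<alpha> f)"
    unfolding slow_entropy_def using part by (intro SUP_upper2[of "(k, P)"]) auto
  finally show ?thesis .
qed

theorem slow_entropy_ge:
  assumes "0 < \<beta>" "\<beta> \<le> 1"
  shows "ennreal (1 + \<gamma>) \<le> slow_entropy (\<lambda>n t. real n powr t) \<beta> M (special_flow \<alpha> f)"
proof (rule dense_le)
  fix y assume y: "y < ennreal (1 + \<gamma>)"
  then obtain s where s: "y = ennreal s" "0 \<le> s" by (cases y) auto
  then have "s < 1 + \<gamma>" using y unfolding s(1) by (subst (asm) ennreal_less_iff) (use s in auto)
  then have "max s (1/2) < 1 + \<gamma>" "0 < max s (1/2)" using \<gamma> by auto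
  then have "ennreal (max s (1/2)) \<le> slow_entropy (\<lambda>n t. real n powr t) \<beta> M (special_flow \<alpha> f)"
    using slow_entropy_ge_exponent[OF assms] by blast
  moreover have "y \<le> ennreal (max s (1/2))" unfolding s by (rule ennreal_leI) simp
  ultimately show "y \<le> slow_entropy (\<lambda>n t. real n powr t) \<beta> M (special_flow \<alpha> f)" by (rule order.trans[rotated])
qed

end

section \<open>The upper bound\<close>

text \<open>
  The integer parts of \<open>y i / \<sigma>\<close> are distinct and positive, which compares the sum with a convergent series.
\<close>

lemma sum_separated_powr_le:
  fixes y :: "'i \<Rightarrow> real"
  assumes I: "finite I" and \<sigma>: "0 < \<sigma>" and \<gamma>: "0 < \<gamma>"
    and ge: "\<And>i. i \<in> I \<Longrightarrow> \<sigma> \<le> y i"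
    and sep: "\<And>i j. i \<in> I \<Longrightarrow> j \<in> I \<Longrightarrow> i \<noteq> j \<Longrightarrow> \<sigma> \<le> \<bar>y i - y j\<bar>"
  shows "(\<Sum>i\<in>I. y i powr - (1 + \<gamma>)) \<le> (\<Sum>n. real n powr - (1 + \<gamma>)) * \<sigma> powr - (1 + \<gamma>)"
proof -
  define b where "b i = nat \<lfloor>y i / \<sigma>\<rfloor>" for i
  have b: "1 \<le> real (b i)" "real (b i) \<le> y i / \<sigma>" "y i / \<sigma> < real (b i) + 1" if "i \<in> I" for i
  proof -
    have "1 \<le> y i / \<sigma>" using ge[OF that] \<sigma> by simp
    then have "1 \<le> \<lfloor>y i / \<sigma>\<rfloor>" by simp
    then show "1 \<le> real (b i)" "real (b i) \<le> y i / \<sigma>" "y i / \<sigma> < real (b i) + 1"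
      unfolding b_def by (simp_all add: of_nat_nat)
  qed
  have inj: "inj_on b I"
  proof (rule inj_onI, rule ccontr)
    fix i j assume ij: "i \<in> I" "j \<in> I" "b i = b j" "i \<noteq> j"
    have "\<sigma> / \<sigma> \<le> \<bar>y i - y j\<bar> / \<sigma>" using sep[OF ij(1,2,4)] \<sigma> by (intro divide_right_mono) auto
    also have "\<dots> = \<bar>y i / \<sigma> - y j / \<sigma>\<bar>" using \<sigma> by (simp add: diff_divide_distrib[symmetric] abs_divide)
    also have "\<dots> < 1" using b(2,3)[OF ij(1)] b(2,3)[OF ij(2)] ij(3) by (simp add: abs_less_iff)
    finally show False using \<sigma> by simp
  qed
  have summ: "summable (\<lambda>n. real n powr - (1 + \<gamma>))" using \<gamma> by (subst summable_real_powr_iff) auto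
  have "(\<Sum>i\<in>I. y i powr - (1 + \<gamma>)) \<le> (\<Sum>i\<in>I. real (b i) powr - (1 + \<gamma>) * \<sigma> powr - (1 + \<gamma>))"
  proof (intro sum_mono)
    fix i assume i: "i \<in> I"
    have "real (b i) * \<sigma> \<le> y i" using b(2)[OF i] \<sigma> by (simp add: field_simps)
    then have "y i powr - (1 + \<gamma>) \<le> (real (b i) * \<sigma>) powr - (1 + \<gamma>)"
      using b(1)[OF i] \<sigma> \<gamma> by (intro powr_mono2') auto
    also have "\<dots> = real (b i) powr - (1 + \<gamma>) * \<sigma> powr - (1 + \<gamma>)" using \<sigma> by (simp add: powr_mult)
    finally show "y i powr - (1 + \<gamma>) \<le> real (b i) powr - (1 + \<gamma>) * \<sigma> powr - (1 + \<gamma>)" .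
  qed
  also have "\<dots> = (\<Sum>n\<in>b ` I. real n powr - (1 + \<gamma>)) * \<sigma> powr - (1 + \<gamma>)"
    by (simp add: sum.reindex[OF inj] sum_distrib_right)
  also have "\<dots> \<le> (\<Sum>n. real n powr - (1 + \<gamma>)) * \<sigma> powr - (1 + \<gamma>)"
    using I summ by (intro mult_right_mono sum_le_suminf) auto
  finally show ?thesis .
qed

context kochergin
begin

text \<open>
  The zeta value at \<open>1 + \<gamma>\<close>: the summand for \<open>n = 0\<close> vanishes because \<open>0 powr s = 0\<close>.
\<close>

definition zeta :: real where "zeta = (\<Sum>n. real n powr - (1 + \<gamma>))"

lemma zeta_ge_1: "1 \<le> zeta"
proof -
  have summ: "summable (\<lambda>n. real n powr - (1 + \<gamma>))" using \<gamma> by (subst summable_real_powr_iff) auto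
  have "(\<Sum>n\<in>{1}. real n powr - (1 + \<gamma>)) \<le> zeta"
    unfolding zeta_def using summ by (intro sum_le_suminf) auto
  then show ?thesis by simp
qed

definition remote :: "nat \<Rightarrow> real \<Rightarrow> real \<Rightarrow> bool" where
  "remote n \<sigma> x \<longleftrightarrow> (\<forall>i<n. 2 * \<sigma> \<le> frac (x + real i * \<alpha>) \<and> frac (x + real i * \<alpha>) \<le> 1 - 2 * \<sigma>)"

lemma remote_shift:
  assumes "remote n \<sigma> x" "i < n" "\<bar>d\<bar> \<le> \<sigma>" "0 < \<sigma>"
  shows "frac (x + d + real i * \<alpha>) = frac (x + real i * \<alpha>) + d"
proof -
  have b: "2 * \<sigma> \<le> frac (x + real i * \<alpha>)" "frac (x + real i * \<alpha>) \<le> 1 - 2 * \<sigma>"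
    using assms by (auto simp: remote_def)
  have "frac (frac (x + real i * \<alpha>) + d) = frac (x + real i * \<alpha>) + d"
    using b assms by (intro frac_unique_iff[THEN iffD2]) auto
  moreover have "x + d + real i * \<alpha> = (frac (x + real i * \<alpha>) + d) + of_int \<lfloor>x + real i * \<alpha>\<rfloor>" by (simp add: frac_def)
  ultimately show ?thesis by (metis frac_add_of_int)
qed

text \<open>
  Near the points of a remote orbit the derivative of the roof is controlled by the distance to the
  singularity, and the separation of the orbit makes the sum over the orbit comparable to its largest term.
\<close>

lemma bsum_close:
  assumes rem: "remote n \<sigma> x" and \<sigma>: "0 < \<sigma>" and d: "\<bar>d\<bar> \<le> \<sigma>"
    and sep: "\<And>i j. i < n \<Longrightarrow> j < n \<Longrightarrow> i \<noteq> j \<Longrightarrow> \<sigma> \<le> \<bar>frac (x + real i * \<alpha>) - frac (x + real j * \<alpha>)\<bar>"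
    and m: "m \<le> n"
  shows "\<bar>bsum m (x + d) - bsum m x\<bar> \<le> \<bar>d\<bar> * (2 * Cf * zeta * \<sigma> powr - (1 + \<gamma>))"
proof -
  define z where "z i = frac (x + real i * \<alpha>)" for i
  have z: "2 * \<sigma> \<le> z i" "z i \<le> 1 - 2 * \<sigma>" if "i < n" for i using rem that by (auto simp: remote_def z_def)
  have step: "\<bar>f (z i + d) - f (z i)\<bar> \<le> \<bar>d\<bar> * (Cf * ((z i - \<sigma>) powr - (1 + \<gamma>) + (1 - z i - \<sigma>) powr - (1 + \<gamma>)))"
    if i: "i < n" for i
  proof -
    let ?B = "Cf * ((z i - \<sigma>) powr - (1 + \<gamma>) + (1 - z i - \<sigma>) powr - (1 + \<gamma>))"
    have "norm (f (z i + d) - f (z i)) \<le> ?B * norm (z i + d - z i)"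
    proof (rule field_differentiable_bound[of "{z i - \<sigma>..z i + \<sigma>}" f f'])
      fix y assume y: "y \<in> {z i - \<sigma>..z i + \<sigma>}"
      then have y01: "0 < y" "y < 1" using z[OF i] \<sigma> by auto
      show "(f has_field_derivative f' y) (at y within {z i - \<sigma>..z i + \<sigma>})"
        using roof_deriv(1)[OF y01] by (rule has_field_derivative_at_within)
      have "\<bar>f' y\<bar> \<le> Cf * (y powr - (1 + \<gamma>) + (1 - y) powr - (1 + \<gamma>))" by (rule roof_deriv(5)[OF y01])
      also have "\<dots> \<le> ?B"
        using y z[OF i] \<sigma> \<gamma> Cf by (intro mult_left_mono add_mono powr_mono2') auto
      finally show "norm (f' y) \<le> ?B" by simp
    qed (use d in auto)
    then show ?thesis by (simp add: mult.commute)
  qed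
  have sum1: "(\<Sum>i<m. (z i - \<sigma>) powr - (1 + \<gamma>)) \<le> zeta * \<sigma> powr - (1 + \<gamma>)"
    unfolding zeta_def
  proof (rule sum_separated_powr_le[OF _ \<sigma> \<gamma>(1)])
    show "\<sigma> \<le> \<bar>z i - \<sigma> - (z j - \<sigma>)\<bar>" if "i \<in> {..<m}" "j \<in> {..<m}" "i \<noteq> j" for i j
      using sep[of i j] that m by (simp add: z_def)
  qed (use z m in force)+
  have sum2: "(\<Sum>i<m. (1 - z i - \<sigma>) powr - (1 + \<gamma>)) \<le> zeta * \<sigma> powr - (1 + \<gamma>)"
    unfolding zeta_def
  proof (rule sum_separated_powr_le[OF _ \<sigma> \<gamma>(1)])
    show "\<sigma> \<le> \<bar>1 - z i - \<sigma> - (1 - z j - \<sigma>)\<bar>" if "i \<in> {..<m}" "j \<in> {..<m}" "i \<noteq> j" for i j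
      using sep[of i j] that m by (simp add: z_def abs_minus_commute)
    show "\<sigma> \<le> 1 - z i - \<sigma>" if "i \<in> {..<m}" for i
      using z(2)[of i] that m by simp
  qed simp
  have "bsum m (x + d) - bsum m x = (\<Sum>i<m. f (z i + d) - f (z i))"
    using m d \<sigma> remote_shift[OF rem] by (simp add: bsum_def sum_subtractf z_def)
  then have "\<bar>bsum m (x + d) - bsum m x\<bar> \<le> (\<Sum>i<m. \<bar>f (z i + d) - f (z i)\<bar>)" by (simp add: sum_abs)
  also have "\<dots> \<le> (\<Sum>i<m. \<bar>d\<bar> * (Cf * ((z i - \<sigma>) powr - (1 + \<gamma>) + (1 - z i - \<sigma>) powr - (1 + \<gamma>))))"
    using step m by (intro sum_mono) auto
  also have "\<dots> = \<bar>d\<bar> * (Cf * ((\<Sum>i<m. (z i - \<sigma>) powr - (1 + \<gamma>)) + (\<Sum>i<m. (1 - z i - \<sigma>) powr - (1 + \<gamma>))))"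
    by (simp only: sum_distrib_left[symmetric] sum.distrib)
  also have "\<dots> \<le> \<bar>d\<bar> * (Cf * (zeta * \<sigma> powr - (1 + \<gamma>) + zeta * \<sigma> powr - (1 + \<gamma>)))"
    using sum1 sum2 Cf by (intro mult_left_mono add_mono) auto
  also have "\<dots> = \<bar>d\<bar> * (2 * Cf * zeta * \<sigma> powr - (1 + \<gamma>))" by (simp add: mult_ac)
  finally show ?thesis .
qed

lemma steps_le:
  assumes "p \<in> X" "0 \<le> t"
  shows "cf * real (steps t p) \<le> snd p + t"
proof -
  obtain x s where p: "p = (x, s)" by fastforce
  then have "regular x" using assms X_iff by auto
  then show ?thesis using bsum_ge[of x "steps t p" 0] steps_props(1)[of x s t] assms p by simp
qed

text \<open>
  Two orbits that start close to each other have made different numbers of steps only while the first one is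
  within \<open>2 * \<tau>\<close> of a crossing of the roof.
\<close>

lemma measure_steps_differ_le:
  assumes pq: "(x, s) \<in> X" "(y, s') \<in> X" and ss: "\<bar>s - s'\<bar> \<le> \<tau>" and \<tau>: "0 \<le> \<tau>"
    and n: "\<And>t. t \<in> {0..r} \<Longrightarrow> Suc (steps t (x, s)) \<le> n" "\<And>t. t \<in> {0..r} \<Longrightarrow> Suc (steps t (y, s')) \<le> n"
    and close: "\<And>m. m \<le> n \<Longrightarrow> \<bar>bsum m x - bsum m y\<bar> \<le> \<tau>"
  shows "measure lborel {t \<in> {0..r}. steps t (x, s) \<noteq> steps t (y, s')} \<le> 4 * \<tau> * (real n + 1)"
proof -
  have reg: "regular x" "regular y" using pq X_iff by auto
  let ?D = "{t \<in> {0..r}. steps t (x, s) \<noteq> steps t (y, s')}"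
  let ?I = "\<lambda>m. {bsum m x - s - 2 * \<tau>..bsum m x - s + 2 * \<tau>}"
  have "?D \<subseteq> (\<Union>m\<in>{..n}. ?I m)"
  proof
    fix t assume t: "t \<in> ?D"
    define a b where "a = steps t (x, s)" and "b = steps t (y, s')"
    have ab: "a \<noteq> b" "Suc a \<le> n" "Suc b \<le> n" using t n by (auto simp: a_def b_def)
    have t0: "0 \<le> t" using t by simp
    note A = steps_props[OF pq(1) t0, folded a_def] and B = steps_props[OF pq(2) t0, folded b_def]
    consider "a < b" | "b < a" using ab by linarith
    then show "t \<in> (\<Union>m\<in>{..n}. ?I m)"
    proof cases
      case 1
      then have "bsum (Suc a) y \<le> bsum b y" by (intro bsum_mono reg) simp
      then have "t \<in> ?I (Suc a)" using A B close[OF ab(2)] ss by (simp add: abs_le_iff)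
      then show ?thesis using ab by blast
    next
      case 2
      then have "bsum (Suc b) y \<le> bsum a y" by (intro bsum_mono reg) simp
      moreover have "\<bar>bsum a x - bsum a y\<bar> \<le> \<tau>" using ab by (intro close) simp
      ultimately have "t \<in> ?I a" using A B ss by (simp add: abs_le_iff)
      then show ?thesis using ab by (intro UN_I[of a]) auto
    qed
  qed
  moreover have "(\<Union>m\<in>{..n}. ?I m) \<in> fmeasurable lborel"
    by (intro fmeasurable.finite_UN) (auto intro: fmeasurable_lborel_Icc)
  moreover have "?D \<in> sets lborel"
  proof -
    have "{t \<in> space borel. t \<in> {0..r} \<and> real (steps t (x, s)) \<noteq> real (steps t (y, s'))} \<in> sets borel" by measurable
    then show ?thesis by simp
  qed
  ultimately have "measure lborel ?D \<le> measure lborel (\<Union>m\<in>{..n}. ?I m)" by (intro measure_mono_fmeasurable)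
  also have "\<dots> \<le> (\<Sum>m\<in>{..n}. measure lborel (?I m))" by (intro measure_UNION_le) auto
  also have "\<dots> = 4 * \<tau> * (real n + 1)" using \<tau> by simp
  finally show ?thesis .
qed

lemma remote_failure_measure_le:
  assumes "0 < \<sigma>" "0 < H"
  shows "{p \<in> X. snd p < H \<and> \<not> remote n \<sigma> (fst p)} \<in> sets M"
    "measure M {p \<in> X. snd p < H \<and> \<not> remote n \<sigma> (fst p)} \<le> 4 * \<sigma> * H / area * real n"
proof -
  have remm: "{p \<in> space borel. p \<in> X \<and> snd p < H \<and> \<not> (\<forall>i<n. 2 * \<sigma> \<le> frac (fst p + real i * \<alpha>) \<and> frac (fst p + real i * \<alpha>) \<le> 1 - 2 * \<sigma>)} \<in> sets borel"
    by measurable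
  then show S: "{p \<in> X. snd p < H \<and> \<not> remote n \<sigma> (fst p)} \<in> sets M"
    by (auto simp: sets_M remote_def)
  define B where "B = ({0..2 * \<sigma>} \<union> {1 - 2 * \<sigma>..1}) \<times> {0..H}"
  have B: "B \<in> sets borel" unfolding B_def by (intro borel_closed closed_Times closed_Un closed_atLeastAtMost)
  have eB: "emeasure lborel B \<le> ennreal (4 * \<sigma> * H)"
  proof -
    have "emeasure lborel B = emeasure lborel ({0..2 * \<sigma>} \<union> {1 - 2 * \<sigma>..1}) * emeasure lborel {0..H}"
      unfolding B_def by (intro emeasure_lborel_Times) auto
    also have "\<dots> \<le> (emeasure lborel {0..2 * \<sigma>} + emeasure lborel {1 - 2 * \<sigma>..1}) * emeasure lborel {0..H}"
      by (intro mult_right_mono emeasure_subadditive) auto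
    also have "emeasure lborel {0..2 * \<sigma>} = ennreal (2 * \<sigma>)" using assms by (subst emeasure_lborel_Icc) auto
    also have "emeasure lborel {1 - 2 * \<sigma>..1} = ennreal (2 * \<sigma>)" using assms by (subst emeasure_lborel_Icc) auto
    also have "emeasure lborel {0..H} = ennreal H" using assms by (subst emeasure_lborel_Icc) auto
    also have "ennreal (2 * \<sigma>) + ennreal (2 * \<sigma>) = ennreal (4 * \<sigma>)"
      using assms by (subst ennreal_plus[symmetric]) auto
    also have "ennreal (4 * \<sigma>) * ennreal H = ennreal (4 * \<sigma> * H)"
      using assms by (intro ennreal_mult[symmetric]) auto
    finally show ?thesis .
  qed
  define Y where "Y i = {p. fst p \<in> {0..<1} \<and> (frac (fst p + real i * \<alpha>), snd p + 0) \<in> B}" for i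
  have Y: "emeasure lborel (Y i) \<le> ennreal (4 * \<sigma> * H)" for i
    unfolding Y_def using emeasure_skew_rotation_vimage_le[OF B, of "\<lambda>_. 0"] eB by (auto intro: order.trans)
  have Ym: "Y i \<in> sets borel" for i
  proof -
    have [measurable]: "B \<in> sets borel" by (rule B)
    have "{p \<in> space borel. fst p \<in> {0..<1} \<and> (frac (fst p + real i * \<alpha>), snd p + 0) \<in> B} \<in> sets borel" by measurable
    then show ?thesis by (simp add: Y_def)
  qed
  have "{p \<in> X. snd p < H \<and> \<not> remote n \<sigma> (fst p)} \<subseteq> (\<Union>i<n. Y i)"
  proof
    fix p assume p: "p \<in> {p \<in> X. snd p < H \<and> \<not> remote n \<sigma> (fst p)}"
    then obtain i where i: "i < n" "\<not> (2 * \<sigma> \<le> frac (fst p + real i * \<alpha>) \<and> frac (fst p + real i * \<alpha>) \<le> 1 - 2 * \<sigma>)"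
      by (auto simp: remote_def)
    have "0 \<le> fst p" "fst p < 1" "0 \<le> snd p" using p X_iff[of "fst p" "snd p"] by auto
    then have "p \<in> Y i" using i p frac_ge_0[of "fst p + real i * \<alpha>"] frac_lt_1[of "fst p + real i * \<alpha>"]
      by (auto simp: Y_def B_def)
    then show "p \<in> (\<Union>i<n. Y i)" using i by blast
  qed
  then have "emeasure lborel {p \<in> X. snd p < H \<and> \<not> remote n \<sigma> (fst p)} \<le> emeasure lborel (\<Union>i<n. Y i)"
    using Ym by (intro emeasure_mono sets.finite_UN) auto
  also have "\<dots> \<le> (\<Sum>i<n. emeasure lborel (Y i))" using Ym by (intro emeasure_subadditive_finite) auto
  also have "\<dots> \<le> (\<Sum>i<n. ennreal (4 * \<sigma> * H))" using Y by (intro sum_mono) auto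
  also have "\<dots> = ennreal (4 * \<sigma> * H * real n)" using assms by (simp add: ennreal_mult ennreal_of_nat_eq_real_of_nat mult.commute)
  finally have "measure M {p \<in> X. snd p < H \<and> \<not> remote n \<sigma> (fst p)} \<le> 4 * \<sigma> * H * real n / area"
    using assms by (intro measure_M_le[OF S]) auto
  then show "measure M {p \<in> X. snd p < H \<and> \<not> remote n \<sigma> (fst p)} \<le> 4 * \<sigma> * H / area * real n" by simp
qed

end

context kochergin_partition
begin

text \<open>
  Inner regularity, applied below a high level so that the closed sets obtained are compact.
\<close>

lemma separated_core:
  assumes \<eta>: "0 < \<eta>"
  obtains T d where "0 < d" "\<And>i. i \<in> {1..k} \<Longrightarrow> T i \<subseteq> P i" "(\<Union>i\<in>{1..k}. T i) \<in> sets borel"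
    "\<And>i j p q. i \<in> {1..k} \<Longrightarrow> j \<in> {1..k} \<Longrightarrow> i \<noteq> j \<Longrightarrow> p \<in> T i \<Longrightarrow> q \<in> T j \<Longrightarrow> d \<le> dist p q"
    "emeasure lborel (X - (\<Union>i\<in>{1..k}. T i)) \<le> ennreal (\<eta> * area)"
proof -
  obtain H where H: "0 < H" "{p \<in> X. H \<le> snd p} \<in> sets M"
    "emeasure lborel {p \<in> X. H \<le> snd p} \<le> ennreal (\<eta> / 2 * area)"
    using small_cusp[of "\<eta> / 2"] \<eta> by auto
  define \<zeta> where "\<zeta> = \<eta> * area / (2 * (real k + 1))"
  have \<zeta>: "0 < \<zeta>" using \<eta> area_pos by (simp add: \<zeta>_def)
  have low: "{p :: real \<times> real. snd p < H} \<in> sets borel"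
  proof -
    have "{p \<in> space borel. snd p < H} \<in> sets (borel :: (real \<times> real) measure)" by measurable
    then show ?thesis by simp
  qed
  have "\<forall>i\<in>{1..k}. \<exists>T. closed T \<and> T \<subseteq> P i \<inter> {p. snd p < H} \<and> emeasure lborel (P i \<inter> {p. snd p < H} - T) \<le> ennreal \<zeta>"
  proof
    fix i assume i: "i \<in> {1..k}"
    have S: "P i \<inter> {p. snd p < H} \<in> sets borel" using P_sets[OF i] low by auto
    then have "P i \<inter> {p. snd p < H} \<in> sets lebesgue" by simp
    from sets_lebesgue_inner_closed[OF this \<zeta>]
    obtain T where T: "closed T" "T \<subseteq> P i \<inter> {p. snd p < H}" "emeasure lebesgue (P i \<inter> {p. snd p < H} - T) < ennreal \<zeta>"
      by metis
    have "P i \<inter> {p. snd p < H} - T \<in> sets lborel" using S T(1) by auto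
    then have "emeasure lborel (P i \<inter> {p. snd p < H} - T) \<le> ennreal \<zeta>" using T(3) by simp
    then show "\<exists>T. closed T \<and> T \<subseteq> P i \<inter> {p. snd p < H} \<and> emeasure lborel (P i \<inter> {p. snd p < H} - T) \<le> ennreal \<zeta>"
      using T by blast
  qed
  from bchoice[OF this] obtain T where T:
    "\<forall>i\<in>{1..k}. closed (T i) \<and> T i \<subseteq> P i \<inter> {p. snd p < H} \<and> emeasure lborel (P i \<inter> {p. snd p < H} - T i) \<le> ennreal \<zeta>" ..
  have PX: "(\<Union>i\<in>{1..k}. P i) = X" using part by (auto simp: finite_measurable_partition_def partition_on_def)
  have comp: "compact (T i)" if i: "i \<in> {1..k}" for i
  proof -
    have "T i \<subseteq> {0..1} \<times> {0..H}"
    proof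
      fix p assume "p \<in> T i"
      then have "p \<in> P i" "snd p < H" using T i by auto
      then have "p \<in> X" using PX i by blast
      then show "p \<in> {0..1} \<times> {0..H}" using X_iff[of "fst p" "snd p"] \<open>snd p < H\<close> by (simp add: mem_Times_iff)
    qed
    moreover have "bounded ({0..1::real} \<times> {0..H})" by (intro bounded_Times) auto
    ultimately have "bounded (T i)" by (rule bounded_subset[rotated])
    then show ?thesis using T i by (simp add: compact_eq_bounded_closed)
  qed
  have disj: "P i \<inter> P j = {}" if "i \<in> {1..k}" "j \<in> {1..k}" "i \<noteq> j" for i j
  proof -
    have "P i \<noteq> P j" using part that by (auto simp: finite_measurable_partition_def dest: inj_onD)
    then show ?thesis using part that by (auto simp: finite_measurable_partition_def partition_on_def disjoint_def)
  qed
  have "\<forall>z\<in>{1..k} \<times> {1..k}. \<exists>d>0. fst z \<noteq> snd z \<longrightarrow> (\<forall>p\<in>T (fst z). \<forall>q\<in>T (snd z). d \<le> dist p q)"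
  proof
    fix z assume z: "z \<in> {1..k} \<times> {1..k}"
    show "\<exists>d>0. fst z \<noteq> snd z \<longrightarrow> (\<forall>p\<in>T (fst z). \<forall>q\<in>T (snd z). d \<le> dist p q)"
    proof (cases "fst z = snd z")
      case True
      then show ?thesis by (intro exI[of _ 1]) simp
    next
      case False
      have i: "fst z \<in> {1..k}" "snd z \<in> {1..k}" using z by auto
      then have "T (fst z) \<inter> T (snd z) = {}" using T disj[OF i False] by blast
      then obtain d where "0 < d" "\<forall>p\<in>T (fst z). \<forall>q\<in>T (snd z). d \<le> dist p q"
        using separate_compact_closed[OF comp[OF i(1)], of "T (snd z)"] T i by blast
      then show ?thesis by blast
    qed
  qed
  from bchoice[OF this] obtain \<Delta> where \<Delta>:
    "\<forall>z\<in>{1..k} \<times> {1..k}. 0 < \<Delta> z \<and> (fst z \<noteq> snd z \<longrightarrow> (\<forall>p\<in>T (fst z). \<forall>q\<in>T (snd z). \<Delta> z \<le> dist p q))" ..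
  define d where "d = Min (insert 1 (\<Delta> ` ({1..k} \<times> {1..k})))"
  have d: "0 < d" using \<Delta> by (auto simp: d_def)
  have dle: "d \<le> \<Delta> z" if "z \<in> {1..k} \<times> {1..k}" for z using that by (auto simp: d_def intro!: Min_le)
  show ?thesis
  proof (rule that[OF d])
    show "T i \<subseteq> P i" if "i \<in> {1..k}" for i using T that by blast
    show core: "(\<Union>i\<in>{1..k}. T i) \<in> sets borel" using T by (intro sets.finite_UN) auto
    show "d \<le> dist p q" if "i \<in> {1..k}" "j \<in> {1..k}" "i \<noteq> j" "p \<in> T i" "q \<in> T j" for i j p q
      using \<Delta> dle[of "(i, j)"] that by force
    have csb: "{p \<in> X. H \<le> snd p} \<in> sets borel" using H(2) sets_M by blast
    have sub: "X - (\<Union>i\<in>{1..k}. T i) \<subseteq> {p \<in> X. H \<le> snd p} \<union> (\<Union>i\<in>{1..k}. P i \<inter> {p. snd p < H} - T i)"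
      using PX by fastforce
    have Dm: "P i \<inter> {p. snd p < H} - T i \<in> sets borel" if "i \<in> {1..k}" for i
      using P_sets[OF that] low T that by auto
    have "emeasure lborel (X - (\<Union>i\<in>{1..k}. T i))
      \<le> emeasure lborel ({p \<in> X. H \<le> snd p} \<union> (\<Union>i\<in>{1..k}. P i \<inter> {p. snd p < H} - T i))"
      using sub Dm csb by (intro emeasure_mono) auto
    also have "\<dots> \<le> emeasure lborel {p \<in> X. H \<le> snd p} + emeasure lborel (\<Union>i\<in>{1..k}. P i \<inter> {p. snd p < H} - T i)"
      using Dm csb by (intro emeasure_subadditive) auto
    also have "\<dots> \<le> ennreal (\<eta> / 2 * area) + ennreal (\<eta> / 2 * area)"
    proof (intro add_mono H(3))
      have "emeasure lborel (\<Union>i\<in>{1..k}. P i \<inter> {p. snd p < H} - T i) \<le> (\<Sum>i\<in>{1..k}. emeasure lborel (P i \<inter> {p. snd p < H} - T i))"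
        using Dm by (intro emeasure_subadditive_finite) auto
      also have "\<dots> \<le> (\<Sum>i\<in>{1..k}. ennreal \<zeta>)" using T by (intro sum_mono) auto
      also have "\<dots> = ennreal (real k * \<zeta>)" using \<zeta> by (simp add: ennreal_mult ennreal_of_nat_eq_real_of_nat)
      also have "\<dots> \<le> ennreal (\<eta> / 2 * area)"
      proof (rule ennreal_leI)
        have "real k * \<zeta> \<le> (real k + 1) * \<zeta>" using \<zeta> by simp
        also have "\<dots> = \<eta> / 2 * area" by (simp add: \<zeta>_def divide_simps) 
        finally show "real k * \<zeta> \<le> \<eta> / 2 * area" .
      qed
      finally show "emeasure lborel (\<Union>i\<in>{1..k}. P i \<inter> {p. snd p < H} - T i) \<le> ennreal (\<eta> / 2 * area)" .
    qed
    also have "\<dots> = ennreal (\<eta> * area)" using \<eta> area_pos by (simp flip: ennreal_plus)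
    finally show "emeasure lborel (X - (\<Union>i\<in>{1..k}. T i)) \<le> ennreal (\<eta> * area)" .
  qed
qed

end

context kochergin_partition
begin

text \<open>
  The good points lie below \<open>H\<close>, have a remote orbit and spend little time outside the cores of the atoms.
  Good points in the same cell of width \<open>w\<close> and height \<open>\<tau>\<close> have orbits within \<open>3 * \<tau> < d\<close> of each other as long as
  they have made the same number of steps, and then they lie in the same core if both lie in cores.
  One name for each cell therefore suffices.
\<close>

lemma covering_number_upper:
  assumes \<epsilon>: "0 < \<epsilon>" "\<epsilon> \<le> 1" and \<beta>: "\<beta> \<le> 1" and \<kappa>: "0 < \<kappa>"
  obtains K r0 where "0 < K" "1 \<le> r0" "\<And>r. r0 \<le> r \<Longrightarrow> cov r \<epsilon> \<beta> \<le> ennreal (K * r powr ((1 + \<gamma>) * (1 + \<kappa>)))"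
proof -
  obtain c where c: "0 < c" "c \<le> 1"
    "\<And>(i::nat) (j::int). 0 < i \<Longrightarrow> c * real i powr (- (1 + \<kappa>)) \<le> \<bar>real i * \<alpha> - of_int j\<bar>"
    using diophantine_lower_bound[OF dio \<kappa>] by metis
  have \<eta>: "0 < \<epsilon>\<^sup>2 / 32" using \<epsilon> by simp
  obtain T d where d: "0 < d" and TP: "\<And>i. i \<in> {1..k} \<Longrightarrow> T i \<subseteq> P i"
    and core: "(\<Union>i\<in>{1..k}. T i) \<in> sets borel"
    and far: "\<And>i j p q. i \<in> {1..k} \<Longrightarrow> j \<in> {1..k} \<Longrightarrow> i \<noteq> j \<Longrightarrow> p \<in> T i \<Longrightarrow> q \<in> T j \<Longrightarrow> d \<le> dist p q"
    and rest: "emeasure lborel (X - (\<Union>i\<in>{1..k}. T i)) \<le> ennreal (\<epsilon>\<^sup>2 / 32 * area)"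
    by (rule separated_core[OF \<eta>]) (rule that)
  define core where "core = (\<Union>i\<in>{1..k}. T i)"
  have core_meas: "X - core \<in> sets borel" using core unfolding core_def by auto
  obtain H where H: "0 < H" "measure M {p \<in> X. H \<le> snd p} \<le> \<epsilon> / 8" and cs: "{p \<in> X. H \<le> snd p} \<in> sets M"
    using small_cusp[of "\<epsilon> / 8"] \<epsilon> by auto
  (* the second bound makes the time with different numbers of steps at most \<epsilon> / 8 * r *)
  define \<tau> where "\<tau> = min (d / 4) (\<epsilon> * cf / 256)"
  have \<tau>: "0 < \<tau>" "\<tau> \<le> d / 4" "\<tau> \<le> \<epsilon> * cf / 256" using d \<epsilon> cf by (auto simp: \<tau>_def)
  have Cz: "0 < 2 * Cf * zeta" using Cf zeta_ge_1 by simp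
  define a where "a = min (min 1 \<tau>) (\<tau> / (2 * Cf * zeta))"
  have a: "0 < a" "a \<le> 1" "a \<le> \<tau>" "a \<le> \<tau> / (2 * Cf * zeta)" using \<tau> Cz by (auto simp: a_def)
  have a_close: "a * (2 * Cf * zeta) \<le> \<tau>" using a(4) Cz by (simp add: pos_le_divide_eq)
  obtain r1 where r1: "1 \<le> r1" "\<And>r. r1 \<le> r \<Longrightarrow> 32 * c * H / (area * \<epsilon>) \<le> r powr \<kappa>"
    using powr_eventually_large[OF \<kappa>] by metis
  define K where "K = 2 * (H / \<tau> + 1) * (1 / a) * c powr - (1 + \<gamma>) * (4 / cf) powr ((1 + \<gamma>) * (1 + \<kappa>))"
  have "0 < H / \<tau> + 1" using H \<tau> by (intro add_pos_pos divide_pos_pos) auto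
  then have K: "0 < K" unfolding K_def using a c cf by (intro mult_pos_pos) auto
  show ?thesis
  proof (rule that[OF K, of "max r1 H"])
    show "1 \<le> max r1 H" using r1 by simp
    fix r assume "max r1 H \<le> r"
    then have r: "1 \<le> r" "H \<le> r" "r1 \<le> r" using r1 by auto
    then have r0: "0 < r" by simp
    (* an upper bound for the number of steps up to time r, as each step lasts at least cf *)
    define n where "n = nat \<lceil>2 * r / cf\<rceil> + 1"
    have rc: "r \<le> r / cf" using cf r by (simp add: pos_le_divide_eq)
    have n: "2 * r / cf \<le> real n - 1" "real n \<le> 4 / cf * r" "r \<le> real n"
    proof -
      have "2 * r / cf = 2 * (r / cf)" "4 / cf * r = 4 * (r / cf)" by simp_all
      then show "2 * r / cf \<le> real n - 1" "real n \<le> 4 / cf * r" "r \<le> real n"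
        using rc r unfolding n_def by linarith+
    qed
    have n1: "1 \<le> real n" using n r by linarith
    define \<sigma> where "\<sigma> = c * real n powr - (1 + \<kappa>)"
    have \<sigma>: "0 < \<sigma>" "\<sigma> \<le> 1"
    proof -
      show "0 < \<sigma>" using c n1 by (simp add: \<sigma>_def)
      have "real n powr - (1 + \<kappa>) \<le> real n powr 0" using n1 \<kappa> by (intro powr_mono) auto
      then have "c * real n powr - (1 + \<kappa>) \<le> 1 * 1" using c n1 by (intro mult_mono) auto
      then show "\<sigma> \<le> 1" by (simp add: \<sigma>_def)
    qed
    have sep: "\<sigma> \<le> \<bar>frac (x + real i * \<alpha>) - frac (x + real j * \<alpha>)\<bar>" if "i < n" "j < n" "i \<noteq> j" for x i j
      unfolding \<sigma>_def using that by (intro frac_diff_lower_bound[OF c(3) _ \<kappa> c(1)]) auto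
    define w where "w = a * \<sigma> powr (1 + \<gamma>)"
    have w: "0 < w" "w \<le> \<sigma>" "w \<le> 1" "w \<le> \<tau>"
    proof -
      have "\<sigma> powr (1 + \<gamma>) \<le> \<sigma> powr 1" using \<sigma> \<gamma> by (intro powr_mono') auto
      then have s: "\<sigma> powr (1 + \<gamma>) \<le> \<sigma>" using \<sigma> by simp
      show "0 < w" using a \<sigma> by (simp add: w_def)
      have "a * \<sigma> powr (1 + \<gamma>) \<le> 1 * \<sigma>" using a s \<sigma> by (intro mult_mono) auto
      then show ws: "w \<le> \<sigma>" by (simp add: w_def)
      then show "w \<le> 1" using \<sigma> by simp
      have "a * \<sigma> powr (1 + \<gamma>) \<le> \<tau> * 1" using a s \<sigma> \<tau> by (intro mult_mono) auto
      then show "w \<le> \<tau>" by (simp add: w_def)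
    qed
    define bad where "bad = {z :: real \<times> (real \<times> real). snd z \<in> X - core}"
    have bad: "bad \<in> sets borel"
    proof -
      have [measurable]: "X - core \<in> sets borel" by (rule core_meas)
      have "{z \<in> space borel. snd z \<in> X - core} \<in> sets (borel :: (real \<times> (real \<times> real)) measure)" by measurable
      then show ?thesis by (simp add: bad_def)
    qed
    define B where "B = {q \<in> X. \<epsilon> / 4 * r < measure lborel {t \<in> {0..r}. (t, flow t q) \<in> bad}}"
    have Bs: "B \<in> sets M" and B: "measure M B \<le> \<epsilon> / 8"
    proof -
      have "{p \<in> X. (t, p) \<in> bad} = X - core" for t by (auto simp: bad_def)
      then have small: "emeasure lborel {p \<in> X. (t, p) \<in> bad} \<le> ennreal (\<epsilon>\<^sup>2 / 32 * area)" for t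
        using rest by (simp add: core_def)
      have pos: "0 < \<epsilon> / 4" "0 \<le> \<epsilon>\<^sup>2 / 32 * area" using \<epsilon> area_pos by auto
      show "B \<in> sets M" unfolding B_def by (rule measure_long_stay_le(1)[OF bad r0 pos small])
      have "measure M B \<le> (\<epsilon>\<^sup>2 / 32 * area) / (\<epsilon> / 4 * area)"
        unfolding B_def by (rule measure_long_stay_le(2)[OF bad r0 pos small])
      also have "\<dots> = \<epsilon> / 8" using \<epsilon> area_pos by (simp add: power2_eq_square)
      finally show "measure M B \<le> \<epsilon> / 8" .
    qed
    define R where "R = {p \<in> X. snd p < H \<and> \<not> remote n \<sigma> (fst p)}"
    have Rs: "R \<in> sets M" and R: "measure M R \<le> \<epsilon> / 8"
    proof -
      show "R \<in> sets M" unfolding R_def by (rule remote_failure_measure_le[OF \<sigma>(1) H(1)])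
      have "measure M R \<le> 4 * \<sigma> * H / area * real n"
        unfolding R_def by (rule remote_failure_measure_le[OF \<sigma>(1) H(1)])
      also have "\<dots> = 4 * c * H / area * (real n * real n powr - (1 + \<kappa>))" by (simp add: \<sigma>_def)
      also have "real n * real n powr - (1 + \<kappa>) = real n powr - \<kappa>"
        using n1 powr_mult_base[of "real n" "- (1 + \<kappa>)"] by simp
      also have "4 * c * H / area * real n powr - \<kappa> \<le> \<epsilon> / 8"
      proof -
        have "32 * c * H / (area * \<epsilon>) \<le> real n powr \<kappa>" using r1(2)[of "real n"] n r by linarith
        then show ?thesis using n1 \<epsilon> area_pos unfolding powr_minus by (simp add: field_simps)
      qed
      finally show "measure M R \<le> \<epsilon> / 8" .
    qed
    define G where "G = X - ({p \<in> X. H \<le> snd p} \<union> (R \<union> B))"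
    have Gs: "G \<in> sets M" unfolding G_def using cs Rs Bs by (auto simp: sets_M)
    have G: "1 - \<epsilon> < measure M G"
    proof -
      have "measure M ({p \<in> X. H \<le> snd p} \<union> (R \<union> B)) \<le> measure M {p \<in> X. H \<le> snd p} + measure M (R \<union> B)"
        using cs Rs Bs by (intro measure_Un_le) auto
      also have "measure M (R \<union> B) \<le> measure M R + measure M B" using Rs Bs by (intro measure_Un_le) auto
      finally have "measure M ({p \<in> X. H \<le> snd p} \<union> (R \<union> B)) \<le> \<epsilon> / 8 + \<epsilon> / 8 + \<epsilon> / 8"
        using H(2) R B by simp
      moreover have "measure M G = 1 - measure M ({p \<in> X. H \<le> snd p} \<union> (R \<union> B))"
        using M.finite_measure_compl[of "{p \<in> X. H \<le> snd p} \<union> (R \<union> B)"] cs Rs Bs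
        by (simp add: G_def measure_M_X)
      ultimately show ?thesis using \<epsilon> by linarith
    qed
    define idx where "idx p = (\<lfloor>fst p / w\<rfloor>, \<lfloor>snd p / \<tau>\<rfloor>)" for p :: "real \<times> real"
    have GX: "p \<in> X" "snd p < H" "remote n \<sigma> (fst p)" "p \<notin> B" if "p \<in> G" for p
      using that by (auto simp: G_def R_def not_le)
    have steps_n: "Suc (steps t p) \<le> n" if "p \<in> G" "t \<in> {0..r}" for p t
    proof -
      have "cf * real (steps t p) \<le> 2 * r" using steps_le[of p t] GX[OF that(1)] that r by auto
      then have "real (steps t p) \<le> 2 * r / cf" using cf by (simp add: field_simps)
      then show ?thesis using n(1) by linarith
    qed
    have floor_close: "\<bar>u - v\<bar> < b" if "\<lfloor>u / b\<rfloor> = \<lfloor>v / b\<rfloor>" "0 < b" for u v b :: real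
    proof -
      have "\<bar>u / b - v / b\<bar> < 1" using that by linarith
      then have "\<bar>u - v\<bar> / b < 1" using that by (simp add: abs_divide flip: diff_divide_distrib)
      then show ?thesis using that by simp
    qed
    have close: "hamming_dist r (name r p) (name r q) < \<epsilon>" if pG: "p \<in> G" and qG: "q \<in> G" and eq: "idx p = idx q" for p q
    proof -
      obtain x s y s' where xy: "p = (x, s)" "q = (y, s')" by fastforce
      have dx: "\<bar>y - x\<bar> < w" using eq w floor_close[of y w x] by (auto simp: idx_def xy)
      have ds: "\<bar>s - s'\<bar> < \<tau>" using eq \<tau> floor_close[of s \<tau> s'] by (auto simp: idx_def xy)
      have rem: "remote n \<sigma> x" using GX(3)[OF pG] xy by simp
      have bs: "\<bar>bsum m x - bsum m y\<bar> \<le> \<tau>" if "m \<le> n" for m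
      proof -
        have "\<bar>bsum m (x + (y - x)) - bsum m x\<bar> \<le> \<bar>y - x\<bar> * (2 * Cf * zeta * \<sigma> powr - (1 + \<gamma>))"
          using dx w by (intro bsum_close[OF rem \<sigma>(1) _ sep that]) auto
        also have "\<dots> \<le> w * (2 * Cf * zeta * \<sigma> powr - (1 + \<gamma>))" using dx Cz by (intro mult_right_mono) auto
        also have "\<dots> = a * (2 * Cf * zeta) * (\<sigma> powr (1 + \<gamma>) * \<sigma> powr - (1 + \<gamma>))" by (simp add: w_def mult_ac)
        also have "\<sigma> powr (1 + \<gamma>) * \<sigma> powr - (1 + \<gamma>) = 1" using \<sigma> by (simp flip: powr_add)
        finally show ?thesis using a_close by (simp add: abs_minus_commute)
      qed
      define S where "S = {t \<in> {0..r}. name r p t = name r q t}"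
      define S1 where "S1 = {t \<in> {0..r}. (t, flow t p) \<in> bad}"
      define S2 where "S2 = {t \<in> {0..r}. (t, flow t q) \<in> bad}"
      define S3 where "S3 = {t \<in> {0..r}. steps t (x, s) \<noteq> steps t (y, s')}"
      have m3: "measure lborel S3 \<le> \<epsilon> / 8 * r"
      proof -
        have "measure lborel S3 \<le> 4 * \<tau> * (real n + 1)"
          unfolding S3_def
        proof (rule measure_steps_differ_le)
          show "Suc (steps t (x, s)) \<le> n" if "t \<in> {0..r}" for t using steps_n[OF pG that] by (simp add: xy)
          show "Suc (steps t (y, s')) \<le> n" if "t \<in> {0..r}" for t using steps_n[OF qG that] by (simp add: xy)
        qed (use GX(1)[OF pG] GX(1)[OF qG] xy ds \<tau> bs in auto)
        also have "\<dots> \<le> 4 * \<tau> * (2 * (4 / cf * r))" using n n1 \<tau> by (intro mult_left_mono) auto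
        also have "\<dots> = \<tau> * (32 / cf * r)" by simp
        also have "\<dots> \<le> (\<epsilon> * cf / 256) * (32 / cf * r)" using \<tau> cf r by (intro mult_right_mono) auto
        also have "\<dots> = \<epsilon> / 8 * r" using cf by simp
        finally show ?thesis .
      qed
      have [measurable]: "bad \<in> sets borel" by (rule bad)
      have "{t \<in> space borel. t \<in> {0..r} \<and> (t, flow t p) \<in> bad} \<in> sets borel" by measurable
      then have 1: "S1 \<in> sets borel" by (simp add: S1_def)
      have "{t \<in> space borel. t \<in> {0..r} \<and> (t, flow t q) \<in> bad} \<in> sets borel" by measurable
      then have 2: "S2 \<in> sets borel" by (simp add: S2_def)
      have 3: "S3 \<in> sets borel"
      proof -
        have "{t \<in> space borel. t \<in> {0..r} \<and> real (steps t (x, s)) \<noteq> real (steps t (y, s'))} \<in> sets borel" by measurable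
        then show ?thesis by (simp add: S3_def)
      qed
      have cover: "{0..r} \<subseteq> S \<union> (S1 \<union> (S2 \<union> S3))"
      proof
        fix t assume t: "t \<in> {0..r}"
        show "t \<in> S \<union> (S1 \<union> (S2 \<union> S3))"
        proof (rule ccontr)
          assume no: "\<not> ?thesis"
          have fl: "flow t p \<in> X" "flow t q \<in> X" using flow_in_X GX(1) pG qG t by auto
          have st: "steps t p = steps t q" using no t by (auto simp: S3_def xy)
          have "flow t p \<in> core" "flow t q \<in> core" using no t fl by (auto simp: S1_def S2_def bad_def)
          then obtain i j where ij: "i \<in> {1..k}" "flow t p \<in> T i" "j \<in> {1..k}" "flow t q \<in> T j"
            by (auto simp: core_def)
          have "i \<noteq> j"
          proof
            assume "i = j"
            then have "name r p t = i" "name r q t = i"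
              using name_iff(1)[OF GX(1)[OF pG] t ij(1)] name_iff(1)[OF GX(1)[OF qG] t ij(1)] TP[OF ij(1)] ij by auto
            then show False using no t by (auto simp: S_def)
          qed
          then have "d \<le> dist (flow t p) (flow t q)" using far ij by blast
          also have "\<dots> \<le> \<bar>fst (flow t p) - fst (flow t q)\<bar> + \<bar>snd (flow t p) - snd (flow t q)\<bar>"
            using sqrt_sum_squares_le_sum_abs[of "fst (flow t p) - fst (flow t q)" "snd (flow t p) - snd (flow t q)"]
            by (simp add: dist_prod_def dist_real_def)
          finally have "d \<le> \<bar>fst (flow t p) - fst (flow t q)\<bar> + \<bar>snd (flow t p) - snd (flow t q)\<bar>" .
          moreover have "\<bar>fst (flow t p) - fst (flow t q)\<bar> \<le> \<tau>"
          proof -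
            have "frac (x + (y - x) + real (steps t p) * \<alpha>) = frac (x + real (steps t p) * \<alpha>) + (y - x)"
              using steps_n[OF pG t] dx w \<sigma> by (intro remote_shift[OF rem]) auto
            then have "fst (flow t q) = fst (flow t p) + (y - x)"
              using st by (simp add: xy flow_eqs)
            then show ?thesis using dx w by simp
          qed
          moreover have "\<bar>snd (flow t p) - snd (flow t q)\<bar> \<le> 2 * \<tau>"
          proof -
            have "\<bar>bsum (steps t p) x - bsum (steps t p) y\<bar> \<le> \<tau>" using steps_n[OF pG t] by (intro bs) simp
            moreover have "snd (flow t p) - snd (flow t q) = (s - s') - (bsum (steps t p) x - bsum (steps t p) y)"
              using st by (simp add: xy flow_eqs)
            ultimately show ?thesis using ds by linarith
          qed
          ultimately show False using \<tau> d by linarith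
        qed
      qed
      have fms: "S1 \<in> lmeasurable" "S2 \<in> lmeasurable" "S3 \<in> lmeasurable"
        by (intro lmeasurable_borel_subset_Icc[where r = r] 1 2 3; auto simp: S1_def S2_def S3_def)+
      have Sm: "S \<in> lmeasurable"
        unfolding S_def
        by (rule agreement_measurable[OF name_in_word_space[OF GX(1)[OF pG]] name_in_word_space[OF GX(1)[OF qG]]])
      have "r = measure lebesgue {0..r}" using r by simp
      also have "\<dots> \<le> measure lebesgue (S \<union> (S1 \<union> (S2 \<union> S3)))"
        using cover fms Sm by (intro measure_mono_fmeasurable) auto
      also have "\<dots> \<le> measure lebesgue S + (measure lebesgue S1 + (measure lebesgue S2 + measure lebesgue S3))"
        using fms Sm by (meson measure_Un_le add_left_mono order.trans fmeasurableD sets.Un)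
      finally have "r \<le> measure lebesgue S + (measure lborel S1 + (measure lborel S2 + measure lborel S3))"
        using 1 2 3 by (simp add: measure_def)
      moreover have "measure lborel S1 \<le> \<epsilon> / 4 * r" using GX[OF pG] by (auto simp: B_def S1_def)
      moreover have "measure lborel S2 \<le> \<epsilon> / 4 * r" using GX[OF qG] by (auto simp: B_def S2_def)
      ultimately have "r - measure lebesgue S \<le> 5/8 * \<epsilon> * r" using m3 by (simp add: field_simps)
      also have "\<dots> < \<epsilon> * r" using \<epsilon> r by simp
      finally show ?thesis using r0 by (simp add: hamming_dist_def S_def pos_divide_less_eq)
    qed
    define rep where "rep v = (SOME p. p \<in> G \<and> idx p = v)" for v
    have rep: "rep (idx p) \<in> G" "idx (rep (idx p)) = idx p" if "p \<in> G" for p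
      using someI[of "\<lambda>q. q \<in> G \<and> idx q = idx p" p] that by (auto simp: rep_def)
    define J where "J = {0..\<lfloor>1 / w\<rfloor>} \<times> {0..\<lfloor>H / \<tau>\<rfloor>}"
    have idxJ: "idx p \<in> J" if "p \<in> G" for p
    proof -
      have b: "0 \<le> fst p" "fst p \<le> 1" "0 \<le> snd p" "snd p \<le> H"
        using GX(1,2)[OF that] X_iff[of "fst p" "snd p"] by auto
      have "fst p / w \<le> 1 / w" "snd p / \<tau> \<le> H / \<tau>" using b w \<tau> by (auto intro: divide_right_mono)
      then show ?thesis using b w \<tau> by (auto simp: J_def idx_def intro: floor_mono)
    qed
    define C where "C = (\<lambda>v. name r (rep v)) ` (idx ` G)"
    have finJ: "finite J" by (simp add: J_def)
    have idxGJ: "idx ` G \<subseteq> J" using idxJ by blast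
    then have finG: "finite (idx ` G)" using finJ by (rule finite_subset)
    have C: "finite C" "C \<subseteq> word_space k r"
    proof -
      show "finite C" unfolding C_def using finG by (rule finite_imageI)
      show "C \<subseteq> word_space k r"
      proof
        fix v assume "v \<in> C"
        then obtain p where "p \<in> G" "v = name r (rep (idx p))" by (auto simp: C_def)
        then show "v \<in> word_space k r" using name_in_word_space GX(1) rep(1) by blast
      qed
    qed
    have "cov r \<epsilon> \<beta> \<le> of_nat (card C)"
    proof (rule covering_number_le[OF C \<epsilon>(1)])
      have "G \<subseteq> {p \<in> X. \<exists>w\<in>C. hamming_dist r w (name r p) < \<epsilon>}"
      proof
        fix p assume p: "p \<in> G"
        then have "hamming_dist r (name r (rep (idx p))) (name r p) < \<epsilon>" using rep by (intro close) auto
        moreover have "name r (rep (idx p)) \<in> C" using p by (auto simp: C_def)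
        ultimately show "p \<in> {p \<in> X. \<exists>w\<in>C. hamming_dist r w (name r p) < \<epsilon>}" using GX(1)[OF p] by blast
      qed
      then have "measure M G \<le> measure M {p \<in> X. \<exists>w\<in>C. hamming_dist r w (name r p) < \<epsilon>}"
        by (intro M.finite_measure_mono name_measure_balls(2)[OF C \<epsilon>(1)])
      then show "\<beta> - \<epsilon> < measure M {p \<in> X. \<exists>w\<in>C. hamming_dist r w (name r p) < \<epsilon>}" using G \<beta> by linarith
    qed
    also have "of_nat (card C) \<le> ennreal (K * r powr ((1 + \<gamma>) * (1 + \<kappa>)))"
    proof -
      have "card C \<le> card (idx ` G)" unfolding C_def using finG by (rule card_image_le)
      also have "\<dots> \<le> card J" using finJ idxGJ by (rule card_mono)
      finally have cCJ: "real (card C) \<le> real (card J)" by simp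
      have "real (card J) = real (nat (\<lfloor>1 / w\<rfloor> + 1)) * real (nat (\<lfloor>H / \<tau>\<rfloor> + 1))"
        by (simp add: J_def card_cartesian_product)
      also have "\<dots> \<le> (2 * (1 / w)) * (H / \<tau> + 1)"
      proof (intro mult_mono)
        have fl: "real (nat (\<lfloor>v\<rfloor> + 1)) \<le> v + 1" if "0 \<le> v" for v
          using that by (simp add: of_nat_nat)
        have "1 \<le> 1 / w" using w by simp
        then show "real (nat (\<lfloor>1 / w\<rfloor> + 1)) \<le> 2 * (1 / w)" using fl[of "1 / w"] by linarith
        show "real (nat (\<lfloor>H / \<tau>\<rfloor> + 1)) \<le> H / \<tau> + 1" using H \<tau> by (intro fl) simp
      qed (use w in auto)
      also have "1 / w = 1 / a * \<sigma> powr - (1 + \<gamma>)"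
        unfolding w_def powr_minus using \<sigma> by (simp add: divide_simps)
      also have "\<sigma> powr - (1 + \<gamma>) = c powr - (1 + \<gamma>) * real n powr ((1 + \<gamma>) * (1 + \<kappa>))"
      proof -
        have "- (1 + \<kappa>) * - (1 + \<gamma>) = (1 + \<gamma>) * (1 + \<kappa>)" by (simp add: algebra_simps)
        then show ?thesis unfolding \<sigma>_def using c n1 by (simp only: powr_mult powr_powr)
      qed
      also have "2 * (1 / a * (c powr - (1 + \<gamma>) * real n powr ((1 + \<gamma>) * (1 + \<kappa>)))) * (H / \<tau> + 1)
          \<le> 2 * (1 / a * (c powr - (1 + \<gamma>) * (4 / cf * r) powr ((1 + \<gamma>) * (1 + \<kappa>)))) * (H / \<tau> + 1)"
        using n n1 a \<tau> H \<gamma> \<kappa> by (intro mult_right_mono mult_left_mono powr_mono2) auto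
      also have "(4 / cf * r) powr ((1 + \<gamma>) * (1 + \<kappa>)) = (4 / cf) powr ((1 + \<gamma>) * (1 + \<kappa>)) * r powr ((1 + \<gamma>) * (1 + \<kappa>))"
        using cf r by (intro powr_mult)
      also have "2 * (1 / a * (c powr - (1 + \<gamma>) * ((4 / cf) powr ((1 + \<gamma>) * (1 + \<kappa>)) * r powr ((1 + \<gamma>) * (1 + \<kappa>))))) * (H / \<tau> + 1)
          = K * r powr ((1 + \<gamma>) * (1 + \<kappa>))" by (simp add: K_def mult_ac)
      finally have "real (card C) \<le> K * r powr ((1 + \<gamma>) * (1 + \<kappa>))" using cCJ by linarith
      then have "ennreal (real (card C)) \<le> ennreal (K * r powr ((1 + \<gamma>) * (1 + \<kappa>)))" by (rule ennreal_leI)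
      then show ?thesis by (simp only: ennreal_of_nat_eq_real_of_nat)
    qed
    finally show "cov r \<epsilon> \<beta> \<le> ennreal (K * r powr ((1 + \<gamma>) * (1 + \<kappa>)))" .
  qed
qed

lemma growth_le:
  assumes \<epsilon>: "0 < \<epsilon>" "\<epsilon> \<le> 1" and \<beta>: "\<beta> \<le> 1"
  shows "growth \<epsilon> \<beta> \<le> ennreal (1 + \<gamma>)"
  unfolding growth_exponent_def
proof (rule Sup_least, safe)
  fix t :: real
  assume t: "0 < t" and pos: "0 < Liminf at_top (\<lambda>r. cov r \<epsilon> \<beta> / ennreal (real (nat \<lfloor>r\<rfloor>) powr t))"
  have "t \<le> 1 + \<gamma>"
  proof (rule ccontr)
    assume "\<not> t \<le> 1 + \<gamma>"
    (* halves the gap between 1 + \<gamma> and t *)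
    define \<kappa> where "\<kappa> = (t - (1 + \<gamma>)) / (2 * (1 + \<gamma>))"
    have \<kappa>: "0 < \<kappa>" using \<open>\<not> t \<le> 1 + \<gamma>\<close> \<gamma> by (simp add: \<kappa>_def)
    define u where "u = (1 + \<gamma>) * (1 + \<kappa>)"
    have u: "u < t" "0 < u"
    proof -
      have "2 * u = t + (1 + \<gamma>)" using \<gamma> by (simp add: u_def \<kappa>_def field_simps)
      then show "u < t" "0 < u" using \<open>\<not> t \<le> 1 + \<gamma>\<close> \<gamma> by simp_all
    qed
    obtain K r0 where K: "0 < K" "1 \<le> r0" "\<And>r. r0 \<le> r \<Longrightarrow> cov r \<epsilon> \<beta> \<le> ennreal (K * r powr u)"
      using covering_number_upper[OF \<epsilon> \<beta> \<kappa>] unfolding u_def by metis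
    have lim: "((\<lambda>r. ennreal (K * 2 powr t * r powr (u - t))) \<longlongrightarrow> 0) at_top"
    proof -
      have "((\<lambda>r. r powr (u - t)) \<longlongrightarrow> 0) (at_top :: real filter)"
        using u by (intro tendsto_neg_powr filterlim_ident) auto
      then have "((\<lambda>r. K * 2 powr t * r powr (u - t)) \<longlongrightarrow> K * 2 powr t * 0) (at_top :: real filter)"
        by (intro tendsto_mult_left)
      then have "((\<lambda>r. ennreal (K * 2 powr t * r powr (u - t))) \<longlongrightarrow> ennreal (K * 2 powr t * 0)) (at_top :: real filter)"
        by (rule tendsto_ennrealI)
      then show ?thesis by simp
    qed
    have "Liminf at_top (\<lambda>r. cov r \<epsilon> \<beta> / ennreal (real (nat \<lfloor>r\<rfloor>) powr t))
      \<le> Liminf at_top (\<lambda>r. ennreal (K * 2 powr t * r powr (u - t)))"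
    proof (rule Liminf_mono)
      show "\<forall>\<^sub>F r in at_top. cov r \<epsilon> \<beta> / ennreal (real (nat \<lfloor>r\<rfloor>) powr t) \<le> ennreal (K * 2 powr t * r powr (u - t))"
        using eventually_ge_at_top[of "max 1 r0"]
      proof eventually_elim
        case (elim r)
        define n where "n = real (nat \<lfloor>r\<rfloor>)"
        have r: "1 \<le> r" "r0 \<le> r" using elim by auto
        have "n = of_int \<lfloor>r\<rfloor>" using r by (simp add: n_def)
        moreover have "1 \<le> \<lfloor>r\<rfloor>" using r by (simp add: le_floor_iff)
        ultimately have n: "1 \<le> n" "r / 2 \<le> n" by linarith+
        have np: "0 < n powr t" using n by simp
        have "cov r \<epsilon> \<beta> / ennreal (n powr t) \<le> ennreal (K * r powr u) / ennreal (n powr t)"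
          using K(3)[OF r(2)] by (rule divide_right_mono_ennreal)
        also have "\<dots> = ennreal (K * r powr u / n powr t)" using K np by (intro divide_ennreal) auto
        also have "\<dots> \<le> ennreal (K * 2 powr t * r powr (u - t))"
        proof (rule ennreal_leI)
          have "(r / 2) powr t \<le> n powr t" using n r t by (intro powr_mono2) auto
          then have "K * r powr u / n powr t \<le> K * r powr u / (r / 2) powr t"
            using K r np by (intro divide_left_mono) auto
          also have "\<dots> = K * 2 powr t * r powr (u - t)" using r by (simp add: powr_divide powr_diff)
          finally show "K * r powr u / n powr t \<le> K * 2 powr t * r powr (u - t)" .
        qed
        finally show ?case by (simp add: n_def)
      qed
    qed
    also have "\<dots> = 0" using lim by (intro lim_imp_Liminf) auto
    finally show False using pos by simp
  qed
  then show "ennreal t \<le> ennreal (1 + \<gamma>)" by (rule ennreal_leI)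
qed

lemma partition_entropy_le:
  assumes "\<beta> \<le> 1"
  shows "partition_entropy (\<lambda>n t. real n powr t) M (special_flow \<alpha> f) k P \<beta> \<le> ennreal (1 + \<gamma>)"
  unfolding partition_entropy_eq
proof (rule SUP_least)
  fix \<epsilon> :: real assume "\<epsilon> \<in> {0<..}"
  then have "growth \<epsilon> \<beta> \<le> growth (min \<epsilon> 1) \<beta>" by (intro growth_antimono) auto
  also have "\<dots> \<le> ennreal (1 + \<gamma>)" using \<open>\<epsilon> \<in> {0<..}\<close> assms by (intro growth_le) auto
  finally show "growth \<epsilon> \<beta> \<le> ennreal (1 + \<gamma>)" .
qed

end

context kochergin
begin

theorem slow_entropy_le:
  assumes "\<beta> \<le> 1"
  shows "slow_entropy (\<lambda>n t. real n powr t) \<beta> M (special_flow \<alpha> f) \<le> ennreal (1 + \<gamma>)"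
  unfolding slow_entropy_def
proof (rule SUP_least, clarsimp)
  fix k P assume "finite_measurable_partition M k P"
  then interpret kochergin_partition \<alpha> \<gamma> f f' f'' cf Cf k P by unfold_locales
  show "partition_entropy (\<lambda>n t. real n powr t) M (special_flow \<alpha> f) k P \<beta> \<le> ennreal (1 + \<gamma>)"
    by (rule partition_entropy_le[OF assms])
qed

end

section \<open>The slow entropy\<close>

theorem theorem1p2:
  fixes \<alpha> \<beta> \<gamma> :: real and f :: "real \<Rightarrow> real"
  assumes "0 < \<beta>" "\<beta> \<le> 1"
    and "\<alpha> \<in> diophantine_set"
    and "0 < \<gamma>" "\<gamma> < 1"
    and "kochergin_roof \<gamma> f"
  shows "slow_entropy (\<lambda>n t. real n powr t) \<beta> (special_flow_measure \<alpha> f) (special_flow \<alpha> f)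
           = ennreal (1 + \<gamma>)"
proof -
  obtain c C where "singular_roof \<gamma> f (deriv f) (deriv (deriv f)) c C"
    using kochergin_roof_singular_roof[OF assms(6,4,5)] by blast
  then interpret kochergin \<alpha> \<gamma> f "deriv f" "deriv (deriv f)" c C
    using assms by unfold_locales
  show ?thesis
    using slow_entropy_le[OF assms(2)] slow_entropy_ge[OF assms(1,2)] by (rule antisym)
qed

end
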